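(* Let $\Gamma$ be a bipartite distance-regular graph with vertex set $X$ and diameter $d\geqslant 6$ which is $Q$-polynomial with respect to the ordering $\{E_i\}_{i=0}^d$ of its primitive idempotents. Fix $x\in X$, and let $\Gamma_d=\Gamma_d(x)$ and $\Gamma_d^2=\Gamma_d^2(x)$, the graph with vertex set $\Gamma_d$ in which $y,z$ are adjacent if and only if $\partial(y,z)=2$. Suppose $\Gamma_d^2$ has diameter $\lfloor d/2\rfloor$. If $Y$ is a descendent of a halved graph of $\Gamma$ with width $w$, then $Y\cap\Gamma_d$ is a descendent of $\Gamma_d^2$ with width $w$, provided that $Y\cap\Gamma_d$ is nonempty.
   Context: All graphs are finite, simple and undirected. Let $\Gamma$ be a connected graph with vertex set $X$, path-length distance $\partial$ and diameter $d$; write $\Gamma_i(x)=\{y\in X:\partial(x,y)=i\}$, and let $A_i\in\mathbb{C}^{X\times X}$ be the adjacency matrix of the distance-$i$ graph ($A_0=I$). $\Gamma$ is distance-regular if there are integers $b_i,c_i$ such that whenever $\partial(x,y)=i$, $y$ has exactly $b_i$ (resp. $c_i$) neighbours at distance $i+1$ (resp. $i-1$) from $x$. Then the Bose--Mesner algebra $\boldsymbol{A}=\langle A_0,\dots,A_d\rangle$ (complex span) is a commutative semisimple algebra with a basis of primitive idempotents $E_0=|X|^{-1}J,E_1,\dots,E_d$. $\Gamma$ is $Q$-polynomial with respect to the ordering $\{E_i\}_{i=0}^d$ if there are scalars $a_i^*,b_i^*,c_i^*$ with $b_d^*=c_0^*=0$, $b_{i-1}^*c_i^*\neq 0$ $(1\leqslant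 i\leqslant d)$ and $E_1\circ E_i=|X|^{-1}(b_{i-1}^*E_{i-1}+a_i^*E_i+c_{i+1}^*E_{i+1})$ $(0\leqslant i\leqslant d)$, where $\circ$ is the entrywise product, $E_{-1}=E_{d+1}=0$, $b_{-1}^*=c_{d+1}^*=0$. For a nonempty subset $Y$ of the vertices of a $Q$-polynomial distance-regular graph with diameter $D$, distance matrices $A_i$ and $Q$-polynomial ordering $\{E_i\}_{i=0}^{D}$, with characteristic vector $\hat Y$, the width is $w=\max\{i:\hat Y^{\mathsf T}A_i\hat Y\neq 0\}$ and the dual width is $w^*=\max\{i:\hat Y^{\mathsf T}E_i\hat Y\neq 0\}$; always $w+w^*\geqslant D$, and $Y$ is a descendent if $w+w^*=D$. Halved graphs: for $\Gamma$ bipartite with bipartition $X=X^+\cup X^-$, the halved graphs are the graphs on $X^+$ and on $X^-$ with adjacency $\partial=2$. They are distance-regular with diameter $\lfloor d/2\rfloor$, and $Q$-polynomial with respect to the ordering whose $j$-th idempotent $(0\leqslant j\leqslant\lfloor d/2\rfloor)$ is the restriction to $X^{\pm}$ of $E_j+E_{d-j}$ if $j\neq d/2$ (of $E_{d/2}$ if $j=d/2$). Descendents of a halved graph are taken with respect to this ordering. The graph $\Gamma_d^2$: it is known (Caughman) that $\Gamma_d^2$ is distance-regular and $Q$-polynomial, with diameter equal to half the width of $\Gamma_d$. Its $Q$-polynomial ordering is the following. Let $E_i^*=\mathrm{diag}(A_i\hat x)$, where $\hat x$ is the unit coordinate vector at $x$, and let $\boldsymbol{T}$ be the subalgebra of $\mathbb{C}^{X\times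 X}$ generated by $\boldsymbol{A}$ and $E_0^*,\dots,E_d^*$. For an irreducible $\boldsymbol{T}$-module $W\subseteq\mathbb{C}^X$ the endpoint is $\min\{i:E_i^*W\neq0\}$ and the dual endpoint is $\min\{i:E_iW\neq 0\}$. Let $U_{ij}$ be the sum of the irreducible $\boldsymbol{T}$-modules in $\mathbb{C}^X$ with endpoint $i$ and dual endpoint $j$. Then $E_d^*\mathbb{C}^X=\bigoplus_{j=0}^{\lfloor d/2\rfloor}E_d^*U_{2j,j}$ (orthogonal direct sum), and when $\Gamma_d^2$ has diameter $\lfloor d/2\rfloor$ the spaces $E_d^*U_{2j,j}$ $(j=0,1,\dots,\lfloor d/2\rfloor)$, in this order, are the eigenspaces of $\Gamma_d^2$ in its $Q$-polynomial ordering. Descendents of $\Gamma_d^2$ are taken with respect to this ordering. *)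

theory Defs
  imports "HOL-Analysis.Analysis"
begin

text \<open>
  A graph is given by a vertex set \<open>V\<close> inside a finite type and an adjacency relation
  \<open>R\<close>, a set of ordered pairs.  Matrices of \<open>\<complex>\<^sup>V\<^sup>\<times>\<^sup>V\<close> and vectors of
  \<open>\<complex>\<^sup>V\<close> are padded with zeros to the whole type, so that graphs on subsets of
  the vertices of another graph need no type of their own.
\<close>

section \<open>Graphs\<close>

definition simple_graph :: "'v::finite set \<Rightarrow> 'v rel \<Rightarrow> bool" where
  "simple_graph V R \<longleftrightarrow> R \<subseteq> V \<times> V \<and> sym R \<and> irrefl R"

definition connected_graph :: "'v::finite set \<Rightarrow> 'v rel \<Rightarrow> bool" where
  "connected_graph V R \<longleftrightarrow> V \<noteq> {} \<and> (\<forall>u\<in>V. \<forall>v\<in>V. (u, v) \<in> R\<^sup>*)"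

text \<open>Only meaningful when a walk from \<open>u\<close> to \<open>v\<close> exists.\<close>

definition gdist :: "'v rel \<Rightarrow> 'v \<Rightarrow> 'v \<Rightarrow> nat" where
  "gdist R u v = (LEAST n. (u, v) \<in> R ^^ n)"

definition diameter_of :: "'v::finite set \<Rightarrow> 'v rel \<Rightarrow> nat" where
  "diameter_of V R = Max {gdist R u v |u v. u \<in> V \<and> v \<in> V}"

text \<open>A graph with a (finite) diameter is in particular connected.\<close>

definition has_diameter :: "'v::finite set \<Rightarrow> 'v rel \<Rightarrow> nat \<Rightarrow> bool" where
  "has_diameter V R D \<longleftrightarrow> connected_graph V R \<and> diameter_of V R = D"

definition distance_regular :: "'v::finite set \<Rightarrow> 'v rel \<Rightarrow> bool" where
  "distance_regular V R \<longleftrightarrow> simple_graph V R \<and> connected_graph V R \<and>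
     (\<exists>b c :: nat \<Rightarrow> nat. \<forall>x\<in>V. \<forall>y\<in>V.
        card {z\<in>V. (y, z) \<in> R \<and> gdist R x z = gdist R x y + 1} = b (gdist R x y) \<and>
        card {z\<in>V. (y, z) \<in> R \<and> gdist R x z + 1 = gdist R x y} = c (gdist R x y))"

definition bipartition :: "'v::finite set \<Rightarrow> 'v rel \<Rightarrow> 'v set \<Rightarrow> 'v set \<Rightarrow> bool" where
  "bipartition V R P N \<longleftrightarrow> P \<union> N = V \<and> P \<inter> N = {} \<and>
     (\<forall>(u, v)\<in>R. (u \<in> P \<and> v \<in> N) \<or> (u \<in> N \<and> v \<in> P))"

text \<open>The graph on \<open>H\<close> in which adjacency is being at distance 2 in the ambient graph.\<close>

definition dist2_edges :: "'v rel \<Rightarrow> 'v set \<Rightarrow> 'v rel" where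
  "dist2_edges R H = {(u, v). u \<in> H \<and> v \<in> H \<and> gdist R u v = 2}"

definition sphere_at :: "'v::finite set \<Rightarrow> 'v rel \<Rightarrow> nat \<Rightarrow> 'v \<Rightarrow> 'v set" where
  "sphere_at V R i x = {y\<in>V. gdist R x y = i}"


section \<open>Bose--Mesner algebra and $Q$-polynomial orderings\<close>

definition mscale :: "complex \<Rightarrow> complex^'n^'m \<Rightarrow> complex^'n^'m" where
  "mscale k M = (\<chi> u v. k * M $ u $ v)"

definition hadamard :: "complex^'n^'m \<Rightarrow> complex^'n^'m \<Rightarrow> complex^'n^'m" where
  "hadamard M N = (\<chi> u v. M $ u $ v * N $ u $ v)"

definition dist_matrix :: "'v::finite set \<Rightarrow> 'v rel \<Rightarrow> nat \<Rightarrow> complex^'v^'v" where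
  "dist_matrix V R i = (\<chi> u v. if u \<in> V \<and> v \<in> V \<and> gdist R u v = i then 1 else 0)"

definition all_ones :: "'v::finite set \<Rightarrow> complex^'v^'v" where
  "all_ones V = (\<chi> u v. if u \<in> V \<and> v \<in> V then 1 else 0)"

definition bose_mesner :: "'v::finite set \<Rightarrow> 'v rel \<Rightarrow> (complex^'v^'v) set" where
  "bose_mesner V R = {\<Sum>i\<le>diameter_of V R. mscale (k i) (dist_matrix V R i) |k. True}"

definition primitive_idempotent :: "(complex^'v^'v) set \<Rightarrow> complex^'v::finite^'v \<Rightarrow> bool" where
  "primitive_idempotent \<A> e \<longleftrightarrow> e \<in> \<A> \<and> e \<noteq> 0 \<and> e ** e = e \<and>
     \<not> (\<exists>f\<in>\<A>. \<exists>g\<in>\<A>. f \<noteq> 0 \<and> g \<noteq> 0 \<and> f ** f = f \<and> g ** g = g \<and>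
            f ** g = 0 \<and> g ** f = 0 \<and> e = f + g)"

text \<open>
  \<open>E\<close> is an ordering \<open>E 0, \<dots>, E d\<close> of the primitive idempotents, \<open>d\<close> being the diameter
  (values of \<open>E\<close> beyond \<open>d\<close> are irrelevant), with respect to which the graph is
  \<open>Q\<close>-polynomial.
\<close>

definition Q_polynomial ::
    "'v::finite set \<Rightarrow> 'v rel \<Rightarrow> (nat \<Rightarrow> complex^'v^'v) \<Rightarrow> bool" where
  "Q_polynomial V R E \<longleftrightarrow> (let d = diameter_of V R; q = 1 / of_nat (card V) in
     bij_betw E {..d} {e. primitive_idempotent (bose_mesner V R) e} \<and>
     E 0 = mscale q (all_ones V) \<and>
     (\<exists>as bs cs :: nat \<Rightarrow> complex. bs d = 0 \<and> cs 0 = 0 \<and>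
        (\<forall>i\<in>{1..d}. bs (i - 1) * cs i \<noteq> 0) \<and>
        (\<forall>i\<le>d. hadamard (E 1) (E i) =
           mscale q ((if i = 0 then 0 else mscale (bs (i - 1)) (E (i - 1)))
                     + mscale (as i) (E i)
                     + (if i = d then 0 else mscale (cs (i + 1)) (E (i + 1)))))))"


section \<open>Width, dual width, descendents\<close>

definition char_vec :: "'v::finite set \<Rightarrow> complex^'v" where
  "char_vec Y = (\<chi> u. if u \<in> Y then 1 else 0)"

text \<open>\<open>Y\<^sup>T M Y\<close> for the (real) characteristic vector of \<open>Y\<close>.\<close>

definition qform :: "complex^'v::finite^'v \<Rightarrow> 'v set \<Rightarrow> complex" where
  "qform M Y = (\<Sum>u\<in>UNIV. char_vec Y $ u * (M *v char_vec Y) $ u)"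

definition width :: "'v::finite set \<Rightarrow> 'v rel \<Rightarrow> 'v set \<Rightarrow> nat" where
  "width V R Y = Max {i. i \<le> diameter_of V R \<and> qform (dist_matrix V R i) Y \<noteq> 0}"

definition dual_width ::
    "'v::finite set \<Rightarrow> 'v rel \<Rightarrow> (nat \<Rightarrow> complex^'v^'v) \<Rightarrow> 'v set \<Rightarrow> nat" where
  "dual_width V R F Y = Max {i. i \<le> diameter_of V R \<and> qform (F i) Y \<noteq> 0}"

text \<open>Used when \<open>F\<close> is the given \<open>Q\<close>-polynomial ordering of the graph \<open>(V, R)\<close>.\<close>

definition descendent ::
    "'v::finite set \<Rightarrow> 'v rel \<Rightarrow> (nat \<Rightarrow> complex^'v^'v) \<Rightarrow> 'v set \<Rightarrow> bool" where
  "descendent V R F Y \<longleftrightarrow> Y \<noteq> {} \<and> Y \<subseteq> V \<and>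
     width V R Y + dual_width V R F Y = diameter_of V R"


section \<open>The ordering of the idempotents of a halved graph\<close>

definition restrict_mat :: "'v::finite set \<Rightarrow> complex^'v^'v \<Rightarrow> complex^'v^'v" where
  "restrict_mat H M = (\<chi> u v. if u \<in> H \<and> v \<in> H then M $ u $ v else 0)"

definition halved_idempotent ::
    "'v::finite set \<Rightarrow> nat \<Rightarrow> (nat \<Rightarrow> complex^'v^'v) \<Rightarrow> nat \<Rightarrow> complex^'v^'v" where
  "halved_idempotent H d E j =
     restrict_mat H (if 2 * j = d then E j else E j + E (d - j))"


section \<open>Terwilliger algebra\<close>

text \<open>
  From here on the graph has the whole type as its vertex set, so that modules are complex
  subspaces (\<open>vec.subspace\<close>) of the full coordinate space.
\<close>

definition dual_idempotent :: "'v::finite rel \<Rightarrow> 'v \<Rightarrow> nat \<Rightarrow> complex^'v^'v" where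
  "dual_idempotent R x i =
     (\<chi> u v. if u = v then (dist_matrix UNIV R i *v axis x 1) $ u else 0)"

inductive_set terwilliger :: "'v::finite rel \<Rightarrow> 'v \<Rightarrow> (complex^'v^'v) set"
  for R :: "'v rel" and x :: 'v where
  bm: "M \<in> bose_mesner UNIV R \<Longrightarrow> M \<in> terwilliger R x"
| dual: "i \<le> diameter_of UNIV R \<Longrightarrow> dual_idempotent R x i \<in> terwilliger R x"
| add: "M \<in> terwilliger R x \<Longrightarrow> N \<in> terwilliger R x \<Longrightarrow> M + N \<in> terwilliger R x"
| scale: "M \<in> terwilliger R x \<Longrightarrow> mscale k M \<in> terwilliger R x"
| mult: "M \<in> terwilliger R x \<Longrightarrow> N \<in> terwilliger R x \<Longrightarrow> M ** N \<in> terwilliger R x"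

definition T_module :: "'v::finite rel \<Rightarrow> 'v \<Rightarrow> (complex^'v) set \<Rightarrow> bool" where
  "T_module R x W \<longleftrightarrow> vec.subspace W \<and> (\<forall>M\<in>terwilliger R x. \<forall>w\<in>W. M *v w \<in> W)"

definition irreducible_T_module :: "'v::finite rel \<Rightarrow> 'v \<Rightarrow> (complex^'v) set \<Rightarrow> bool" where
  "irreducible_T_module R x W \<longleftrightarrow> T_module R x W \<and> W \<noteq> {0} \<and>
     (\<forall>W'. T_module R x W' \<and> W' \<subseteq> W \<longrightarrow> W' = {0} \<or> W' = W)"

definition endpoint :: "'v::finite rel \<Rightarrow> 'v \<Rightarrow> (complex^'v) set \<Rightarrow> nat" where
  "endpoint R x W =
     Min {i. i \<le> diameter_of UNIV R \<and> (*v) (dual_idempotent R x i) ` W \<noteq> {0}}"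

definition dual_endpoint ::
    "'v::finite rel \<Rightarrow> (nat \<Rightarrow> complex^'v^'v) \<Rightarrow> (complex^'v) set \<Rightarrow> nat" where
  "dual_endpoint R E W = Min {i. i \<le> diameter_of UNIV R \<and> (*v) (E i) ` W \<noteq> {0}}"

definition U_space ::
    "'v::finite rel \<Rightarrow> (nat \<Rightarrow> complex^'v^'v) \<Rightarrow> 'v \<Rightarrow> nat \<Rightarrow> nat \<Rightarrow> (complex^'v) set" where
  "U_space R E x i j =
     vec.span (\<Union>{W. irreducible_T_module R x W \<and> endpoint R x W = i \<and> dual_endpoint R E W = j})"


section \<open>The ordering of the idempotents of the last subconstituent\<close>

definition hermitian_mat :: "complex^'v^'v \<Rightarrow> bool" where
  "hermitian_mat P \<longleftrightarrow> (\<forall>u v. P $ u $ v = cnj (P $ v $ u))"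

text \<open>The orthogonal projection (for the Hermitian inner product) onto a complex subspace.\<close>

definition orth_proj :: "(complex^'v::finite) set \<Rightarrow> complex^'v^'v" where
  "orth_proj W = (THE P. hermitian_mat P \<and> P ** P = P \<and> range ((*v) P) = W)"

text \<open>
  The \<open>j\<close>-th eigenspace in the ordering is the image of \<open>U_space R E x (2 * j) j\<close> under the
  last dual idempotent.  The adjacency matrix is real symmetric, so the idempotent belonging
  to an eigenspace is the orthogonal projection onto it.
\<close>

definition last_idempotent ::
    "'v::finite rel \<Rightarrow> (nat \<Rightarrow> complex^'v^'v) \<Rightarrow> 'v \<Rightarrow> nat \<Rightarrow> complex^'v^'v" where
  "last_idempotent R E x j =
     orth_proj ((*v) (dual_idempotent R x (diameter_of UNIV R)) ` U_space R E x (2 * j) j)"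

end

theory Submission
  imports Defs
begin

text \<open>
  Let \<open>T\<close> be the restriction of \<open>A\<^sup>2\<close> to \<open>\<Gamma>\<^sub>d\<close>, which is the adjacency matrix of \<open>\<Gamma>\<^sub>d\<^sup>2\<close> up to scaling
  and a multiple of the identity.

  The tridiagonal relation for \<open>A\<close> and the dual adjacency matrix \<open>A\<^sup>*\<close> shows that the restriction
  of \<open>A\<^sub>2\<^sub>i\<close> to \<open>\<Gamma>\<^sub>d\<close> is a polynomial of degree at most \<open>i\<close> in \<open>T\<close>.  Hence distances in \<open>\<Gamma>\<^sub>d\<^sup>2\<close> are
  half of those in \<open>\<Gamma>\<close>, and every vertex of \<open>\<Gamma>\<^sub>d\<^sup>2\<close> has the same eccentricity, so that passing
  from \<open>Y\<close> to \<open>Y \<inter> \<Gamma>\<^sub>d\<close> does not increase the width.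

  An irreducible module of dual endpoint \<open>j\<close> that meets \<open>E\<^sub>d\<^sup>*V\<close> has endpoint \<open>2j\<close>, lives on
  \<open>E\<^sub>j, \<dots>, E\<^bsub>d-j\<^esub>\<close>, and \<open>T\<close> acts on its last component as a scalar depending only on \<open>j\<close>.  If \<open>j\<close>
  exceeds the dual width of \<open>Y\<close>, the characteristic vector of \<open>Y\<close> is orthogonal to such a module,
  so the dual width does not increase either.

  Finally, a set whose characteristic vector involves only \<open>m + 1\<close> eigenvalues of \<open>T\<close> has covering
  radius at most \<open>m\<close>; hence width and dual width add up to at least the diameter, and both
  inequalities are equalities.
\<close>

section \<open>Hermitian geometry\<close>

text \<open>The obstacle for distances is that an \<open>A\<close>-walk between two vertices of
  \<open>K\<close> may descend many levels towards \<open>x\<close>, whereas one step of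
  \<open>R2\<close> descends a single level and returns. The tridiagonal relation rewrites an ascent
  after \<open>k\<close> descents as \<open>k - 1\<close> descents after a linear polynomial in
  \<open>T\<close>, so that deep excursions become shallow ones. The ordering of the eigenspaces is
  given only through irreducible modules. That their parts on level \<open>d\<close> span this
  level, are eigenspaces of \<open>T\<close> and are pairwise orthogonal has to be derived. Spanning
  comes from complete reducibility and the value of the endpoint. Orthogonality needs distinct
  eigenvalues, and the diameter supplies them: for a single vertex, the covering radius bound
  demands \<open>d div 2 + 1\<close> different values. The common eccentricity is what turns a
  covering radius into a bound on the width: some vertex lies at full distance from a chosen member
  of the set, another member lies close to that vertex, and the triangle inequality separates the
  two members.\<close>

definition cip :: "complex^'v::finite \<Rightarrow> complex^'v \<Rightarrow> complex" where
  "cip u v = (\<Sum>i\<in>UNIV. cnj (u $ i) * v $ i)"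

definition adj :: "complex^'v::finite^'v \<Rightarrow> complex^'v^'v" where
  "adj M = (\<chi> u v. cnj (M $ v $ u))"

definition ocomp :: "(complex^'v::finite) set \<Rightarrow> (complex^'v) set" where
  "ocomp W = {v. \<forall>w\<in>W. cip w v = 0}"

lemma cip_add_right: "cip u (v + w) = cip u v + cip u w"
  by (simp add: cip_def algebra_simps sum.distrib)

lemma cip_add_left: "cip (u + v) w = cip u w + cip v w"
  by (simp add: cip_def algebra_simps sum.distrib)

lemma cip_scale_right: "cip u (c *s v) = c * cip u v"
  by (simp add: cip_def sum_distrib_left mult_ac)

lemma cip_scale_left: "cip (c *s u) v = cnj c * cip u v"
  by (simp add: cip_def sum_distrib_left mult_ac)

lemma cip_zero [simp]: "cip 0 v = 0" "cip v 0 = 0"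
  by (simp_all add: cip_def)

lemma cip_sum_right: "cip u (\<Sum>j\<in>J. f j) = (\<Sum>j\<in>J. cip u (f j))"
  by (induction J rule: infinite_finite_induct) (simp_all add: cip_add_right)

lemma cip_commute: "cip v u = cnj (cip u v)"
  by (simp add: cip_def mult.commute)

lemma cip_eq_0_commute: "cip u v = 0 \<longleftrightarrow> cip v u = 0"
  by (subst cip_commute) simp

lemma cip_self: "cip v v = of_real (\<Sum>i\<in>UNIV. (cmod (v $ i))\<^sup>2)"
  unfolding cip_def of_real_sum
  by (intro sum.cong refl) (metis complex_norm_square mult.commute)

lemma cip_self_eq_0: "cip v v = 0 \<longleftrightarrow> v = 0"
proof -
  have "cip v v = 0 \<longleftrightarrow> (\<Sum>i\<in>UNIV. (cmod (v $ i))\<^sup>2) = 0"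
    unfolding cip_self of_real_eq_0_iff ..
  also have "\<dots> \<longleftrightarrow> v = 0"
    by (subst sum_nonneg_eq_0_iff) (auto simp: vec_eq_iff)
  finally show ?thesis .
qed

lemma cip_adj: "cip (M *v u) v = cip u (adj M *v v)"
proof -
  have "cip (M *v u) v = (\<Sum>i\<in>UNIV. \<Sum>j\<in>UNIV. cnj (M $ i $ j) * cnj (u $ j) * v $ i)"
    by (simp add: cip_def matrix_vector_mult_def sum_distrib_right)
  also have "\<dots> = (\<Sum>j\<in>UNIV. \<Sum>i\<in>UNIV. cnj (M $ i $ j) * cnj (u $ j) * v $ i)"
    by (rule sum.swap)
  also have "\<dots> = cip u (adj M *v v)"
    by (simp add: cip_def adj_def matrix_vector_mult_def sum_distrib_left mult_ac)
  finally show ?thesis .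
qed

lemma hermitian_mat_iff_adj: "hermitian_mat P \<longleftrightarrow> adj P = P"
  unfolding hermitian_mat_def adj_def vec_eq_iff vec_lambda_beta by metis

lemma adj_adj [simp]: "adj (adj M) = M"
  by (simp add: adj_def vec_eq_iff)

lemma adj_mscale: "adj (mscale c M) = mscale (cnj c) (adj M)"
  by (simp add: adj_def mscale_def vec_eq_iff)

lemma adj_mult: "adj (M ** N) = adj N ** adj M"
  by (simp add: adj_def matrix_matrix_mult_def vec_eq_iff mult.commute)

lemma inner_eq_Re_cip: "inner u v = Re (cip u v)"
  by (simp add: inner_vec_def cip_def inner_complex_def)

lemma subspace_ocomp: "vec.subspace (ocomp W)"
  by (simp add: vec.subspace_def ocomp_def cip_add_right cip_scale_right)

lemma ocomp_inter: "v \<in> W \<Longrightarrow> v \<in> ocomp W \<Longrightarrow> v = 0"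
  using cip_self_eq_0 unfolding ocomp_def by blast

text \<open>The decomposition is taken over the reals. For a complex subspace real orthogonality
  implies Hermitian orthogonality: testing against \<open>w\<close> gives the real part of
  \<open>cip w q\<close>, and testing against \<open>\<i> *s w\<close> gives the imaginary
  part.\<close>

lemma orthogonal_decomposition:
  assumes "vec.subspace W"
  obtains p q where "p \<in> W" "q \<in> ocomp W" "v = p + q"
proof -
  have rs: "subspace W"
    unfolding subspace_def
  proof (intro conjI allI ballI)
    fix c :: real and w assume "w \<in> W"
    then have "complex_of_real c *s w \<in> W"
      using assms vec.subspace_scale by blast
    moreover have "complex_of_real c *s w = c *\<^sub>R w"
      unfolding vec_eq_iff by (simp add: complex_eq_iff)
    ultimately show "c *\<^sub>R w \<in> W" by simp
  qed (use assms vec.subspace_0 vec.subspace_add in auto)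
  obtain p q where pq: "p \<in> span W" "\<And>w. w \<in> span W \<Longrightarrow> orthogonal q w" "v = p + q"
    using orthogonal_subspace_decomp_exists by metis
  have sp: "span W = W"
    using rs span_eq_iff by blast
  have "q \<in> ocomp W"
    unfolding ocomp_def
  proof (intro CollectI ballI)
    fix w assume w: "w \<in> W"
    then have iw: "\<i> *s w \<in> W"
      using assms vec.subspace_scale by blast
    have "Re (cip w q) = 0" "Re (cip (\<i> *s w) q) = 0"
      using pq(2)[of w] pq(2)[of "\<i> *s w"] w iw
      by (auto simp: sp orthogonal_def inner_commute inner_eq_Re_cip[symmetric])
    then show "cip w q = 0"
      by (simp add: cip_scale_left complex_eq_iff)
  qed
  then show thesis
    using that pq sp by blast
qed

lemma vec_linear_matrix:
  fixes f :: "complex^'v::finite \<Rightarrow> complex^'v"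
  assumes "\<And>u v. f (u + v) = f u + f v" "\<And>c v. f (c *s v) = c *s f v"
  shows "matrix f *v v = f v"
proof -
  have "Vector_Spaces.linear (*s) (*s) f"
    by unfold_locales (simp_all add: assms)
  then show ?thesis by (rule matrix_works)
qed

lemma orth_proj_exists:
  assumes W: "vec.subspace W"
  shows "\<exists>P. hermitian_mat P \<and> P ** P = P \<and> range ((*v) P) = W"
proof -
  have "\<exists>p. \<forall>v. p v \<in> W \<and> v - p v \<in> ocomp W"
  proof (rule choice, rule allI)
    fix v show "\<exists>p. p \<in> W \<and> v - p \<in> ocomp W"
      using orthogonal_decomposition[OF W, of v] by (metis add_diff_cancel_left')
  qed
  then obtain p where p: "\<And>v. p v \<in> W" "\<And>v. v - p v \<in> ocomp W" by blast
  have uniq: "a = p v" if "a \<in> W" "v - a \<in> ocomp W" for a v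
  proof -
    have "a - p v \<in> W" using that(1) p(1) W vec.subspace_diff by blast
    moreover have "(v - p v) - (v - a) \<in> ocomp W"
      using that(2) p(2) subspace_ocomp vec.subspace_diff by blast
    ultimately show ?thesis using ocomp_inter by force
  qed
  have add: "p (u + v) = p u + p v" for u v
  proof (rule uniq[symmetric])
    show "p u + p v \<in> W" using p(1) W vec.subspace_add by blast
    have "(u - p u) + (v - p v) \<in> ocomp W" using p(2) subspace_ocomp vec.subspace_add by blast
    then show "u + v - (p u + p v) \<in> ocomp W" by (simp add: algebra_simps)
  qed
  have scale: "p (c *s v) = c *s p v" for c v
  proof (rule uniq[symmetric])
    show "c *s p v \<in> W" using p(1) W vec.subspace_scale by blast
    have "c *s (v - p v) \<in> ocomp W" using p(2) subspace_ocomp vec.subspace_scale by blast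
    then show "c *s v - c *s p v \<in> ocomp W" by (simp add: vector_sub_rdistrib vec.scale_right_diff_distrib)
  qed
  have fixes_W: "p w = w" if "w \<in> W" for w
    by (rule uniq[OF that, symmetric]) (simp add: vec.subspace_0[OF subspace_ocomp])
  define P where "P = matrix p"
  have P: "P *v v = p v" for v
    unfolding P_def using add scale by (rule vec_linear_matrix)
  have "cip (P *v u) v = cip u (P *v v)" for u v
  proof -
    have "cip (p u) (v - p v) = 0" using p unfolding ocomp_def by blast
    moreover have "cip (u - p u) (p v) = 0"
      using p cip_eq_0_commute unfolding ocomp_def by blast
    moreover have "cip (p u) v = cip (p u) (v - p v) + cip (p u) (p v)"
      by (simp flip: cip_add_right)
    moreover have "cip u (p v) = cip (u - p u) (p v) + cip (p u) (p v)"
      by (simp flip: cip_add_left)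
    ultimately show ?thesis by (simp add: P)
  qed
  then have *: "cip u ((adj P - P) *v v) = 0" for u v
    using cip_adj[of P u v] cip_add_right[of u "(adj P - P) *v v" "P *v v"]
    by (simp add: matrix_vector_mult_diff_rdistrib)
  have "(adj P - P) *v v = 0 *v v" for v
    using *[of "(adj P - P) *v v" v] by (simp add: cip_self_eq_0)
  then have "adj P - P = 0" by (simp add: matrix_eq)
  then have "hermitian_mat P" by (simp add: hermitian_mat_iff_adj)
  moreover have "P ** P = P"
    by (simp add: matrix_eq P p fixes_W flip: matrix_vector_mul_assoc)
  moreover have "range ((*v) P) = W"
  proof
    show "range ((*v) P) \<subseteq> W" using p(1) by (auto simp: P)
    show "W \<subseteq> range ((*v) P)" using fixes_W P by (metis rangeI subsetI)
  qed
  ultimately show ?thesis by blast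
qed

text \<open>Existence and uniqueness give the definite description its meaning. Two such projections
  with the same range satisfy \<open>Q ** P = P\<close> and \<open>P ** Q = Q\<close>, and taking
  adjoints yields \<open>P = Q\<close>.\<close>

lemma orth_proj:
  assumes W: "vec.subspace W"
  shows "hermitian_mat (orth_proj W)" "orth_proj W ** orth_proj W = orth_proj W"
    "range ((*v) (orth_proj W)) = W"
proof -
  let ?p = "\<lambda>P. hermitian_mat P \<and> P ** P = P \<and> range ((*v) P) = W"
  obtain P where P: "?p P" using orth_proj_exists[OF W] by blast
  have "Q = P" if Q: "?p Q" for Q
  proof -
    have QP: "Q *v (P *v v) = P *v v" for v
    proof -
      obtain u where "P *v v = Q *v u" using P Q by (metis rangeE rangeI)
      then show ?thesis using Q by (simp add: matrix_vector_mul_assoc)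
    qed
    have PQ: "P *v (Q *v v) = Q *v v" for v
    proof -
      obtain u where "Q *v v = P *v u" using P Q by (metis rangeE rangeI)
      then show ?thesis using P by (simp add: matrix_vector_mul_assoc)
    qed
    have "Q ** P = P" "P ** Q = Q"
      by (simp_all add: matrix_eq QP PQ flip: matrix_vector_mul_assoc)
    then show ?thesis
      using P Q by (metis adj_mult hermitian_mat_iff_adj)
  qed
  then have "?p (orth_proj W)"
    unfolding orth_proj_def by (rule theI[of ?p P, OF P])
  then show "hermitian_mat (orth_proj W)" "orth_proj W ** orth_proj W = orth_proj W"
    "range ((*v) (orth_proj W)) = W" by auto
qed

lemma orth_proj_fixes:
  assumes "vec.subspace W" "w \<in> W"
  shows "orth_proj W *v w = w"
proof -
  obtain u where "w = orth_proj W *v u" using orth_proj(3)[OF assms(1)] assms(2) by blast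
  then show ?thesis using orth_proj(2)[OF assms(1)] by (simp add: matrix_vector_mul_assoc)
qed

lemma orth_proj_kills:
  assumes "vec.subspace W" "w \<in> ocomp W"
  shows "orth_proj W *v w = 0"
proof -
  let ?P = "orth_proj W"
  have "cip (?P *v w) (?P *v w) = cip (?P *v (?P *v w)) w"
    using cip_adj[of ?P] orth_proj(1)[OF assms(1)] by (simp add: hermitian_mat_iff_adj)
  also have "\<dots> = 0"
    using assms(2) orth_proj(3)[OF assms(1)] unfolding ocomp_def by blast
  finally show ?thesis by (simp add: cip_self_eq_0)
qed

lemma qform_eq_cip: "qform M Y = cip (char_vec Y) (M *v char_vec Y)"
  unfolding qform_def cip_def by (intro sum.cong refl) (simp add: char_vec_def)

lemma qform_hermitian_idempotent:
  assumes "hermitian_mat M" "M ** M = M"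
  shows "qform M Y = cip (M *v char_vec Y) (M *v char_vec Y)"
  unfolding qform_eq_cip using assms cip_adj[of M]
  by (simp add: hermitian_mat_iff_adj matrix_vector_mul_assoc)

section \<open>Bipartite distance-regular graphs\<close>

lemma relpow_gdist: "(u, v) \<in> R\<^sup>* \<Longrightarrow> (u, v) \<in> R ^^ gdist R u v"
  unfolding gdist_def by (rule LeastI_ex) (rule rtrancl_imp_relpow)

lemma gdist_le: "(u, v) \<in> R ^^ n \<Longrightarrow> gdist R u v \<le> n"
  unfolding gdist_def by (rule Least_le)

lemma gdist_self [simp]: "gdist R u u = 0"
  using gdist_le[of u u 0 R] by simp

lemma gdist_eq_0: "(u, v) \<in> R\<^sup>* \<Longrightarrow> gdist R u v = 0 \<longleftrightarrow> u = v"
  using relpow_gdist[of u v R] by auto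

lemma gdist_triangle:
  assumes "(u, v) \<in> R\<^sup>*" "(v, w) \<in> R\<^sup>*"
  shows "gdist R u w \<le> gdist R u v + gdist R v w"
  by (rule gdist_le) (use assms[THEN relpow_gdist] in \<open>auto simp: relpow_add\<close>)

lemma relpow_sym: "sym R \<Longrightarrow> (u, v) \<in> R ^^ n \<Longrightarrow> (v, u) \<in> R ^^ n"
proof (induction n arbitrary: v)
  case (Suc n)
  then obtain w where "(u, w) \<in> R ^^ n" "(w, v) \<in> R" by auto
  then show ?case using Suc by (meson relpow_Suc_I2 symD)
qed simp

lemma gdist_sym: "sym R \<Longrightarrow> gdist R u v = gdist R v u"
  unfolding gdist_def by (metis relpow_sym)

lemma gdist_split:
  assumes "(u, v) \<in> R\<^sup>*" "gdist R u v = m + n"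
  obtains w where "gdist R u w = m" "gdist R w v = n" "(u, w) \<in> R\<^sup>*" "(w, v) \<in> R\<^sup>*"
proof -
  have "(u, v) \<in> R ^^ (m + n)" using relpow_gdist assms by metis
  then obtain w where w: "(u, w) \<in> R ^^ m" "(w, v) \<in> R ^^ n"
    by (auto simp: relpow_add)
  then have star: "(u, w) \<in> R\<^sup>*" "(w, v) \<in> R\<^sup>*" by (auto dest: relpow_imp_rtrancl)
  have "gdist R u w \<le> m" "gdist R w v \<le> n" by (rule gdist_le, fact)+
  then show thesis using that star gdist_triangle[OF star] assms(2) by force
qed

lemma diameter_of_eqI:
  assumes "\<And>u v. u \<in> V \<Longrightarrow> v \<in> V \<Longrightarrow> gdist R u v \<le> n" "u \<in> V" "v \<in> V" "gdist R u v = n"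
  shows "diameter_of V R = n"
  unfolding diameter_of_def
proof (rule Max_eqI)
  have "{gdist R u v |u v. u \<in> V \<and> v \<in> V} = (\<lambda>(u, v). gdist R u v) ` (V \<times> V)" by auto
  then show "finite {gdist R u v |u v. u \<in> V \<and> v \<in> V}" by simp
qed (use assms in auto)

lemma diameter_of_bounds:
  assumes "V \<noteq> {}"
  shows "u \<in> V \<Longrightarrow> v \<in> V \<Longrightarrow> gdist R u v \<le> diameter_of V R"
    and "\<exists>u\<in>V. \<exists>v\<in>V. gdist R u v = diameter_of V R"
proof -
  have eq: "{gdist R u v |u v. u \<in> V \<and> v \<in> V} = (\<lambda>(u, v). gdist R u v) ` (V \<times> V)" by auto
  then have fin: "finite {gdist R u v |u v. u \<in> V \<and> v \<in> V}" by simp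
  show "u \<in> V \<Longrightarrow> v \<in> V \<Longrightarrow> gdist R u v \<le> diameter_of V R"
    unfolding diameter_of_def using fin by (intro Max_ge) auto
  have "diameter_of V R \<in> {gdist R u v |u v. u \<in> V \<and> v \<in> V}"
    unfolding diameter_of_def using fin assms by (intro Max_in) auto
  then show "\<exists>u\<in>V. \<exists>v\<in>V. gdist R u v = diameter_of V R" by force
qed

lemma mscale_nth [simp]: "mscale k M $ u $ v = k * M $ u $ v"
  by (simp add: mscale_def)

lemma hadamard_nth [simp]: "hadamard M N $ u $ v = M $ u $ v * N $ u $ v"
  by (simp add: hadamard_def)

lemma mscale_mult_left: "mscale k M ** N = mscale k (M ** N)"
  by (simp add: vec_eq_iff matrix_matrix_mult_def sum_distrib_left mult_ac)

lemma mscale_mult_right: "M ** mscale k N = mscale k (M ** N)"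
  by (simp add: vec_eq_iff matrix_matrix_mult_def sum_distrib_left mult_ac)

lemma matrix_mult_add_left: "(M + N) ** L = M ** L + N ** (L :: 'a::semiring_1^'n^'m)"
  by (simp add: vec_eq_iff matrix_matrix_mult_def distrib_right sum.distrib)

lemma mscale_vec: "mscale k M *v v = k *s (M *v v)"
  by (simp add: vec_eq_iff matrix_vector_mult_def sum_distrib_left mult_ac)

text \<open>The hypotheses on the graph, unpacked for a vertex set that is the whole type.
  \<open>P\<close> is one colour class and its complement is the other.\<close>

locale bipartite_drg =
  fixes R :: "'v::finite rel" and P :: "'v set" and b c :: "nat \<Rightarrow> nat" and d :: nat
  assumes sym: "sym R"
    and irrefl: "irrefl R"
    and conn: "(u, v) \<in> R\<^sup>*"
    and colour: "(u, v) \<in> R \<Longrightarrow> u \<in> P \<longleftrightarrow> v \<notin> P"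
    and card_b: "card {z. (v, z) \<in> R \<and> gdist R u z = gdist R u v + 1} = b (gdist R u v)"
    and card_c: "card {z. (v, z) \<in> R \<and> gdist R u z + 1 = gdist R u v} = c (gdist R u v)"
    and dist_le: "gdist R u v \<le> d"
    and dist_attained: "\<exists>u v. gdist R u v = d"
begin

section \<open>Distances, parity and intersection numbers\<close>

abbreviation dist :: "'v \<Rightarrow> 'v \<Rightarrow> nat" where "dist \<equiv> gdist R"

lemma dist_sym: "dist u v = dist v u"
  by (rule gdist_sym[OF sym])

lemma dist_triangle: "dist u w \<le> dist u v + dist v w"
  by (rule gdist_triangle[OF conn conn])

lemma dist_eq_0 [simp]: "dist u v = 0 \<longleftrightarrow> u = v"
  by (rule gdist_eq_0[OF conn])

lemma diameter_of_UNIV [simp]: "diameter_of UNIV R = d"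
  using dist_attained dist_le by (auto intro: diameter_of_eqI)

lemma dist_eq_1: "dist u v = 1 \<longleftrightarrow> (u, v) \<in> R"
proof
  assume "dist u v = 1"
  then show "(u, v) \<in> R" using relpow_gdist[OF conn, of u v] by simp
next
  assume uv: "(u, v) \<in> R"
  then have "dist u v \<le> 1" by (intro gdist_le) simp
  moreover have "u \<noteq> v" using uv irrefl by (auto simp: irrefl_def)
  ultimately show "dist u v = 1" by (metis One_nat_def dist_eq_0 le_Suc_eq le_zero_eq)
qed

lemma dist_eq_Suc_0: "dist u v = Suc 0 \<longleftrightarrow> (u, v) \<in> R"
  using dist_eq_1 by simp

lemma colour_relpow: "(u, v) \<in> R ^^ n \<Longrightarrow> (u \<in> P \<longleftrightarrow> v \<in> P) \<longleftrightarrow> even n"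
proof (induction n arbitrary: v)
  case (Suc n)
  then obtain w where "(u, w) \<in> R ^^ n" "(w, v) \<in> R" by auto
  then show ?case using Suc.IH[of w] colour[of w v] by auto
qed simp

lemma even_dist: "even (dist u v) \<longleftrightarrow> (u \<in> P \<longleftrightarrow> v \<in> P)"
  using colour_relpow[OF relpow_gdist[OF conn]] by blast

lemma dist_neighbour:
  assumes "(v, z) \<in> R"
  shows "dist u z = dist u v + 1 \<or> dist u z + 1 = dist u v"
proof -
  have "dist v z = 1" "dist z v = 1" using assms dist_eq_1 dist_sym by metis+
  then have "dist u z \<le> dist u v + 1" "dist u v \<le> dist u z + 1"
    using dist_triangle by metis+
  moreover have "even (dist u z) \<noteq> even (dist u v)"
    using even_dist colour[OF assms] by auto
  then have "dist u z \<noteq> dist u v" by auto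
  ultimately show ?thesis by linarith
qed

lemma dist_split:
  assumes "dist u v = m + n"
  obtains w where "dist u w = m" "dist w v = n"
  using gdist_split[OF conn assms] by metis

lemma b_pos:
  assumes "i < d"
  shows "b i > 0"
proof -
  obtain u v where uv: "dist u v = d" using dist_attained by blast
  then have "dist u v = i + (1 + (d - i - 1))" using assms by simp
  then obtain w where w: "dist u w = i" "dist w v = 1 + (d - i - 1)" by (rule dist_split)
  then obtain z where z: "dist w z = 1" "dist z v = d - i - 1" by (elim dist_split)
  have "dist u z = dist u w + 1"
    using dist_neighbour[of w z u] dist_eq_1 z w uv dist_triangle[of u v z] assms by force
  then have "z \<in> {z. (w, z) \<in> R \<and> dist u z = dist u w + 1}" using z dist_eq_1 by auto
  then have "card {z. (w, z) \<in> R \<and> dist u z = dist u w + 1} > 0"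
    by (metis card_gt_0_iff empty_iff finite)
  then show ?thesis using card_b[of w u] w by simp
qed

lemma dist_exists:
  assumes "i \<le> d"
  obtains v where "dist u v = i"
proof -
  have "\<exists>v. dist u v = i" using assms
  proof (induction i)
    case (Suc i)
    then obtain v where v: "dist u v = i" by auto
    then have "card {z. (v, z) \<in> R \<and> dist u z = dist u v + 1} > 0"
      using card_b[of v u] b_pos[of i] Suc.prems by simp
    then have "{z. (v, z) \<in> R \<and> dist u z = dist u v + 1} \<noteq> {}" by (metis card.empty less_irrefl)
    then show ?case using v by auto
  qed auto
  then show thesis using that by blast
qed

lemma c_pos:
  assumes "0 < i" "i \<le> d"
  shows "c i > 0"
proof -
  fix u :: 'v
  obtain v where v: "dist u v = i" using dist_exists assms by metis
  then have "dist u v = (i - 1) + 1" using assms by simp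
  then obtain w where w: "dist u w = i - 1" "dist w v = 1" by (rule dist_split)
  then have "w \<in> {z. (v, z) \<in> R \<and> dist u z + 1 = dist u v}"
    using v assms dist_eq_1 dist_sym by auto
  then have "card {z. (v, z) \<in> R \<and> dist u z + 1 = dist u v} > 0"
    by (metis card_gt_0_iff empty_iff finite)
  then show ?thesis using card_c[of v u] v by simp
qed

text \<open>In a bipartite graph no neighbour keeps the distance, hence only two terms. At distance
  0 the truncated index \<open>0 - 1\<close> is multiplied by \<open>c 0\<close>, which is
  0.\<close>

lemma sum_neighbours:
  "(\<Sum>z | (v, z) \<in> R. f (dist u z)) =
     of_nat (c (dist u v)) * f (dist u v - 1) + of_nat (b (dist u v)) * (f (dist u v + 1) :: complex)"
proof -
  let ?C = "{z. (v, z) \<in> R \<and> dist u z + 1 = dist u v}"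
  let ?B = "{z. (v, z) \<in> R \<and> dist u z = dist u v + 1}"
  have "{z. (v, z) \<in> R} = ?C \<union> ?B" using dist_neighbour by blast
  moreover have "?C \<inter> ?B = {}" by auto
  ultimately have "(\<Sum>z | (v, z) \<in> R. f (dist u z)) = (\<Sum>z\<in>?C. f (dist u z)) + (\<Sum>z\<in>?B. f (dist u z))"
    using sum.union_disjoint[of ?C ?B "\<lambda>z. f (dist u z)"] by simp
  also have "(\<Sum>z\<in>?C. f (dist u z)) = (\<Sum>z\<in>?C. f (dist u v - 1))"
    by (intro sum.cong refl arg_cong[where f = f]) auto
  also have "(\<Sum>z\<in>?B. f (dist u z)) = (\<Sum>z\<in>?B. f (dist u v + 1))"
    by (intro sum.cong refl arg_cong[where f = f]) auto
  finally show ?thesis by (simp only: sum_constant card_b card_c)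
qed

subsection \<open>The Bose--Mesner algebra\<close>

abbreviation dm :: "nat \<Rightarrow> complex^'v^'v" where "dm \<equiv> dist_matrix UNIV R"

abbreviation BM :: "(complex^'v^'v) set" where "BM \<equiv> bose_mesner UNIV R"

abbreviation A :: "complex^'v^'v" where "A \<equiv> dm 1"

text \<open>Matrices whose entries depend only on the distance. They make up the whole Bose-Mesner
  algebra (\<open>BM_eq\<close>), so that its closure properties can be read off entrywise.\<close>

definition rad :: "(nat \<Rightarrow> complex) \<Rightarrow> complex^'v^'v" where
  "rad k = (\<chi> u v. k (dist u v))"

lemma rad_nth [simp]: "rad k $ u $ v = k (dist u v)"
  by (simp add: rad_def)

lemma dm_nth: "dm i $ u $ v = (if dist u v = i then 1 else 0)"
  by (simp add: dist_matrix_def)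

lemma A_vec: "(A *v v) $ u = (\<Sum>z | (u, z) \<in> R. v $ z)"
  unfolding matrix_vector_mult_def
  by (simp add: dm_nth dist_eq_Suc_0 if_distrib[of "\<lambda>t. t * _"] sum.If_cases cong: if_cong)

lemma sum_dm: "(\<Sum>i\<le>d. mscale (k i) (dm i)) = rad k"
proof -
  have "(\<Sum>i\<le>d. mscale (k i) (dm i)) $ u $ v = k (dist u v)" for u v
    using dist_le[of u v] by (simp add: dm_nth if_distrib[of "\<lambda>t. _ * t"] cong: if_cong)
  then show ?thesis by (simp add: vec_eq_iff)
qed

lemma BM_eq: "BM = range rad"
  by (auto simp: bose_mesner_def sum_dm)

lemma rad_in_BM [simp]: "rad k \<in> BM"
  by (simp add: BM_eq)

lemma dm_eq_rad: "dm i = rad (\<lambda>j. if j = i then 1 else 0)"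
  by (simp add: vec_eq_iff dm_nth)

lemma dm_in_BM [simp]: "dm i \<in> BM"
  by (simp add: dm_eq_rad)

lemma dm_0: "dm 0 = mat 1"
  by (simp add: vec_eq_iff dm_nth mat_def)

lemma BM_add: "M \<in> BM \<Longrightarrow> N \<in> BM \<Longrightarrow> M + N \<in> BM"
proof -
  assume "M \<in> BM" "N \<in> BM"
  then obtain k l where "M = rad k" "N = rad l" by (auto simp: BM_eq)
  then have "M + N = rad (\<lambda>i. k i + l i)" by (simp add: vec_eq_iff)
  then show ?thesis by simp
qed

lemma BM_scale: "M \<in> BM \<Longrightarrow> mscale s M \<in> BM"
proof -
  assume "M \<in> BM"
  then obtain k where "M = rad k" by (auto simp: BM_eq)
  then have "mscale s M = rad (\<lambda>i. s * k i)" by (simp add: vec_eq_iff)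
  then show ?thesis by simp
qed

lemma BM_hadamard: "M \<in> BM \<Longrightarrow> N \<in> BM \<Longrightarrow> hadamard M N \<in> BM"
proof -
  assume "M \<in> BM" "N \<in> BM"
  then obtain k l where "M = rad k" "N = rad l" by (auto simp: BM_eq)
  then have "hadamard M N = rad (\<lambda>i. k i * l i)" by (simp add: vec_eq_iff)
  then show ?thesis by simp
qed

lemma BM_adj: "M \<in> BM \<Longrightarrow> adj M \<in> BM"
proof -
  assume "M \<in> BM"
  then obtain k where "M = rad k" by (auto simp: BM_eq)
  then have "adj M = rad (\<lambda>i. cnj (k i))" by (simp add: vec_eq_iff adj_def dist_sym)
  then show ?thesis by simp
qed

lemma BM_transpose: "M \<in> BM \<Longrightarrow> transpose M = M"
  by (auto simp: BM_eq vec_eq_iff transpose_def dist_sym)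

lemma BM_sum: "(\<And>j. j \<in> J \<Longrightarrow> f j \<in> BM) \<Longrightarrow> (\<Sum>j\<in>J. f j) \<in> BM"
proof (induction J rule: infinite_finite_induct)
  case empty
  have "rad (\<lambda>_. 0) = 0" by (simp add: vec_eq_iff)
  then show ?case using rad_in_BM[of "\<lambda>_. 0"] by simp
next
  case (infinite J)
  have "rad (\<lambda>_. 0) = 0" by (simp add: vec_eq_iff)
  then show ?case using infinite rad_in_BM[of "\<lambda>_. 0"] by simp
qed (simp_all add: BM_add)

lemma A_rad:
  "A ** rad k = rad (\<lambda>i. of_nat (c i) * k (i - 1) + of_nat (b i) * k (i + 1))"
proof -
  have "(A ** rad k) $ u $ v = of_nat (c (dist u v)) * k (dist u v - 1)
      + of_nat (b (dist u v)) * k (dist u v + 1)" for u v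
  proof -
    have "(A ** rad k) $ u $ v = (A *v (\<chi> z. k (dist v z))) $ u"
      by (simp add: matrix_matrix_mult_def matrix_vector_mult_def dist_sym[of v])
    also have "\<dots> = (\<Sum>z | (u, z) \<in> R. k (dist v z))" by (simp only: A_vec vec_lambda_beta)
    finally show ?thesis by (simp only: sum_neighbours dist_sym[of v u])
  qed
  then show ?thesis by (simp add: vec_eq_iff)
qed

lemma A_in_BM_mult: "M \<in> BM \<Longrightarrow> A ** M \<in> BM"
  using A_rad by (auto simp: BM_eq)

lemma c_0: "c 0 = 0"
  using card_c[of undefined undefined] by simp

lemma A_dm:
  "A ** dm i = mscale (of_nat (c (Suc i))) (dm (Suc i)) +
     (if i = 0 then 0 else mscale (of_nat (b (i - 1))) (dm (i - 1)))"
proof -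
  have "(A ** dm i) $ u $ v = (mscale (of_nat (c (Suc i))) (dm (Suc i)) +
     (if i = 0 then 0 else mscale (of_nat (b (i - 1))) (dm (i - 1)))) $ u $ v" for u v
    unfolding dm_eq_rad[of i] A_rad by (cases "dist u v") (auto simp: dm_nth c_0)
  then show ?thesis by (simp add: vec_eq_iff)
qed

text \<open>\<open>A\<close> generates the algebra: \<open>c (Suc n)\<close> is nonzero up to the
  diameter, so the recurrence \<open>A_dm\<close> can be solved for the next distance
  matrix.\<close>

lemma BM_induct [consumes 1, case_names one mult add scale]:
  assumes M: "M \<in> BM"
    and one: "Q (mat 1)"
    and mult: "\<And>M. M \<in> BM \<Longrightarrow> Q M \<Longrightarrow> Q (A ** M)"
    and add: "\<And>M N. M \<in> BM \<Longrightarrow> N \<in> BM \<Longrightarrow> Q M \<Longrightarrow> Q N \<Longrightarrow> Q (M + N)"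
    and scale: "\<And>M s. M \<in> BM \<Longrightarrow> Q M \<Longrightarrow> Q (mscale s M)"
  shows "Q M"
proof -
  have Qdm: "i \<le> d \<Longrightarrow> Q (dm i)" for i
  proof (induction i rule: less_induct)
    case (less i)
    show ?case
    proof (cases i)
      case 0 then show ?thesis using one dm_0 by simp
    next
      case (Suc n)
      let ?b = "of_nat (b (n - 1)) :: complex" and ?c = "of_nat (c (Suc n)) :: complex"
      have c: "?c \<noteq> 0" using c_pos[of "Suc n"] less.prems Suc by simp
      define L where "L = (if n = 0 then mscale 0 (dm 0) else mscale (- ?b) (dm (n - 1)))"
      have "dm (Suc n) = mscale (1 / ?c) (A ** dm n + L)"
        unfolding A_dm L_def using c by (auto simp: vec_eq_iff)
      moreover have "Q L" "L \<in> BM" unfolding L_def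
        using scale less.IH Suc less.prems BM_scale by auto
      moreover have "Q (A ** dm n)" using mult less.IH Suc less.prems by simp
      ultimately show ?thesis using Suc scale add A_in_BM_mult BM_add dm_in_BM by metis
    qed
  qed
  obtain k where k: "M = (\<Sum>i\<le>d. mscale (k i) (dm i))"
    using M by (auto simp: BM_eq sum_dm)
  have "n \<le> d \<Longrightarrow> Q (\<Sum>i\<le>n. mscale (k i) (dm i))" for n
  proof (induction n)
    case (Suc n)
    have "(\<Sum>i\<le>n. mscale (k i) (dm i)) \<in> BM" by (intro BM_sum BM_scale) simp
    then show ?case using Suc by (simp add: add scale Qdm BM_scale)
  qed (simp add: scale Qdm)
  then show ?thesis using k by blast
qed

lemma BM_mult: "M \<in> BM \<Longrightarrow> N \<in> BM \<Longrightarrow> M ** N \<in> BM"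
  by (induction M rule: BM_induct)
     (simp_all add: A_in_BM_mult[unfolded One_nat_def] BM_add BM_scale mscale_mult_left matrix_mult_add_left
        flip: matrix_mul_assoc)

text \<open>All members are symmetric, including products, so \<open>M ** N\<close> equals its
  transpose \<open>N ** M\<close>.\<close>

lemma BM_commute: "M \<in> BM \<Longrightarrow> N \<in> BM \<Longrightarrow> M ** N = N ** M"
  using BM_transpose[of "M ** N"] BM_transpose[of M] BM_transpose[of N] BM_mult
  by (simp add: matrix_transpose_mul)

lemma one_in_BM: "mat 1 \<in> BM"
  using dm_in_BM[of 0] by (simp add: dm_0)

text \<open>For every vertex \<open>x\<close>, \<open>signed M = S M S\<close> with \<open>S\<close> the diagonal matrix of the signs
  \<open>(-1)\<^bsup>\<partial>(x,u)\<^esup>\<close>, because the graph is bipartite; hence \<open>signed\<close> is multiplicative.\<close>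

definition signed :: "complex^'v^'v \<Rightarrow> complex^'v^'v" where
  "signed M = (\<chi> u v. (-1) ^ dist u v * M $ u $ v)"

lemma signed_nth [simp]: "signed M $ u $ v = (-1) ^ dist u v * M $ u $ v"
  by (simp add: signed_def)

lemma dist_sign: "(-1 :: complex) ^ dist u v = (-1) ^ dist x u * (-1) ^ dist x v"
proof -
  have "even (dist u v) \<longleftrightarrow> (even (dist x u) \<longleftrightarrow> even (dist x v))"
    using even_dist by metis
  then show ?thesis by (auto simp: minus_one_power_iff)
qed

lemma signed_in_BM: "M \<in> BM \<Longrightarrow> signed M \<in> BM"
proof -
  assume "M \<in> BM"
  then obtain k where "M = rad k" by (auto simp: BM_eq)
  then have "signed M = rad (\<lambda>i. (-1) ^ i * k i)" by (simp add: vec_eq_iff)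
  then show ?thesis by simp
qed

lemma signed_signed [simp]: "signed (signed M) = M"
  by (simp add: vec_eq_iff flip: mult.assoc power_add)

lemma signed_mult: "signed (M ** N) = signed M ** signed N"
proof -
  have "(-1) ^ dist u v * (M $ u $ z * N $ z $ v) =
      (-1) ^ dist u z * M $ u $ z * ((-1) ^ dist z v * N $ z $ v)" for u v z
    using dist_sign[of u v z] by (simp add: dist_sym)
  then show ?thesis
    unfolding vec_eq_iff signed_nth matrix_matrix_mult_def vec_lambda_beta sum_distrib_left
    by (intro allI sum.cong refl)
qed

lemma signed_add: "signed (M + N) = signed M + signed N"
  by (simp add: vec_eq_iff algebra_simps)

lemma signed_mscale: "signed (mscale k M) = mscale k (signed M)"
  by (simp add: vec_eq_iff algebra_simps)

lemma signed_zero [simp]: "signed 0 = 0"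
  by (simp add: vec_eq_iff)

lemma signed_inject [simp]: "signed M = signed N \<longleftrightarrow> M = N"
  by (metis signed_signed)

lemma hadamard_signed: "hadamard M (signed N) = signed (hadamard M N)"
  by (simp add: vec_eq_iff algebra_simps)

text \<open>\<open>signed\<close> is an involutive automorphism of the Bose-Mesner algebra, so a
  splitting of \<open>signed e\<close> would carry over to a splitting of \<open>e\<close>.\<close>

lemma signed_primitive:
  assumes "primitive_idempotent BM e"
  shows "primitive_idempotent BM (signed e)"
proof -
  have e: "e \<in> BM" "e \<noteq> 0" "e ** e = e"
    using assms by (auto simp: primitive_idempotent_def)
  have "\<not> (\<exists>f\<in>BM. \<exists>g\<in>BM. f \<noteq> 0 \<and> g \<noteq> 0 \<and> f ** f = f \<and> g ** g = g \<and> f ** g = 0 \<and> g ** f = 0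
      \<and> signed e = f + g)"
  proof
    assume "\<exists>f\<in>BM. \<exists>g\<in>BM. f \<noteq> 0 \<and> g \<noteq> 0 \<and> f ** f = f \<and> g ** g = g \<and> f ** g = 0 \<and> g ** f = 0
      \<and> signed e = f + g"
    then obtain f g where fg: "f \<in> BM" "g \<in> BM" "f \<noteq> 0" "g \<noteq> 0" "f ** f = f" "g ** g = g"
      "f ** g = 0" "g ** f = 0" "signed e = f + g" by blast
    then have "signed f \<in> BM" "signed g \<in> BM" "signed f \<noteq> 0" "signed g \<noteq> 0"
      "signed f ** signed f = signed f" "signed g ** signed g = signed g"
      "signed f ** signed g = 0" "signed g ** signed f = 0" "e = signed f + signed g"
      by (metis signed_in_BM signed_signed signed_zero signed_mult signed_add)+
    then show False using assms unfolding primitive_idempotent_def by blast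
  qed
  then show ?thesis
    using e signed_in_BM[of e] signed_mult[of e e] signed_inject[of e 0]
    unfolding primitive_idempotent_def by simp
qed

subsection \<open>Graphs with adjacency at distance two\<close>

lemma relpow_dist2_le: "(u, v) \<in> dist2_edges R K ^^ n \<Longrightarrow> dist u v \<le> 2 * n"
proof (induction n arbitrary: v)
  case (Suc n)
  then obtain z where "(u, z) \<in> dist2_edges R K ^^ n" "(z, v) \<in> dist2_edges R K" by auto
  then have "dist u z \<le> 2 * n" "dist z v = 2" using Suc.IH by (auto simp: dist2_edges_def)
  then show ?case using dist_triangle[of u v z] by simp
qed auto

text \<open>A geodesic of even length, read at every second vertex, stays in the colour class and is
  a walk of the halved graph.\<close>

lemma relpow_dist2_colour_class:
  assumes H: "\<And>u v. u \<in> H \<Longrightarrow> v \<in> H \<longleftrightarrow> even (dist u v)" and "u \<in> H"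
  shows "dist u v = 2 * n \<Longrightarrow> (u, v) \<in> dist2_edges R H ^^ n"
proof (induction n arbitrary: v)
  case (Suc n)
  then have "dist u v = 2 * n + 2" by simp
  then obtain z where z: "dist u z = 2 * n" "dist z v = 2" by (rule dist_split)
  then have "z \<in> H" "v \<in> H" using assms Suc.prems by (metis dvd_triv_left)+
  then have "(z, v) \<in> dist2_edges R H" using z by (simp add: dist2_edges_def)
  then show ?case using Suc.IH[OF z(1)] by auto
qed auto

lemma gdist_colour_class:
  assumes H: "\<And>u v. u \<in> H \<Longrightarrow> v \<in> H \<longleftrightarrow> even (dist u v)" and "u \<in> H" "v \<in> H"
  shows "2 * gdist (dist2_edges R H) u v = dist u v"
proof -
  obtain n where n: "dist u v = 2 * n" using assms by (metis evenE)
  have r: "(u, v) \<in> dist2_edges R H ^^ n" by (rule relpow_dist2_colour_class[OF H \<open>u \<in> H\<close> n])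
  then have "gdist (dist2_edges R H) u v \<le> n" by (rule gdist_le)
  moreover have "n \<le> gdist (dist2_edges R H) u v"
    using relpow_dist2_le[OF relpow_gdist[OF relpow_imp_rtrancl[OF r]]] n by simp
  ultimately show ?thesis using n by simp
qed

lemma diameter_colour_class:
  assumes H: "\<And>u v. u \<in> H \<Longrightarrow> v \<in> H \<longleftrightarrow> even (dist u v)" and "u \<in> H"
  shows "diameter_of H (dist2_edges R H) = d div 2"
proof -
  obtain v where v: "dist u v = 2 * (d div 2)" using dist_exists[of "2 * (d div 2)" u] by auto
  then have vH: "v \<in> H" using assms by (metis dvd_triv_left)
  show ?thesis
  proof (rule diameter_of_eqI[OF _ \<open>u \<in> H\<close> vH])
    show "gdist (dist2_edges R H) u v = d div 2"
      using gdist_colour_class[OF H \<open>u \<in> H\<close> vH] v by simp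
  next
    fix y z assume "y \<in> H" "z \<in> H"
    then have "2 * gdist (dist2_edges R H) y z \<le> d"
      using gdist_colour_class[OF H] dist_le by metis
    then show "gdist (dist2_edges R H) y z \<le> d div 2" by linarith
  qed
qed

end

section \<open>$Q$-polynomial structures\<close>

interpretation msp: vector_space mscale
  by unfold_locales (simp_all add: vec_eq_iff algebra_simps)

lemma matrix_mult_diff_left: "(M - N) ** L = M ** L - N ** (L :: 'a::ring_1^'n^'m)"
  by (simp add: vec_eq_iff matrix_matrix_mult_def left_diff_distrib sum_subtractf)

lemma matrix_mult_diff_right: "L ** (M - N) = L ** M - L ** (N :: 'a::ring_1^'n^'m)"
  by (simp add: vec_eq_iff matrix_matrix_mult_def right_diff_distrib sum_subtractf)

lemma matrix_mult_zero [simp]: "0 ** M = (0 :: 'a::ring_1^'n^'m)" "M ** 0 = (0 :: 'a::ring_1^'n^'m)"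
  by (simp_all add: vec_eq_iff matrix_matrix_mult_def)

lemma matrix_mult_sum_left: "(\<Sum>j\<in>J. f j) ** L = (\<Sum>j\<in>J. f j ** (L :: 'a::ring_1^'n^'m))"
  by (induction J rule: infinite_finite_induct) (simp_all add: matrix_mult_add_left)

lemma matrix_mult_sum_right: "L ** (\<Sum>j\<in>J. f j) = (\<Sum>j\<in>J. L ** (f j :: 'a::ring_1^'n^'m))"
  by (induction J rule: infinite_finite_induct) (simp_all add: matrix_add_ldistrib)

lemma matrix_vector_sum_left: "(\<Sum>j\<in>J. f j) *v v = (\<Sum>j\<in>J. f j *v (v :: 'a::ring_1^'n))"
  by (induction J rule: infinite_finite_induct) (simp_all add: matrix_vector_mult_add_rdistrib)

lemma trace_adj_mult_eq_0:
  fixes F :: "complex^'v::finite^'v"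
  assumes "trace (adj F ** F) = 0"
  shows "F = 0"
proof -
  have "trace (adj F ** F) = (\<Sum>i\<in>UNIV. \<Sum>k\<in>UNIV. of_real ((cmod (F $ k $ i))\<^sup>2))"
    unfolding trace_def matrix_matrix_mult_def adj_def vec_lambda_beta
    by (intro sum.cong refl) (metis complex_norm_square mult.commute)
  also have "\<dots> = of_real (\<Sum>i\<in>UNIV. \<Sum>k\<in>UNIV. (cmod (F $ k $ i))\<^sup>2)" by simp
  finally have "(\<Sum>i\<in>UNIV. \<Sum>k\<in>UNIV. (cmod (F $ k $ i))\<^sup>2) = 0"
    using assms by (metis of_real_eq_0_iff)
  then have "(\<Sum>k\<in>UNIV. (cmod (F $ k $ i))\<^sup>2) = 0" for i
    by (subst (asm) sum_nonneg_eq_0_iff) (auto intro: sum_nonneg)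
  then have "F $ k $ i = 0" for k i
    by (subst (asm) sum_nonneg_eq_0_iff) auto
  then show ?thesis by (simp add: vec_eq_iff)
qed

locale bipartite_qpoly = bipartite_drg R P b c d
  for R :: "'v::finite rel" and P b c d +
  fixes E :: "nat \<Rightarrow> complex^'v^'v" and as bs cs :: "nat \<Rightarrow> complex"
  assumes d_ge: "d \<ge> 6"
    and E_bij: "bij_betw E {..d} {e. primitive_idempotent BM e}"
    and E_0: "E 0 = mscale (1 / of_nat CARD('v)) (all_ones UNIV)"
    and bs_cs: "\<And>i. i \<in> {1..d} \<Longrightarrow> bs (i - 1) * cs i \<noteq> 0"
    and hadamard_E: "\<And>i. i \<le> d \<Longrightarrow> hadamard (E 1) (E i) = mscale (1 / of_nat CARD('v))
           ((if i = 0 then 0 else mscale (bs (i - 1)) (E (i - 1)))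
              + mscale (as i) (E i)
              + (if i = d then 0 else mscale (cs (i + 1)) (E (i + 1))))"
begin

section \<open>The primitive idempotents as an orthogonal basis\<close>

lemma E_primitive: "i \<le> d \<Longrightarrow> primitive_idempotent BM (E i)"
  using E_bij by (auto simp: bij_betw_def)

lemma E_in_BM: "i \<le> d \<Longrightarrow> E i \<in> BM"
  and E_nonzero: "i \<le> d \<Longrightarrow> E i \<noteq> 0"
  and E_idem: "i \<le> d \<Longrightarrow> E i ** E i = E i"
  using E_primitive by (auto simp: primitive_idempotent_def)

lemma E_inj: "i \<le> d \<Longrightarrow> j \<le> d \<Longrightarrow> E i = E j \<longleftrightarrow> i = j"
  using E_bij by (auto simp: bij_betw_def inj_on_def)

lemma BM_diff: "M \<in> BM \<Longrightarrow> N \<in> BM \<Longrightarrow> M - N \<in> BM"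
  using BM_add[of M "mscale (-1) N"] BM_scale[of N "-1"] by simp

text \<open>Otherwise \<open>e ** f\<close> and \<open>e - e ** f\<close> would be nonzero
  orthogonal idempotents with sum \<open>e\<close>.\<close>

lemma primitive_mult:
  assumes e: "primitive_idempotent BM e" and f: "f \<in> BM" "f ** f = f"
  shows "e ** f = 0 \<or> e ** f = e"
proof (rule ccontr)
  assume neg: "\<not> ?thesis"
  define g where "g = e ** f"
  have e': "e \<in> BM" "e ** e = e" using e by (auto simp: primitive_idempotent_def)
  have fe: "f ** e = e ** f" using BM_commute e' f by blast
  have g: "g \<in> BM" "e ** g = g" "g ** e = g" "g ** g = g"
    unfolding g_def using e' f BM_mult fe by (metis matrix_mul_assoc)+
  have "e - g \<in> BM" "(e - g) ** (e - g) = e - g" "g ** (e - g) = 0" "(e - g) ** g = 0"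
    "e = g + (e - g)"
    using BM_diff g e' by (simp_all add: matrix_mult_diff_left matrix_mult_diff_right)
  moreover have "g \<noteq> 0" "e - g \<noteq> 0" using neg g_def by auto
  ultimately show False using e g unfolding primitive_idempotent_def by blast
qed

lemma E_orth: "i \<le> d \<Longrightarrow> j \<le> d \<Longrightarrow> i \<noteq> j \<Longrightarrow> E i ** E j = 0"
  using primitive_mult[OF E_primitive E_in_BM E_idem] BM_commute[OF E_in_BM E_in_BM] E_inj by metis

lemma E_mult: "i \<le> d \<Longrightarrow> j \<le> d \<Longrightarrow> E i ** E j = (if i = j then E i else 0)"
  by (simp add: E_orth E_idem)

lemma sum_E_mult:
  assumes "i \<le> d"
  shows "(\<Sum>j\<le>d. mscale (k j) (E j)) ** E i = mscale (k i) (E i)"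
proof -
  have "(\<Sum>j\<le>d. mscale (k j) (E j)) ** E i = (\<Sum>j\<le>d. if j = i then mscale (k i) (E i) else 0)"
    unfolding matrix_mult_sum_left using assms
    by (intro sum.cong refl) (auto simp: mscale_mult_left E_mult)
  then show ?thesis using assms by simp
qed

text \<open>There are \<open>d + 1\<close> primitive idempotents and the Bose-Mesner algebra is spanned by \<open>d + 1\<close>
  matrices, so linear independence already forces the idempotents to be a basis.\<close>

lemma BM_expand:
  assumes M: "M \<in> BM"
  obtains k where "M = (\<Sum>j\<le>d. mscale (k j) (E j))" "\<And>i. i \<le> d \<Longrightarrow> M ** E i = mscale (k i) (E i)"
proof -
  have inj: "inj_on E {..d}" using E_bij by (simp add: bij_betw_def)
  have indep: "msp.independent (E ` {..d})"
  proof
    assume "msp.dependent (E ` {..d})"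
    then obtain u where u: "\<exists>v\<in>E ` {..d}. u v \<noteq> 0" "(\<Sum>v\<in>E ` {..d}. mscale (u v) v) = 0"
      by (auto simp: msp.dependent_finite)
    then have "(\<Sum>j\<le>d. mscale (u (E j)) (E j)) = 0" by (simp add: sum.reindex[OF inj])
    then have "mscale (u (E i)) (E i) = 0" if "i \<le> d" for i
      using sum_E_mult[OF that, of "\<lambda>j. u (E j)"] by simp
    then show False using u(1) E_nonzero by auto
  qed
  have "BM \<subseteq> msp.span (dm ` {..d})"
    unfolding bose_mesner_def
    by (auto intro!: msp.span_sum intro: msp.span_scale msp.span_base)
  then have "insert M (E ` {..d}) \<subseteq> msp.span (dm ` {..d})" using M E_in_BM by auto
  then have "card (insert M (E ` {..d})) \<le> d + 1" if "msp.independent (insert M (E ` {..d}))"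
    using msp.independent_span_bound[OF _ that, of "dm ` {..d}"] card_image_le[of "{..d}" dm] by simp
  then have span: "M \<in> msp.span (E ` {..d})"
    using indep msp.independent_insert[of M "E ` {..d}"] card_image[OF inj]
      msp.span_base[of M "E ` {..d}"] by (cases "M \<in> E ` {..d}") auto
  then obtain u where "M = (\<Sum>v\<in>E ` {..d}. mscale (u v) v)"
    by (auto simp: msp.span_finite)
  then have eq: "M = (\<Sum>j\<le>d. mscale (u (E j)) (E j))" by (simp add: sum.reindex[OF inj])
  show thesis by (rule that[OF eq]) (subst eq, rule sum_E_mult)
qed

lemma sum_E: "(\<Sum>j\<le>d. E j) = mat 1"
proof -
  obtain k where k: "mat 1 = (\<Sum>j\<le>d. mscale (k j) (E j))" "\<And>i. i \<le> d \<Longrightarrow> mat 1 ** E i = mscale (k i) (E i)"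
    using BM_expand[OF one_in_BM] by blast
  have "mscale (k j) (E j) = E j" if "j \<le> d" for j using k(2)[OF that] by simp
  then show ?thesis unfolding k(1) by (intro sum.cong refl) (metis atMost_iff)
qed

lemma sum_E_vec: "(\<Sum>j\<le>d. E j *v v) = v"
  using sum_E matrix_vector_sum_left[of E "{..d}" v] by simp

text \<open>The product \<open>adj (E i) ** E i\<close> is a nonzero multiple of \<open>E i\<close>
  and is its own adjoint. This makes \<open>adj (E i)\<close> a multiple of \<open>E i\<close>, and
  idempotency forces the factor to be 1.\<close>

lemma E_adj:
  assumes i: "i \<le> d"
  shows "adj (E i) = E i"
proof -
  define H where "H = adj (E i) ** E i"
  obtain k where k: "H = mscale k (E i)"
    using BM_expand[OF BM_adj[OF E_in_BM[OF i]]] i unfolding H_def by metis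
  have "H \<noteq> 0"
  proof
    assume "H = 0"
    then have "E i = 0" unfolding H_def by (intro trace_adj_mult_eq_0) (simp add: trace_def)
    then show False using E_nonzero i by simp
  qed
  then have k0: "k \<noteq> 0" using k by auto
  have "adj H = H" by (simp add: H_def adj_mult)
  then have "mscale (cnj k) (adj (E i)) = mscale k (E i)" by (simp add: k adj_mscale)
  then have "mscale (1 / cnj k) (mscale (cnj k) (adj (E i))) = mscale (1 / cnj k) (mscale k (E i))" by simp
  then have u: "adj (E i) = mscale (k / cnj k) (E i)" using k0 by simp
  have "adj (E i) ** adj (E i) = adj (E i)" using E_idem[OF i] by (metis adj_mult)
  then have "mscale (k / cnj k * (k / cnj k)) (E i) = mscale (k / cnj k) (E i)"
    by (simp add: u mscale_mult_left mscale_mult_right E_idem[OF i])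
  then have "k / cnj k * (k / cnj k) = k / cnj k" using E_nonzero[OF i] msp.scale_cancel_right by blast
  then have "k / cnj k = 1"
    using k0 by (metis complex_cnj_zero_iff divide_eq_0_iff mult_cancel_right1)
  then show ?thesis using u by simp
qed

lemma E_symmetric: "i \<le> d \<Longrightarrow> E i $ u $ v = E i $ v $ u"
  using arg_cong[OF BM_transpose[OF E_in_BM], of i "\<lambda>M. M $ u $ v"] by (simp add: transpose_def)

subsection \<open>The reversal of the ordering\<close>

text \<open>The coefficient of \<open>E m\<close> in \<open>hadamard (E 1) (E i)\<close>: the Krein
  parameter with lower indices \<open>1, i\<close> and upper index \<open>m\<close>, divided by the
  number of vertices.\<close>

definition krein :: "nat \<Rightarrow> nat \<Rightarrow> complex" where
  "krein i m = (1 / of_nat CARD('v)) *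
     (if m + 1 = i then bs m else if m = i then as i else if m = i + 1 then cs m else 0)"

lemma hadamard_E_expand:
  assumes "i \<le> d"
  shows "hadamard (E 1) (E i) = (\<Sum>m\<le>d. mscale (krein i m) (E m))"
proof -
  let ?q = "1 / of_nat CARD('v) :: complex"
  have "(\<Sum>m\<le>d. mscale (krein i m) (E m)) =
      (\<Sum>m\<le>d. (if m = i - 1 then (if i = 0 then 0 else mscale (?q * bs m) (E m)) else 0) +
              (if m = i then mscale (?q * as i) (E m) else 0) +
              (if m = i + 1 then mscale (?q * cs m) (E m) else 0))"
    by (intro sum.cong refl) (auto simp: krein_def vec_eq_iff)
  also have "\<dots> = hadamard (E 1) (E i)"
    unfolding sum.distrib hadamard_E[OF assms] using assms
    by (auto simp: vec_eq_iff algebra_simps)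
  finally show ?thesis by simp
qed

lemma krein_eq_0: "m + 1 < i \<or> i + 1 < m \<Longrightarrow> krein i m = 0"
  by (auto simp: krein_def)

lemma krein_nonzero:
  assumes "i \<le> d" "m \<le> d" "m + 1 = i \<or> i + 1 = m"
  shows "krein i m \<noteq> 0"
  using assms bs_cs[of i] bs_cs[of m] by (auto simp: krein_def)

lemma hadamard_E_mult: "i \<le> d \<Longrightarrow> m \<le> d \<Longrightarrow> hadamard (E 1) (E i) ** E m = mscale (krein i m) (E m)"
  by (simp only: hadamard_E_expand sum_E_mult)

text \<open>\<open>signed\<close> permutes the idempotents and commutes with Hadamard multiplication
  by \<open>E 1\<close>, so the permutation \<open>s\<close> is an automorphism of the path
  \<open>0, 1, ..., d\<close> formed by the nonzero off-diagonal coefficients \<open>krein\<close>.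
  Such an automorphism is the identity or the reversal, and \<open>E 0\<close> is moved because
  \<open>signed\<close> changes its entries at distance 1.\<close>

lemma signed_E:
  assumes "i \<le> d"
  shows "signed (E i) = E (d - i)"
proof -
  have "\<exists>s. \<forall>i. i \<le> d \<longrightarrow> s i \<le> d \<and> signed (E i) = E (s i)"
  proof (rule choice, rule allI)
    fix i
    show "\<exists>j. i \<le> d \<longrightarrow> j \<le> d \<and> signed (E i) = E j"
      using signed_primitive[OF E_primitive[of i]] E_bij by (auto simp: bij_betw_def image_iff set_eq_iff)
  qed
  then obtain s where s: "\<And>i. i \<le> d \<Longrightarrow> s i \<le> d" "\<And>i. i \<le> d \<Longrightarrow> signed (E i) = E (s i)" by blast
  have ss: "s (s i) = i" if "i \<le> d" for i
    using s that E_inj[of "s (s i)" i] by (metis signed_signed)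
  have kr: "krein (s i) (s m) = krein i m" if "i \<le> d" "m \<le> d" for i m
  proof -
    have "mscale (krein (s i) (s m)) (E (s m)) = hadamard (E 1) (E (s i)) ** E (s m)"
      using hadamard_E_mult s that by simp
    also have "\<dots> = signed (hadamard (E 1) (E i) ** E m)"
      by (simp only: s(2)[OF that(1), symmetric] s(2)[OF that(2), symmetric] hadamard_signed signed_mult)
    also have "\<dots> = mscale (krein i m) (E (s m))"
      using hadamard_E_mult s that by (simp add: signed_mscale)
    finally show ?thesis using E_nonzero[OF s(1)[OF that(2)]] msp.scale_cancel_right by blast
  qed
  have adjacent: "s m + 1 = s i \<or> s i + 1 = s m" if "i \<le> d" "m \<le> d" "m + 1 = i \<or> i + 1 = m" for i m
  proof -
    have "krein (s i) (s m) \<noteq> 0" using krein_nonzero[OF that] kr that by simp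
    then have "\<not> (s m + 1 < s i \<or> s i + 1 < s m)" using krein_eq_0 by blast
    moreover have "s m \<noteq> s i" using ss that by (metis n_not_Suc_n Suc_eq_plus1)
    ultimately show ?thesis by linarith
  qed
  have "s 0 \<noteq> 0"
  proof
    assume "s 0 = 0"
    then have *: "signed (E 0) = E 0" using s(2)[of 0] by simp
    have "1 \<le> d" using d_ge by simp
    then obtain v where v: "dist undefined v = 1" by (rule dist_exists)
    have "signed (E 0) $ undefined $ v = E 0 $ undefined $ v" using * by simp
    then show False by (simp add: v E_0 all_ones_def)
  qed
  \<comment> \<open>An inner index has two neighbours on the path and \<open>0\<close> has only one:
    both neighbours of \<open>s 0\<close> would be sent to \<open>1\<close>.\<close>
  moreover have "\<not> (0 < s 0 \<and> s 0 < d)"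
  proof
    assume *: "0 < s 0 \<and> s 0 < d"
    have "s (s 0 + 1) + 1 = s (s 0) \<or> s (s 0) + 1 = s (s 0 + 1)" using * by (intro adjacent) auto
    then have "s (s 0 + 1) = 1" using ss[of 0] by linarith
    moreover have "s (s 0 - 1) + 1 = s (s 0) \<or> s (s 0) + 1 = s (s 0 - 1)" using * by (intro adjacent) auto
    then have "s (s 0 - 1) = 1" using ss[of 0] by linarith
    moreover have "s (s (s 0 + 1)) = s 0 + 1" "s (s (s 0 - 1)) = s 0 - 1"
      using * by (auto intro!: ss)
    ultimately show False by simp
  qed
  ultimately have s0: "s 0 = d" using s(1)[of 0] by linarith
  have "n \<le> d \<Longrightarrow> s n = d - n" for n
  proof (induction n rule: less_induct)
    case (less n)
    show ?case
    proof (cases n)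
      case 0 then show ?thesis using s0 by simp
    next
      case (Suc m)
      then have m: "s m = d - m" using less by simp
      have adj: "s n + 1 = s m \<or> s m + 1 = s n" using adjacent[of m n] Suc less.prems by auto
      have "s m + 1 \<noteq> s n"
      proof
        assume *: "s m + 1 = s n"
        show False
        proof (cases m)
          case 0 then show False using * s0 s(1)[of n] less.prems by simp
        next
          case (Suc l)
          then have "s l = d - l" using less \<open>n = Suc m\<close> by simp
          then have "s l = s n" using * m Suc \<open>n = Suc m\<close> less.prems by simp
          then have "l = n" using ss[of l] ss[of n] Suc \<open>n = Suc m\<close> less.prems by simp
          then show False using Suc \<open>n = Suc m\<close> by simp
        qed
      qed
      then show ?thesis using adj m Suc less.prems by linarith
    qed
  qed
  then show ?thesis using s assms by simp
qed

subsection \<open>Dual eigenvalues\<close>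

text \<open>The dual eigenvalues divided by the number of vertices. Only the values up to
  \<open>d\<close> are determined.\<close>

definition ts :: "nat \<Rightarrow> complex" where
  "ts = (SOME k. E 1 = rad k)"

lemma E_1_nth: "E 1 $ u $ v = ts (dist u v)"
proof -
  have "\<exists>k. E 1 = rad k" using E_in_BM[of 1] d_ge by (auto simp: BM_eq)
  then have "E 1 = rad ts" unfolding ts_def by (rule someI_ex)
  then show ?thesis by simp
qed

text \<open>The recurrence for the idempotents computes the entries of every \<open>E k\<close> from
  those of \<open>E 1\<close>. If two distances shared a dual eigenvalue, no member of the
  Bose-Mesner algebra could tell them apart, but \<open>dm i\<close> does.\<close>

lemma ts_inj:
  assumes "i \<le> d" "j \<le> d" "ts i = ts j"
  shows "i = j"
proof -
  fix u :: 'v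
  obtain v v' where v: "dist u v = i" "dist u v' = j" using dist_exists assms(1,2) by metis
  have E: "k \<le> d \<Longrightarrow> E k $ u $ v = E k $ u $ v'" for k
  proof (induction k rule: less_induct)
    case (less k)
    consider "k = 0" | n where "k = Suc n" by (cases k) auto
    then show ?case
    proof cases
      case 1 then show ?thesis by (simp add: E_0 all_ones_def)
    next
      case (2 n)
      then have n: "n \<le> d" "n \<noteq> d" "cs (n + 1) \<noteq> 0" using less.prems bs_cs[of k] by auto
      have eq: "of_nat CARD('v) * (ts (dist u z) * E n $ u $ z) =
          (if n = 0 then 0 else bs (n - 1) * E (n - 1) $ u $ z) + as n * E n $ u $ z + cs (n + 1) * E k $ u $ z" for z
      proof -
        have "hadamard (E 1) (E n) $ u $ z = ts (dist u z) * E n $ u $ z" by (simp add: E_1_nth[unfolded One_nat_def])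
        then show ?thesis using n(2) 2 unfolding hadamard_E[OF n(1)] by (auto simp: field_simps)
      qed
      have "E n $ u $ v = E n $ u $ v'" "n \<noteq> 0 \<Longrightarrow> E (n - 1) $ u $ v = E (n - 1) $ u $ v'"
        using less 2 by auto
      then have "cs (n + 1) * E k $ u $ v = cs (n + 1) * E k $ u $ v'"
        using eq[of v] eq[of v'] v assms(3) by (auto split: if_splits)
      then show ?thesis using n(3) by simp
    qed
  qed
  obtain k where "dm i = (\<Sum>j\<le>d. mscale (k j) (E j))" using BM_expand[OF dm_in_BM] by blast
  then have "dm i $ u $ v = dm i $ u $ v'" using E by (simp add: sum_component)
  then show ?thesis using v by (auto simp: dm_nth split: if_splits)
qed

definition dual_adj :: "'v \<Rightarrow> complex^'v^'v" where
  "dual_adj x = (\<chi> u v. if u = v then ts (dist x u) else 0)"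

lemma dual_adj_vec: "(dual_adj x *v v) $ u = ts (dist x u) * v $ u"
  by (simp add: dual_adj_def matrix_vector_mult_def if_distrib[of "\<lambda>t. t * _"] cong: if_cong)

lemma dual_adj_mult_left: "(dual_adj x ** M) $ u $ v = ts (dist x u) * M $ u $ v"
  by (simp add: dual_adj_def matrix_matrix_mult_def if_distrib[of "\<lambda>t. t * _"] cong: if_cong)

lemma adj_dual_adj: "adj (dual_adj x) = dual_adj x"
proof -
  have "cnj (ts (dist x u)) = ts (dist x u)" for u
  proof -
    have "cnj (E 1 $ x $ u) = E 1 $ u $ x"
      using arg_cong[OF E_adj[of 1], of "\<lambda>M. M $ u $ x"] d_ge by (simp add: adj_def)
    then show ?thesis using E_1_nth dist_sym by simp
  qed
  then show ?thesis by (auto simp: vec_eq_iff adj_def dual_adj_def)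
qed

text \<open>The squared norm of \<open>E\<^sub>i A\<^sup>* E\<^sub>j\<close> is a multiple of the Krein parameter.\<close>

lemma E_dual_adj_E:
  assumes ij: "i \<le> d" "j \<le> d" "i + 1 < j \<or> j + 1 < i"
  shows "E i ** dual_adj x ** E j = 0"
proof (rule trace_adj_mult_eq_0)
  let ?B = "dual_adj x" and ?H = "hadamard (E i) (E j)"
  have one: "1 \<le> d" using d_ge by simp
  have krein: "krein i j = 0" using ij(3) by (intro krein_eq_0) auto
  define M where "M = E 1 ** ?H ** E 1"
  have "adj (E i ** ?B ** E j) ** (E i ** ?B ** E j) = E j ** (?B ** E i ** ?B ** E j)"
    using E_idem[OF ij(1)] by (simp add: adj_mult adj_dual_adj E_adj ij matrix_mul_assoc)
      (metis matrix_mul_assoc)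
  then have "trace (adj (E i ** ?B ** E j) ** (E i ** ?B ** E j)) = trace ((?B ** E i ** ?B ** E j) ** E j)"
    by (simp only: trace_mul_sym[of "E j"])
  also have "(?B ** E i ** ?B ** E j) ** E j = (?B ** E i) ** (?B ** E j)"
    using E_idem[OF ij(2)] by (simp flip: matrix_mul_assoc)
  also have "trace \<dots> = (\<Sum>y\<in>UNIV. \<Sum>z\<in>UNIV. E 1 $ x $ y * (E i $ y $ z * E j $ y $ z) * E 1 $ z $ x)"
    unfolding trace_def matrix_matrix_mult_def[of "?B ** E i"] vec_lambda_beta
    by (intro sum.cong refl)
       (simp add: dual_adj_mult_left E_1_nth[unfolded One_nat_def] E_symmetric[OF ij(2), of _ "_ :: 'v"] dist_sym mult_ac)
  also have "\<dots> = M $ x $ x"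
    unfolding M_def matrix_matrix_mult_def
    unfolding vec_lambda_beta sum_distrib_right hadamard_nth by (rule sum.swap)
  also have "\<dots> = 0"
  proof -
    \<comment> \<open>Members of the Bose-Mesner algebra have constant diagonal, so the entry at
      \<open>x\<close> is determined by the trace, and the trace produces the Krein
      parameter.\<close>
    have "M \<in> BM" unfolding M_def by (intro BM_mult BM_hadamard E_in_BM one ij)
    then obtain k where "M = rad k" by (auto simp: BM_eq)
    then have M: "trace M = of_nat CARD('v) * M $ x $ x" by (simp add: trace_def)
    have "trace M = trace (?H ** E 1)"
      unfolding M_def using E_idem[OF one] trace_mul_sym[of "E 1" "?H ** E 1"] by (metis matrix_mul_assoc)
    also have "\<dots> = trace (hadamard (E 1) (E i) ** E j)"
      unfolding trace_def matrix_matrix_mult_def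
      by (simp add: mult_ac) (intro sum.cong refl, metis E_symmetric ij(1,2) one One_nat_def)
    also have "\<dots> = 0"
      using ij(1,2) krein by (simp add: hadamard_E_mult[unfolded One_nat_def] trace_def)
    finally show ?thesis using M by simp
  qed
  finally show "trace (adj (E i ** ?B ** E j) ** (E i ** ?B ** E j)) = 0" .
qed

end

section \<open>Levels from a base vertex\<close>

text \<open>Polynomials in \<open>T\<close> of degree at most \<open>m\<close>, as maps on vectors.
  An inductive predicate replaces coefficients, so that statements on supports and on coordinate
  sums are proved by rule induction.\<close>

inductive pol :: "complex^'v^'v::finite \<Rightarrow> nat \<Rightarrow> (complex^'v \<Rightarrow> complex^'v) \<Rightarrow> bool"
  for T where
  pol_id: "pol T m (\<lambda>v. v)"
| pol_add: "pol T m f \<Longrightarrow> pol T m g \<Longrightarrow> pol T m (\<lambda>v. f v + g v)"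
| pol_scale: "pol T m f \<Longrightarrow> pol T m (\<lambda>v. s *s f v)"
| pol_step: "pol T m f \<Longrightarrow> pol T (Suc m) (\<lambda>v. T *v f v)"

lemma pol_mono: "pol T m f \<Longrightarrow> m \<le> n \<Longrightarrow> pol T n f"
proof (induction arbitrary: n rule: pol.induct)
  case (pol_step m f)
  then obtain n' where "n = Suc n'" "m \<le> n'" by (cases n) auto
  then show ?case using pol_step by (auto intro: pol.pol_step)
qed (auto intro: pol.intros)

lemma pol_zero: "pol T m (\<lambda>v. 0)"
  using pol_scale[OF pol_id, of T m 0] by simp

locale bipartite_qpoly_base = bipartite_qpoly R P b c d E as bs cs
  for R :: "'v::finite rel" and P b c d E as bs cs +
  fixes x :: 'v
begin

abbreviation Es :: "nat \<Rightarrow> complex^'v^'v" where "Es \<equiv> dual_idempotent R x"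
abbreviation B :: "complex^'v^'v" where "B \<equiv> dual_adj x"

definition lev :: "nat \<Rightarrow> (complex^'v) set" where
  "lev i = {v. \<forall>u. dist x u \<noteq> i \<longrightarrow> v $ u = 0}"

lemma Es_nth: "Es i $ u $ v = (if u = v \<and> dist x u = i then 1 else 0)"
  by (simp add: dual_idempotent_def matrix_vector_mult_def dm_nth axis_def dist_sym[of x]
      if_distrib[of "\<lambda>t. _ * t"] cong: if_cong)

lemma Es_vec [simp]: "(Es i *v v) $ u = (if dist x u = i then v $ u else 0)"
  by (simp add: matrix_vector_mult_def Es_nth if_distrib[of "\<lambda>t. t * _"] cong: if_cong)

lemma B_vec [simp]: "(B *v v) $ u = ts (dist x u) * v $ u"
  by (rule dual_adj_vec)

lemma Es_lev [simp]: "Es i *v v \<in> lev i"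
  by (simp add: lev_def)

lemma Es_on_lev: "v \<in> lev i \<Longrightarrow> Es j *v v = (if j = i then v else 0)"
  by (auto simp: vec_eq_iff lev_def)

lemma B_on_lev: "v \<in> lev i \<Longrightarrow> B *v v = ts i *s v"
  by (auto simp: vec_eq_iff lev_def)

lemma lev_0 [simp]: "0 \<in> lev i"
  and lev_add: "v \<in> lev i \<Longrightarrow> w \<in> lev i \<Longrightarrow> v + w \<in> lev i"
  and lev_scale: "v \<in> lev i \<Longrightarrow> s *s v \<in> lev i"
  by (auto simp: lev_def)

lemma lev_beyond: "v \<in> lev i \<Longrightarrow> d < i \<Longrightarrow> v = 0"
  using dist_le by (auto simp: lev_def vec_eq_iff) (metis not_less)

lemma A_nonzero:
  assumes "(A *v v) $ u \<noteq> 0"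
  obtains z where "(u, z) \<in> R" "v $ z \<noteq> 0"
  using assms unfolding A_vec by (metis (mono_tags, lifting) mem_Collect_eq sum.neutral)

lemma A_lev_nonzero:
  assumes "v \<in> lev i" "(A *v v) $ u \<noteq> 0"
  shows "dist x u = i + 1 \<or> dist x u + 1 = i"
proof -
  obtain z where "(u, z) \<in> R" "v $ z \<noteq> 0" using A_nonzero[OF assms(2)] by blast
  moreover from this have "dist x z = i" using assms(1) unfolding lev_def by blast
  ultimately show ?thesis using dist_neighbour[of u z x] by auto
qed

lemma A_lev_split:
  assumes "v \<in> lev i"
  shows "A *v v = Es (i - 1) *v (A *v v) + Es (i + 1) *v (A *v v)"
  unfolding vec_eq_iff
proof
  fix u
  show "(A *v v) $ u = (Es (i - 1) *v (A *v v) + Es (i + 1) *v (A *v v)) $ u"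
    using A_lev_nonzero[OF assms, of u] by (cases "(A *v v) $ u = 0") auto
qed

subsection \<open>The tridiagonal relation\<close>

definition th :: "nat \<Rightarrow> complex" where
  "th i = (SOME t. A ** E i = mscale t (E i))"

lemma A_E: "i \<le> d \<Longrightarrow> A ** E i = mscale (th i) (E i)"
  unfolding th_def by (rule someI_ex) (metis BM_expand dm_in_BM)

lemma E_A: "i \<le> d \<Longrightarrow> E i ** A = mscale (th i) (E i)"
  using A_E BM_commute[OF E_in_BM dm_in_BM] by metis

lemma E_ext:
  assumes "\<And>i j. i \<le> d \<Longrightarrow> j \<le> d \<Longrightarrow> E i ** M ** E j = E i ** N ** E j"
  shows "M = N"
proof -
  have *: "M = (\<Sum>i\<le>d. \<Sum>j\<le>d. E i ** M ** E j)" for M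
  proof -
    have "M = (\<Sum>i\<le>d. E i) ** M ** (\<Sum>j\<le>d. E j)" by (simp add: sum_E)
    then show ?thesis
      by (subst sum.swap) (simp add: matrix_mult_sum_left matrix_mult_sum_right)
  qed
  have "(\<Sum>i\<le>d. \<Sum>j\<le>d. E i ** M ** E j) = (\<Sum>i\<le>d. \<Sum>j\<le>d. E i ** N ** E j)"
    by (intro sum.cong refl) (use assms in auto)
  then show ?thesis using *[of M] *[of N] by simp
qed

primrec ze :: "nat \<Rightarrow> complex" where
  "ze 0 = 0"
| "ze (Suc i) = ze i + th (Suc i) * th i * (th (Suc i) - th i)"

definition Z :: "complex^'v^'v" where
  "Z = (\<Sum>j\<le>d. mscale (ze j) (E j))"

lemma Z_in_BM: "Z \<in> BM"
  unfolding Z_def by (intro BM_sum BM_scale E_in_BM) simp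

lemma Z_E: "i \<le> d \<Longrightarrow> Z ** E i = mscale (ze i) (E i)"
  unfolding Z_def by (rule sum_E_mult)

lemma E_Z: "i \<le> d \<Longrightarrow> E i ** Z = mscale (ze i) (E i)"
  using Z_E BM_commute[OF E_in_BM Z_in_BM] by metis

text \<open>Between \<open>E\<^sub>i\<close> and \<open>E\<^sub>j\<close> both sides are multiples of \<open>E\<^sub>i A\<^sup>* E\<^sub>j\<close>, which vanishes unless
  \<open>i\<close> and \<open>j\<close> are at most one apart; the eigenvalues of \<open>Z\<close> are chosen to fit the neighbouring
  pairs.\<close>

lemma tridiagonal: "A ** A ** B ** A - A ** B ** A ** A = Z ** B - B ** Z"
proof (rule E_ext)
  fix i j assume ij: "i \<le> d" "j \<le> d"
  let ?M = "E i ** B ** E j"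
  have l: "E i ** (A ** A ** B ** A - A ** B ** A ** A) ** E j
      = mscale (th i * th i * th j - th i * th j * th j) ?M"
  proof -
    have "E i ** (A ** A ** B ** A) ** E j = E i ** A ** A ** B ** (A ** E j)"
      "E i ** (A ** B ** A ** A) ** E j = E i ** A ** B ** (A ** (A ** E j))"
      by (simp_all add: matrix_mul_assoc)
    then show ?thesis
      by (simp add: matrix_mult_diff_left matrix_mult_diff_right E_A[OF ij(1), unfolded One_nat_def]
          A_E[OF ij(2), unfolded One_nat_def] mscale_mult_left mscale_mult_right msp.scale_left_diff_distrib mult_ac)
  qed
  have r: "E i ** (Z ** B - B ** Z) ** E j = mscale (ze i - ze j) ?M"
  proof -
    have "E i ** (Z ** B) ** E j = E i ** Z ** B ** E j" "E i ** (B ** Z) ** E j = E i ** B ** (Z ** E j)"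
      by (simp_all add: matrix_mul_assoc)
    then show ?thesis
      by (simp add: matrix_mult_diff_left matrix_mult_diff_right E_Z[OF ij(1)] Z_E[OF ij(2)]
          mscale_mult_left mscale_mult_right msp.scale_left_diff_distrib)
  qed
  consider "i + 1 < j \<or> j + 1 < i" | "i = j" | "i = Suc j" | "j = Suc i" by linarith
  then have "?M = 0 \<or> th i * th i * th j - th i * th j * th j = ze i - ze j"
  proof cases
    case 1 then show ?thesis using E_dual_adj_E ij by blast
  qed (auto simp: algebra_simps)
  then show "E i ** (A ** A ** B ** A - A ** B ** A ** A) ** E j = E i ** (Z ** B - B ** Z) ** E j"
    unfolding l r by auto
qed

lemma tridiagonal_vec:
  "A *v (A *v (B *v (A *v v))) - A *v (B *v (A *v (A *v v))) = Z *v (B *v v) - B *v (Z *v v)"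
  using arg_cong[OF tridiagonal, of "\<lambda>M. M *v v"]
  by (simp add: matrix_vector_mult_diff_rdistrib flip: matrix_vector_mul_assoc)

lemma A_supp:
  assumes "\<And>u. k < dist x u \<Longrightarrow> v $ u = 0" "k + 1 < dist x u"
  shows "(A *v v) $ u = 0"
proof (rule ccontr)
  assume "(A *v v) $ u \<noteq> 0"
  then obtain z where "(u, z) \<in> R" "v $ z \<noteq> 0" by (rule A_nonzero)
  then show False using assms(1)[of z] assms(2) dist_neighbour[of u z x] by linarith
qed

text \<open>Apply the tridiagonal relation to the unit vector at \<open>x\<close>. Three factors
  \<open>A\<close> reach distance 3 at most, so the left side vanishes farther out. On the right the
  entry at \<open>y\<close> is \<open>Z $ y $ x\<close> times \<open>ts 0 - ts (dist x y)\<close>,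
  whose second factor is nonzero.\<close>

lemma Z_nth_far:
  assumes "3 < dist u v"
  shows "Z $ u $ v = 0"
proof -
  obtain z where Z: "Z = rad z" using Z_in_BM by (auto simp: BM_eq)
  have dm: "dist u v \<le> d" by (rule dist_le)
  obtain y where y: "dist x y = dist u v" using dist_exists[OF dm] by blast
  let ?e = "axis x 1 :: complex^'v"
  have e: "?e $ y = (if y = x then 1 else 0)" for y by (simp add: axis_def)
  have Ze: "(M *v ?e) $ y = M $ y $ x" for M :: "complex^'v^'v" and y
    by (simp add: matrix_vector_mult_def axis_def if_distrib[of "\<lambda>t. _ * t"] cong: if_cong)
  have 0: "0 < dist x u \<Longrightarrow> ?e $ u = 0" for u by (auto simp: e)
  have 1: "1 < dist x u \<Longrightarrow> (A *v ?e) $ u = 0" for u using A_supp[OF 0] by simp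
  have 2: "2 < dist x u \<Longrightarrow> (A *v (B *v (A *v ?e))) $ u = 0" "2 < dist x u \<Longrightarrow> (A *v (A *v ?e)) $ u = 0" for u
    using A_supp[of 1 "B *v (A *v ?e)" u] A_supp[of 1 "A *v ?e" u] 1 by simp_all
  have 3: "3 < dist x u \<Longrightarrow> (A *v (A *v (B *v (A *v ?e)))) $ u = 0"
    "3 < dist x u \<Longrightarrow> (A *v (B *v (A *v (A *v ?e)))) $ u = 0" for u
    using A_supp[of 2 "A *v (B *v (A *v ?e))" u] A_supp[of 2 "B *v (A *v (A *v ?e))" u] 2 by simp_all
  have "?e \<in> lev 0" by (simp add: lev_def e)
  then have "(Z *v (B *v ?e) - B *v (Z *v ?e)) $ y = (ts 0 - ts (dist x y)) * Z $ y $ x"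
    by (simp add: B_on_lev vector_scalar_commute Ze algebra_simps)
  moreover have "(Z *v (B *v ?e) - B *v (Z *v ?e)) $ y = 0"
    unfolding tridiagonal_vec[symmetric] using 3[of y] assms y by simp
  ultimately have "ts 0 = ts (dist x y) \<or> Z $ y $ x = 0" by simp
  moreover have "ts 0 \<noteq> ts (dist x y)" using ts_inj[of 0 "dist x y"] dist_le assms y by auto
  ultimately show ?thesis using y by (simp add: Z dist_sym)
qed

lemma cc_nonzero: "of_nat (c 2) \<noteq> (0::complex)" "of_nat (c 3) \<noteq> (0::complex)"
  using c_pos[of 2] c_pos[of 3] d_ge by simp_all

lemma A_cubed_nth:
  "(A ** (A ** A)) $ u $ v = of_nat (c 2) * of_nat (c 3) * dm 3 $ u $ v
     + (of_nat (c 2) * of_nat (b 1) + of_nat (b 0)) * A $ u $ v"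
proof -
  have "A ** A = mscale (of_nat (c 2)) (dm 2) + mscale (of_nat (b 0)) (dm 0)"
    using A_dm[of 1] by (simp add: numeral_2_eq_2)
  moreover have "A ** dm 2 = mscale (of_nat (c 3)) (dm 3) + mscale (of_nat (b 1)) A"
    using A_dm[of 2] by (simp add: numeral_2_eq_2 numeral_3_eq_3)
  ultimately have "A ** (A ** A) = mscale (of_nat (c 2)) (mscale (of_nat (c 3)) (dm 3) + mscale (of_nat (b 1)) A)
      + mscale (of_nat (b 0)) A"
    by (simp add: matrix_add_ldistrib mscale_mult_right dm_0)
  then show ?thesis by (simp add: algebra_simps)
qed

text \<open>By parity only entries of \<open>Z\<close> at odd distance enter. These are confined to
  the distances 1 and 3, where \<open>Z\<close> agrees with a combination of \<open>A\<close> and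
  its cube.\<close>

lemma tridiagonal_lev:
  obtains \<alpha> \<beta> where "\<And>i w u. w \<in> lev i \<Longrightarrow> odd (i + dist x u) \<Longrightarrow>
    (A *v (A *v (B *v (A *v w)))) $ u - (A *v (B *v (A *v (A *v w)))) $ u
    = (ts i - ts (dist x u)) * (\<alpha> * (A *v w) $ u + \<beta> * (A *v (A *v (A *v w))) $ u)"
proof -
  obtain z where Z: "Z = rad z" using Z_in_BM by (auto simp: BM_eq)
  define \<beta> where "\<beta> = z 3 / (of_nat (c 2) * of_nat (c 3))"
  \<comment> \<open>The cube of \<open>A\<close> has entries at distance 1 as well, and \<alpha>
    compensates for them.\<close>
  define \<alpha> where "\<alpha> = z 1 - \<beta> * (of_nat (c 2) * of_nat (b 1) + of_nat (b 0))"
  have entry: "Z $ u $ v = \<alpha> * A $ u $ v + \<beta> * (A ** (A ** A)) $ u $ v" if "odd (dist u v)" for u v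
  proof -
    have "\<beta> * (of_nat (c 2) * of_nat (c 3)) = z 3" using cc_nonzero by (simp add: \<beta>_def)
    then have "\<alpha> * A $ u $ v + \<beta> * (A ** (A ** A)) $ u $ v = z 1 * A $ u $ v + z 3 * dm 3 $ u $ v"
      unfolding A_cubed_nth \<alpha>_def by (simp add: algebra_simps)
    moreover have "Z $ u $ v = z 1 * A $ u $ v + z 3 * dm 3 $ u $ v"
    proof (cases "3 < dist u v")
      case True then show ?thesis using Z_nth_far by (simp add: dm_nth)
    next
      case False
      then have "dist u v = 1 \<or> dist u v = 3" using that by presburger
      then show ?thesis by (auto simp: Z dm_nth)
    qed
    ultimately show ?thesis by simp
  qed
  show thesis
  proof (rule that)
    fix i w u assume w: "w \<in> lev i" and odd: "odd (i + dist x u)"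
    have "(Z *v w) $ u = (\<Sum>v\<in>UNIV. (\<alpha> * A $ u $ v + \<beta> * (A ** (A ** A)) $ u $ v) * w $ v)"
      unfolding matrix_vector_mult_def vec_lambda_beta
    proof (intro sum.cong refl)
      fix v
      show "Z $ u $ v * w $ v = (\<alpha> * A $ u $ v + \<beta> * (A ** (A ** A)) $ u $ v) * w $ v"
      proof (cases "w $ v = 0")
        case False
        then have "dist x v = i" using w by (auto simp: lev_def)
        then have "odd (dist u v)" using odd even_dist by (metis even_add)
        then show ?thesis using entry by simp
      qed simp
    qed
    also have "\<dots> = \<alpha> * (A *v w) $ u + \<beta> * ((A ** (A ** A)) *v w) $ u"
      unfolding matrix_vector_mult_def vec_lambda_beta
      by (simp add: algebra_simps sum.distrib sum_distrib_left)
    finally have "(Z *v w) $ u = \<alpha> * (A *v w) $ u + \<beta> * (A *v (A *v (A *v w))) $ u"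
      by (simp flip: matrix_vector_mul_assoc)
    then show "(A *v (A *v (B *v (A *v w)))) $ u - (A *v (B *v (A *v (A *v w)))) $ u
      = (ts i - ts (dist x u)) * (\<alpha> * (A *v w) $ u + \<beta> * (A *v (A *v (A *v w))) $ u)"
      using arg_cong[OF tridiagonal_vec[of w], of "\<lambda>v. v $ u"] B_on_lev[OF w]
      by (simp add: vector_scalar_commute algebra_simps)
  qed
qed

end

context bipartite_qpoly_base
begin

lemma ts_neq: "i \<le> d \<Longrightarrow> j \<le> d \<Longrightarrow> i \<noteq> j \<Longrightarrow> ts i \<noteq> ts j"
  using ts_inj by blast

lemma A_lev_up_d:
  assumes "v \<in> lev d"
  shows "A *v v = Es (d - 1) *v (A *v v)"
proof -
  have "Es (d + 1) *v (A *v v) = 0" using lev_beyond[OF Es_lev] by simp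
  then show ?thesis using A_lev_split[OF assms] by simp
qed

text \<open>Three steps from level \<open>i\<close> to level \<open>i - 3\<close> must all descend,
  so \<open>B\<close> meets the relevant part of the vector on one known level.\<close>

lemma A_cubed_down:
  assumes w: "w \<in> lev i" and u: "dist x u + 3 = i"
  shows "(A *v (A *v (B *v (A *v w)))) $ u = ts (i - 1) * (A *v (A *v (A *v w))) $ u"
    and "(A *v (B *v (A *v (A *v w)))) $ u = ts (i - 2) * (A *v (A *v (A *v w))) $ u"
    and "(A *v w) $ u = 0"
proof -
  have far: "(A *v v) $ u = 0" if v: "v \<in> lev j" and "dist x u + 1 \<noteq> j" "dist x u \<noteq> j + 1" for v j u
    using A_lev_nonzero[OF v, of u] that by auto
  show "(A *v w) $ u = 0" using far[OF w] u by simp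
  define v1 v2 where "v1 = Es (i - 1) *v (A *v w)" and "v2 = Es (i + 1) *v (A *v w)"
  define y1 y2 y3 where "y1 = Es (i - 2) *v (A *v v1)" and "y2 = Es i *v (A *v v1)" and "y3 = A *v v2"
  have l: "v1 \<in> lev (i - 1)" "v2 \<in> lev (i + 1)" "y1 \<in> lev (i - 2)" "y2 \<in> lev i"
    by (simp_all add: v1_def v2_def y1_def y2_def)
  have Aw: "A *v w = v1 + v2" unfolding v1_def v2_def by (rule A_lev_split[OF w])
  have Av1: "A *v v1 = y1 + y2"
    using A_lev_split[OF l(1)] u by (simp add: y1_def y2_def numeral_2_eq_2)
  have y3: "(A *v y3) $ u = 0" "(A *v (B *v y3)) $ u = 0"
  proof -
    have "y3 $ z = 0" if "(u, z) \<in> R" for z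
      unfolding y3_def using far[OF l(2), of z] dist_neighbour[OF that, of x] u by auto
    then show "(A *v y3) $ u = 0" "(A *v (B *v y3)) $ u = 0" by (auto simp: A_vec[unfolded One_nat_def] intro!: sum.neutral)
  qed
  have y2: "(A *v y2) $ u = 0" using far[OF l(4)] u by simp
  have "(A *v (A *v (A *v w))) $ u = (A *v y1) $ u"
    using y2 y3 by (simp add: Aw[unfolded One_nat_def] matrix_vector_right_distrib Av1[unfolded One_nat_def] flip: y3_def[unfolded One_nat_def])
  moreover have "(A *v (A *v (B *v (A *v w)))) $ u = ts (i - 1) * (A *v y1) $ u"
    using y2 y3 by (simp add: Aw[unfolded One_nat_def] matrix_vector_right_distrib B_on_lev[OF l(1)] B_on_lev[OF l(2)]
        vector_scalar_commute Av1[unfolded One_nat_def] flip: y3_def[unfolded One_nat_def])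
  moreover have "(A *v (B *v (A *v (A *v w)))) $ u = ts (i - 2) * (A *v y1) $ u"
    using y2 y3 by (simp add: Aw[unfolded One_nat_def] matrix_vector_right_distrib B_on_lev[OF l(3)] B_on_lev[OF l(4)]
        vector_scalar_commute Av1[unfolded One_nat_def] flip: y3_def[unfolded One_nat_def])
  ultimately show "(A *v (A *v (B *v (A *v w)))) $ u = ts (i - 1) * (A *v (A *v (A *v w))) $ u"
    "(A *v (B *v (A *v (A *v w)))) $ u = ts (i - 2) * (A *v (A *v (A *v w))) $ u"
    by simp_all
qed

text \<open>The second property comes from testing the relation on a vertex of level
  \<open>i\<close> and one of level \<open>i - 3\<close> at distance 3, where the cube of
  \<open>A\<close> has a nonzero entry. It is the usual recurrence of the dual eigenvalues, with the
  present \<beta> as the reciprocal of the constant commonly written \<beta> + 1.\<close>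

lemma tridiagonal_coefficients:
  obtains \<alpha> \<beta> where "\<And>i w u. w \<in> lev i \<Longrightarrow> odd (i + dist x u) \<Longrightarrow>
    (A *v (A *v (B *v (A *v w)))) $ u - (A *v (B *v (A *v (A *v w)))) $ u
    = (ts i - ts (dist x u)) * (\<alpha> * (A *v w) $ u + \<beta> * (A *v (A *v (A *v w))) $ u)"
   and "\<And>i. 3 \<le> i \<Longrightarrow> i \<le> d \<Longrightarrow> ts (i - 1) - ts (i - 2) = \<beta> * (ts i - ts (i - 3))"
proof -
  obtain \<alpha> \<beta> where td: "\<And>i w u. w \<in> lev i \<Longrightarrow> odd (i + dist x u) \<Longrightarrow>
    (A *v (A *v (B *v (A *v w)))) $ u - (A *v (B *v (A *v (A *v w)))) $ u
    = (ts i - ts (dist x u)) * (\<alpha> * (A *v w) $ u + \<beta> * (A *v (A *v (A *v w))) $ u)"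
    using tridiagonal_lev by blast
  have "ts (i - 1) - ts (i - 2) = \<beta> * (ts i - ts (i - 3))" if i: "3 \<le> i" "i \<le> d" for i
  proof -
    obtain v where v: "dist x v = i" using dist_exists i by blast
    then have "dist x v = (i - 3) + 3" using i by simp
    then obtain u where u: "dist x u = i - 3" "dist u v = 3" by (rule dist_split)
    define w :: "complex^'v" where "w = axis v 1"
    have w: "w \<in> lev i" using v by (auto simp: w_def lev_def axis_def)
    have e: "(M *v w) $ y = M $ y $ v" for M :: "complex^'v^'v" and y
      by (simp add: w_def matrix_vector_mult_def axis_def if_distrib[of "\<lambda>t. _ * t"] cong: if_cong)
    have "(A *v (A *v (A *v w))) $ u = (A ** (A ** A)) $ u $ v"
      by (simp add: e matrix_vector_mul_assoc matrix_mul_assoc)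
    also have "\<dots> = of_nat (c 2) * of_nat (c 3)" unfolding A_cubed_nth by (simp add: dm_nth u)
    finally have nz: "(A *v (A *v (A *v w))) $ u \<noteq> 0" using cc_nonzero by simp
    have ui: "dist x u + 3 = i" using u i by simp
    have "odd (i + dist x u)" using ui by presburger
    from td[OF w this] have "(ts (i - 1) - ts (i - 2)) * (A *v (A *v (A *v w))) $ u
        = \<beta> * (ts i - ts (i - 3)) * (A *v (A *v (A *v w))) $ u"
      unfolding A_cubed_down[OF w ui] u(1) by (simp add: algebra_simps)
    then show ?thesis using nz by (metis mult_right_cancel)
  qed
  then show thesis using that td by blast
qed

section \<open>Descents from the last level\<close>

definition T :: "complex^'v^'v" where
  "T = Es d ** A ** A ** Es d"

lemma T_vec: "T *v v = Es d *v (A *v (A *v (Es d *v v)))"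
  by (simp add: T_def flip: matrix_vector_mul_assoc)

lemma T_lev [simp]: "T *v v \<in> lev d"
  by (simp add: T_vec)

lemma T_on_lev: "v \<in> lev d \<Longrightarrow> T *v v = Es d *v (A *v (A *v v))"
  by (simp add: T_vec Es_on_lev)

primrec low :: "nat \<Rightarrow> complex^'v \<Rightarrow> complex^'v" where
  "low 0 v = v"
| "low (Suc k) v = Es (d - Suc k) *v (A *v low k v)"

lemma low_lev: "v \<in> lev d \<Longrightarrow> low k v \<in> lev (d - k)"
  by (cases k) simp_all

lemma low_add: "low k (v + w) = low k v + low k w"
  by (induction k) (simp_all add: matrix_vector_right_distrib)

lemma low_scale: "low k (s *s v) = s *s low k v"
  by (induction k) (simp_all add: vector_scalar_commute)

lemma low_zero [simp]: "low k 0 = 0"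
  by (induction k) simp_all

text \<open>With \<open>L\<close> and \<open>R\<close> the parts of \<open>A\<close> that decrease and increase the distance from \<open>x\<close>, so that
  \<open>low k\<close> is \<open>L\<^sup>k\<close>, the tridiagonal relation makes \<open>RL\<^sup>2\<close>, \<open>LRL\<close>, \<open>L\<^sup>2R\<close> and \<open>L\<close> linearly dependent
  on each level, with a nonzero coefficient at \<open>RL\<^sup>2\<close>.\<close>

lemma raise_low_step:
  assumes k: "1 \<le> k" "k + 2 \<le> d"
    and p: "\<And>v. v \<in> lev d \<Longrightarrow> Es (d - k + 1) *v (A *v low k v) = low (k - 1) (a0 *s v + a1 *s (T *v v))"
    and q: "\<And>v. v \<in> lev d \<Longrightarrow>
      Es (d - k) *v (A *v (Es (d - k + 1) *v (A *v (Es (d - k + 2) *v (A *v low (k - 1) v)))))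
       = low k (q0 *s v + q1 *s (T *v v))"
  obtains e f where "\<And>v. v \<in> lev d \<Longrightarrow> Es (d - k) *v (A *v low (k + 1) v) = low k (e *s v + f *s (T *v v))"
proof -
  define i where "i = d - k + 1"
  have i: "3 \<le> i" "i \<le> d" "d - k = i - 1" "d - Suc k = i - 2" "d - k + 2 = i + 1" using k by (auto simp: i_def)
  obtain \<alpha> \<beta> where td: "\<And>i w u. w \<in> lev i \<Longrightarrow> odd (i + dist x u) \<Longrightarrow>
      (A *v (A *v (B *v (A *v w)))) $ u - (A *v (B *v (A *v (A *v w)))) $ u
      = (ts i - ts (dist x u)) * (\<alpha> * (A *v w) $ u + \<beta> * (A *v (A *v (A *v w))) $ u)"
    and \<beta>: "ts (i - 1) - ts (i - 2) = \<beta> * (ts i - ts (i - 3))"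
    using tridiagonal_coefficients i by metis
  \<comment> \<open>\<open>g\<close> is the coefficient of the unknown
    \<open>A *v low (k + 1) v\<close>. The recurrence of \<open>ts\<close> factors it as
    \<open>\<beta> * (ts (i - 1) - ts (i - 3))\<close>, and the dual eigenvalues are
    distinct.\<close>
  define g where "g = ts (i - 1) - ts (i - 2) - (ts i - ts (i - 1)) * \<beta>"
  have "ts (i - 1) \<noteq> ts (i - 2)" by (rule ts_neq) (use i(1,2) in linarith)+
  then have "\<beta> \<noteq> 0" using \<beta> by auto
  moreover have "ts (i - 1) \<noteq> ts (i - 3)" by (rule ts_neq) (use i(1,2) in linarith)+
  moreover have "g = \<beta> * (ts (i - 1) - ts (i - 3))" unfolding g_def \<beta> by (simp add: algebra_simps)
  ultimately have g: "g \<noteq> 0" by simp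
  define s1 where "s1 = (ts i - ts (i - 1)) * \<beta> - (ts (i - 1) - ts i)"
  \<comment> \<open>For \<open>k = 1\<close> the level \<open>i + 1\<close> lies beyond
    \<open>d\<close>. The undetermined value \<open>ts (d + 1)\<close> then multiplies only the zero
    vector.\<close>
  define s2 where "s2 = (ts i - ts (i - 1)) * \<beta> - (ts (i + 1) - ts i)"
  define e where "e = ((ts i - ts (i - 1)) * \<alpha> + s1 * a0 + s2 * q0) / g"
  define f where "f = (s1 * a1 + s2 * q1) / g"
  have "Es (i - 1) *v (A *v low (k + 1) v) = low k (e *s v + f *s (T *v v))" if v: "v \<in> lev d" for v
    unfolding vec_eq_iff
  proof
    fix u
    show "(Es (i - 1) *v (A *v low (k + 1) v)) $ u = low k (e *s v + f *s (T *v v)) $ u"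
    proof (cases "dist x u = i - 1")
      case False
      then show ?thesis
        using low_lev[OF lev_add[OF lev_scale[OF v] lev_scale[OF T_lev]], of k] i by (simp add: lev_def)
    next
      case u: True
      \<comment> \<open>\<open>M\<close>, \<open>C\<close>, \<open>C'\<close> are successive
        descents of \<open>v\<close>. From \<open>M\<close>, the vector \<open>X\<close> returns to
        level \<open>i\<close> from below and \<open>Y\<close> from above. Hypothesis
        \<open>p\<close> evaluates \<open>X\<close>, \<open>q\<close> evaluates the descent of
        \<open>Y\<close>, and the relation at \<open>u\<close> is solved for the ascent of
        \<open>C'\<close>.\<close>
      define M where "M = low (k - 1) v"
      have "d - (k - 1) = i" using k by (simp add: i_def)
      then have M: "M \<in> lev i" using low_lev[OF v, of "k - 1"] by (simp add: M_def)
      define C where "C = low k v"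
      define U where "U = Es (i + 1) *v (A *v M)"
      have "low (Suc (k - 1)) v = Es (i - 1) *v (A *v M)" using k i(3) by (simp only: low.simps M_def) simp
      then have AM: "A *v M = C + U" using A_lev_split[OF M] k by (simp add: C_def U_def)
      have C: "C \<in> lev (i - 1)" and U: "U \<in> lev (i + 1)" using low_lev[OF v, of k] i by (simp_all add: C_def U_def)
      define C' where "C' = low (k + 1) v"
      define X where "X = Es i *v (A *v C)"
      define Y Y' where "Y = Es i *v (A *v U)" and "Y' = Es (i + 2) *v (A *v U)"
      have C': "C' \<in> lev (i - 2)" and X: "X \<in> lev i" and Y: "Y \<in> lev i" and Y': "Y' \<in> lev (i + 2)"
        using low_lev[OF v, of "k + 1"] i by (simp_all add: C'_def X_def Y_def Y'_def)
      have AC: "A *v C = C' + X"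
        using A_lev_split[OF C] i by (simp add: C'_def C_def X_def numeral_2_eq_2)
      have AU: "A *v U = Y + Y'" using A_lev_split[OF U] by (simp add: Y_def Y'_def numeral_2_eq_2)
      have AY': "(A *v Y') $ u = 0" using A_lev_nonzero[OF Y', of u] u i by fastforce
      note simps = matrix_vector_right_distrib vector_scalar_commute AM[unfolded One_nat_def] AC[unfolded One_nat_def] AU[unfolded One_nat_def]
      have 1: "(A *v (A *v (B *v (A *v M)))) $ u
          = ts (i - 1) * ((A *v C') $ u + (A *v X) $ u) + ts (i + 1) * (A *v Y) $ u"
        using AY' by (simp add: simps B_on_lev[OF C] B_on_lev[OF U] algebra_simps)
      have 2: "(A *v (B *v (A *v (A *v M)))) $ u
          = ts (i - 2) * (A *v C') $ u + ts i * ((A *v X) $ u + (A *v Y) $ u)"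
        using AY' by (simp add: simps B_on_lev[OF C'] B_on_lev[OF X] B_on_lev[OF Y] B_on_lev[OF Y'] algebra_simps)
      have 3: "(A *v (A *v (A *v M))) $ u = (A *v C') $ u + (A *v X) $ u + (A *v Y) $ u"
        using AY' by (simp add: simps algebra_simps)
      have 4: "(A *v M) $ u = C $ u" using U u by (simp add: simps lev_def)
      have "odd (i + dist x u)" using u i by (cases i) auto
      from td[OF M this] have key: "g * (A *v C') $ u
          = (ts i - ts (i - 1)) * \<alpha> * C $ u + s1 * (A *v X) $ u + s2 * (A *v Y) $ u"
        unfolding 1 2 3 4 u g_def s1_def s2_def by (simp add: algebra_simps)
      have low_nth: "low k (r *s v + t *s (T *v v)) $ u = r * C $ u + t * low k (T *v v) $ u" for r t
        by (simp add: low_add low_scale C_def)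
      have X_u: "(A *v X) $ u = low k (a0 *s v + a1 *s (T *v v)) $ u"
      proof -
        have "X = low (k - 1) (a0 *s v + a1 *s (T *v v))" using p[OF v] by (simp add: X_def C_def i_def)
        moreover have "low k y = Es (i - 1) *v (A *v low (k - 1) y)" for y
          using low.simps(2)[of "k - 1" y] k i(3) by simp
        ultimately show ?thesis using u by simp
      qed
      have "Es (d - k) *v (A *v Y) = low k (q0 *s v + q1 *s (T *v v))"
        using q[OF v] unfolding Y_def U_def M_def i(5)[symmetric] unfolding i_def .
      then have Y_u: "(A *v Y) $ u = low k (q0 *s v + q1 *s (T *v v)) $ u"
        using u unfolding i(3) by (metis Es_vec)
      have ge: "g * e = (ts i - ts (i - 1)) * \<alpha> + s1 * a0 + s2 * q0" and gf: "g * f = s1 * a1 + s2 * q1"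
        using g by (simp_all add: e_def f_def)
      have "g * (e * C $ u + f * low k (T *v v) $ u) = g * e * C $ u + g * f * low k (T *v v) $ u"
        by (simp only: distrib_left mult.assoc)
      then have "g * (A *v C') $ u = g * (e * C $ u + f * low k (T *v v) $ u)"
        unfolding key X_u Y_u ge gf low_nth by (simp only: algebra_simps)
      then show ?thesis using g u low_nth by (simp add: C'_def)
    qed
  qed
  then show thesis using that i(3) by simp
qed

text \<open>The induction uses two earlier cases: \<open>k - 1\<close> for the detour down and up,
  \<open>k - 2\<close> for the detour up and down. For \<open>k = 2\<close> the second detour would
  leave level \<open>d\<close> upwards and gives zero, while \<open>k = 1\<close> is the definition
  of \<open>T\<close>.\<close>

lemma raise_low:
  assumes "1 \<le> k" "k < d"
  shows "\<exists>a b. \<forall>v\<in>lev d. Es (d - k + 1) *v (A *v low k v) = low (k - 1) (a *s v + b *s (T *v v))"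
  using assms
proof (induction k rule: less_induct)
  case (less k)
  consider "k = 1" | "k = 2" | l where "k = Suc l" "2 \<le> l"
    by (metis less.prems(1) One_nat_def Suc_1 le_antisym not_less_eq_eq old.nat.exhaust le0)
  then show ?case
  proof cases
    case 1
    have "Es d *v (A *v low 1 v) = 0 *s v + 1 *s (T *v v)" if "v \<in> lev d" for v
      using A_lev_up_d[OF that] T_on_lev[OF that] by simp
    then show ?thesis using 1 less.prems by (intro exI[of _ 0] exI[of _ 1]) simp
  next
    case 2
    obtain a b where p: "\<forall>v\<in>lev d. Es (d - 1 + 1) *v (A *v low 1 v) = low (1 - 1) (a *s v + b *s (T *v v))"
      using less.IH[of 1] 2 less.prems by auto
    have q: "Es (d - 1) *v (A *v (Es (d - 1 + 1) *v (A *v (Es (d - 1 + 2) *v (A *v low (1 - 1) v)))))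
       = low 1 (0 *s v + 0 *s (T *v v))" if "v \<in> lev d" for v
    proof -
      have "Es (d - 1 + 2) *v (A *v low (1 - 1) v) = 0" using d_ge by (intro lev_beyond[OF Es_lev]) simp
      then show ?thesis by simp
    qed
    have "1 + 2 \<le> d" using d_ge by simp
    from raise_low_step[OF order_refl this _ q, of a b] p
    obtain e f where "\<And>v. v \<in> lev d \<Longrightarrow> Es (d - 1) *v (A *v low (1 + 1) v) = low 1 (e *s v + f *s (T *v v))"
      by blast
    moreover have "d - k + 1 = d - 1" "k - 1 = 1" "1 + 1 = k" using 2 less.prems by auto
    ultimately show ?thesis by metis
  next
    case (3 l)
    obtain a b where p: "\<And>v. v \<in> lev d \<Longrightarrow> Es (d - l + 1) *v (A *v low l v) = low (l - 1) (a *s v + b *s (T *v v))"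
      using less.IH[of l] 3 less.prems by auto
    have "\<exists>a' b'. \<forall>v\<in>lev d.
        Es (d - (l - 1) + 1) *v (A *v low (l - 1) v) = low (l - 1 - 1) (a' *s v + b' *s (T *v v))"
      by (rule less.IH) (use 3 less.prems in linarith)+
    then obtain a' b' where p': "\<And>v. v \<in> lev d \<Longrightarrow>
        Es (d - (l - 1) + 1) *v (A *v low (l - 1) v) = low (l - 1 - 1) (a' *s v + b' *s (T *v v))"
      by blast
    have q: "Es (d - l) *v (A *v (Es (d - l + 1) *v (A *v (Es (d - l + 2) *v (A *v low (l - 1) v)))))
       = low l (a' *s v + b' *s (T *v v))" if v: "v \<in> lev d" for v
    proof -
      let ?y = "a' *s v + b' *s (T *v v)"
      have n: "d - (l - 1) + 1 = d - l + 2" "l = Suc (Suc (l - 2))" "l - 1 - 1 = l - 2" "l - 1 = Suc (l - 2)"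
        "d - l + 1 = d - (l - 1)"
        using 3 less.prems by auto
      have "Es (d - l + 1) *v (A *v low (l - 2) ?y) = low (l - 1) ?y"
        unfolding n(5) unfolding n(4) by simp
      moreover have "Es (d - l) *v (A *v low (l - 1) ?y) = low l ?y"
        using n(2,4) low.simps(2)[of "l - 1" ?y] by simp
      ultimately show ?thesis using p'[OF v] unfolding n(1) n(3) by simp
    qed
    from raise_low_step[OF _ _ p q] 3 less.prems
    obtain e f where "\<And>v. v \<in> lev d \<Longrightarrow> Es (d - l) *v (A *v low (l + 1) v) = low l (e *s v + f *s (T *v v))"
      by auto
    moreover have "d - k + 1 = d - l" "k - 1 = l" "l + 1 = k" using 3 less.prems by auto
    ultimately show ?thesis by metis
  qed
qed

section \<open>Distance matrices in terms of descents and \<open>T\<close>\<close>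

lemma pol_T_lev: "pol T m f \<Longrightarrow> v \<in> lev d \<Longrightarrow> f v \<in> lev d"
  by (induction rule: pol.induct) (auto intro: lev_add lev_scale)

text \<open>A weighted degree bound: a descent has weight 1, a factor \<open>T\<close> has weight 2,
  and the total weight is at most \<open>n\<close>.\<close>

definition reach :: "nat \<Rightarrow> (complex^'v \<Rightarrow> complex^'v) \<Rightarrow> bool" where
  "reach n F \<longleftrightarrow> (\<exists>f. (\<forall>k\<le>n. pol T ((n - k) div 2) (f k)) \<and> (\<forall>v\<in>lev d. F v = (\<Sum>k\<le>n. low k (f k v))))"

lemma reach_add_scale:
  assumes "reach n F" "reach n G"
  shows "reach n (\<lambda>v. r *s F v + s *s G v)"
proof -
  obtain f g where
    f: "\<And>k. k \<le> n \<Longrightarrow> pol T ((n - k) div 2) (f k)" "\<And>v. v \<in> lev d \<Longrightarrow> F v = (\<Sum>k\<le>n. low k (f k v))" and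
    g: "\<And>k. k \<le> n \<Longrightarrow> pol T ((n - k) div 2) (g k)" "\<And>v. v \<in> lev d \<Longrightarrow> G v = (\<Sum>k\<le>n. low k (g k v))"
    using assms unfolding reach_def by blast
  show ?thesis unfolding reach_def
  proof (intro exI[of _ "\<lambda>k v. r *s f k v + s *s g k v"] conjI allI impI ballI)
    fix k assume "k \<le> n"
    then show "pol T ((n - k) div 2) (\<lambda>v. r *s f k v + s *s g k v)"
      using f(1) g(1) by (intro pol.intros) auto
  next
    fix v assume "v \<in> lev d"
    then show "r *s F v + s *s G v = (\<Sum>k\<le>n. low k (r *s f k v + s *s g k v))"
      using f(2) g(2) by (simp add: low_add low_scale sum.distrib vec.scale_sum_right)
  qed
qed

lemma reach_pad:
  assumes "reach n F"
  shows "reach (n + 2) F"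
proof -
  obtain f where
    f: "\<And>k. k \<le> n \<Longrightarrow> pol T ((n - k) div 2) (f k)" "\<And>v. v \<in> lev d \<Longrightarrow> F v = (\<Sum>k\<le>n. low k (f k v))"
    using assms unfolding reach_def by blast
  show ?thesis unfolding reach_def
  proof (intro exI[of _ "\<lambda>k. if k \<le> n then f k else (\<lambda>v. 0)"] conjI allI impI ballI)
    fix k assume "k \<le> n + 2"
    show "pol T ((n + 2 - k) div 2) (if k \<le> n then f k else (\<lambda>v. 0))"
      using pol_mono[OF f(1)[of k], of "(n + 2 - k) div 2"] pol_zero by (auto intro: div_le_mono)
  next
    fix v assume "v \<in> lev d"
    then show "F v = (\<Sum>k\<le>n + 2. low k ((if k \<le> n then f k else (\<lambda>v. 0)) v))"
      using f(2) by (simp add: numeral_2_eq_2)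
  qed
qed

text \<open>The descending part of \<open>A\<close> adds one descent. The ascending part removes a
  descent and adds a factor linear in \<open>T\<close>. Either way the weight grows by at most one;
  \<open>n < d\<close> keeps every \<open>k\<close> in the range of
  \<open>raise_low\<close>.\<close>

lemma reach_A:
  assumes "reach n F" "n < d"
  shows "reach (Suc n) (\<lambda>v. A *v F v)"
proof -
  obtain f where
    f: "\<And>k. k \<le> n \<Longrightarrow> pol T ((n - k) div 2) (f k)" "\<And>v. v \<in> lev d \<Longrightarrow> F v = (\<Sum>k\<le>n. low k (f k v))"
    using assms(1) unfolding reach_def by blast
  have "\<forall>k. \<exists>p. 1 \<le> k \<and> k < d \<longrightarrow>
     (\<forall>v\<in>lev d. Es (d - k + 1) *v (A *v low k v) = low (k - 1) (fst p *s v + snd p *s (T *v v)))"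
    using raise_low by force
  then obtain p where p: "\<And>k v. 1 \<le> k \<Longrightarrow> k < d \<Longrightarrow> v \<in> lev d \<Longrightarrow>
     Es (d - k + 1) *v (A *v low k v) = low (k - 1) (fst (p k) *s v + snd (p k) *s (T *v v))"
    by metis
  define r where "r k v = fst (p k) *s f k v + snd (p k) *s (T *v f k v)" for k v
  define g where "g k v = (if k = 0 then 0 else f (k - 1) v) + (if k < n then r (k + 1) v else 0)" for k v
  have A_low: "A *v low k (f k v) = low (Suc k) (f k v) + (if k = 0 then 0 else low (k - 1) (r k v))"
    if k: "k \<le> n" and v: "v \<in> lev d" for k v
  proof -
    have fv: "f k v \<in> lev d" using pol_T_lev f(1) k v by blast
    have eq: "A *v low k (f k v) = Es (d - k - 1) *v (A *v low k (f k v)) + Es (d - k + 1) *v (A *v low k (f k v))"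
      by (rule A_lev_split[OF low_lev[OF fv]])
    have "Es (d - k + 1) *v (A *v low k (f k v)) = (if k = 0 then 0 else low (k - 1) (r k v))"
      using p[of k "f k v"] fv k assms(2) lev_beyond[OF Es_lev, of "d + 1" "A *v f 0 v"] by (auto simp: r_def)
    then show ?thesis using eq by simp
  qed
  show ?thesis unfolding reach_def
  proof (intro exI[of _ g] conjI allI impI ballI)
    fix k assume k: "k \<le> Suc n"
    have 1: "pol T ((Suc n - k) div 2) (\<lambda>v. if k = 0 then 0 else f (k - 1) v)"
      using f(1)[of "k - 1"] k pol_zero by (cases k) auto
    have 2: "pol T ((Suc n - k) div 2) (\<lambda>v. if k < n then r (k + 1) v else 0)"
    proof (cases "k < n")
      case True
      have "Suc n - k = Suc (Suc (n - (k + 1)))" using True by simp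
      then have h: "(Suc n - k) div 2 = Suc ((n - (k + 1)) div 2)" by simp
      have "pol T ((n - (k + 1)) div 2) (f (k + 1))" using f(1) True by simp
      then have "pol T (Suc ((n - (k + 1)) div 2)) (f (k + 1))"
        "pol T (Suc ((n - (k + 1)) div 2)) (\<lambda>v. T *v f (k + 1) v)"
        by (auto intro: pol_mono pol_step)
      then have "pol T (Suc ((n - (k + 1)) div 2)) (r (k + 1))"
        unfolding r_def by (rule pol_add[OF pol_scale pol_scale])
      then show ?thesis using True h by simp
    qed (simp add: pol_zero)
    show "pol T ((Suc n - k) div 2) (g k)" using pol_add[OF 1 2] unfolding g_def .
  next
    fix v assume v: "v \<in> lev d"
    have "A *v F v = (\<Sum>k\<le>n. A *v low k (f k v))"
      unfolding f(2)[OF v] by (rule vec.linear_sum) (rule matrix_vector_mul_linear_gen)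
    also have "\<dots> = (\<Sum>k\<le>n. low (Suc k) (f k v)) + (\<Sum>k\<le>n. if k = 0 then 0 else low (k - 1) (r k v))"
      unfolding sum.distrib[symmetric] by (intro sum.cong refl A_low v) simp
    also have "(\<Sum>k\<le>n. low (Suc k) (f k v)) = (\<Sum>k\<le>Suc n. if k = 0 then 0 else low k (f (k - 1) v))"
      by (simp only: sum.atMost_Suc_shift) simp
    also have "(\<Sum>k\<le>n. if k = 0 then 0 else low (k - 1) (r k v)) = (\<Sum>k\<le>Suc n. if k < n then low k (r (k + 1) v) else 0)"
    proof (cases n)
      case (Suc m)
      have "(\<Sum>k\<le>n. if k = 0 then 0 else low (k - 1) (r k v)) = (\<Sum>k\<le>m. low k (r (Suc k) v))"
        unfolding Suc by (simp only: sum.atMost_Suc_shift) simp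
      also have "\<dots> = (\<Sum>k\<le>m. if k < n then low k (r (k + 1) v) else 0)"
        using Suc by (intro sum.cong) auto
      finally show ?thesis using Suc by simp
    qed simp
    also have "(\<Sum>k\<le>Suc n. if k = 0 then 0 else low k (f (k - 1) v)) + (\<Sum>k\<le>Suc n. if k < n then low k (r (k + 1) v) else 0)
        = (\<Sum>k\<le>Suc n. low k (g k v))"
      unfolding sum.distrib[symmetric] by (intro sum.cong refl) (auto simp: g_def low_add)
    finally show "A *v F v = (\<Sum>k\<le>Suc n. low k (g k v))" .
  qed
qed

lemma reach_dm: "n \<le> d \<Longrightarrow> reach n (\<lambda>v. dm n *v v)"
proof (induction n rule: less_induct)
  case (less n)
  show ?case
  proof (cases n)
    case 0
    show ?thesis unfolding reach_def 0
      by (intro exI[of _ "\<lambda>k v. v"]) (simp add: dm_0 pol_id)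
  next
    case (Suc m)
    let ?c = "of_nat (c (Suc m)) :: complex" and ?b = "of_nat (b (m - 1)) :: complex"
    have c: "?c \<noteq> 0" using c_pos[of "Suc m"] less.prems Suc by simp
    have A: "reach (Suc m) (\<lambda>v. A *v (dm m *v v))" using reach_A less Suc by simp
    \<comment> \<open>The index \<open>m - 1\<close> is truncated at \<open>m = 0\<close>. The
      coefficient of \<open>G\<close> is 0 in that case, and any function within
      \<open>reach\<close> will serve.\<close>
    define G where "G = (if m = 0 then (\<lambda>v. A *v (dm m *v v)) else (\<lambda>v. dm (m - 1) *v v))"
    have "reach (m - 1 + 2) (\<lambda>v. dm (m - 1) *v v)" using less Suc by (intro reach_pad) auto
    then have G: "reach (Suc m) G" using A unfolding G_def by (cases m) auto
    have "dm n = mscale (1 / ?c) (A ** dm m) + mscale (if m = 0 then 0 else - ?b / ?c) (dm (m - 1))"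
      unfolding A_dm Suc using c by (auto simp: vec_eq_iff field_simps)
    then have "dm n *v v = (1 / ?c) *s (A *v (dm m *v v)) + (if m = 0 then 0 else - ?b / ?c) *s G v" for v
      by (cases "m = 0") (simp_all only: G_def mscale_vec matrix_vector_mult_add_rdistrib
          matrix_vector_mul_assoc simp_thms if_True if_False vec.scale_zero_left)
    then have eq: "(*v) (dm n) = (\<lambda>v. (1 / ?c) *s (A *v (dm m *v v)) + (if m = 0 then 0 else - ?b / ?c) *s G v)"
      by (rule ext)
    show ?thesis unfolding eq unfolding Suc by (rule reach_add_scale[OF A G])
  qed
qed

text \<open>A term with \<open>k\<close> descents lies on level \<open>d - k\<close>, so
  \<open>Es d\<close> retains only \<open>k = 0\<close>, whose polynomial has degree at most
  \<open>2 * i div 2\<close>.\<close>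

lemma dm_pol_T:
  assumes "2 * i \<le> d"
  obtains f where "pol T i f" "\<And>v. v \<in> lev d \<Longrightarrow> Es d *v (dm (2 * i) *v v) = f v"
proof -
  obtain f where
    f: "\<And>k. k \<le> 2 * i \<Longrightarrow> pol T ((2 * i - k) div 2) (f k)"
      "\<And>v. v \<in> lev d \<Longrightarrow> dm (2 * i) *v v = (\<Sum>k\<le>2 * i. low k (f k v))"
    using reach_dm[OF assms] unfolding reach_def by blast
  have "Es d *v (dm (2 * i) *v v) = f 0 v" if v: "v \<in> lev d" for v
  proof -
    have "Es d *v (dm (2 * i) *v v) = (\<Sum>k\<le>2 * i. Es d *v low k (f k v))"
      unfolding f(2)[OF v] by (rule vec.linear_sum) (rule matrix_vector_mul_linear_gen)
    also have "\<dots> = (\<Sum>k\<le>2 * i. if k = 0 then f 0 v else 0)"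
    proof (intro sum.cong refl)
      fix k assume "k \<in> {..2 * i}"
      then have k: "k \<le> 2 * i" by simp
      then have "low k (f k v) \<in> lev (d - k)" using low_lev pol_T_lev f(1) v by blast
      then show "Es d *v low k (f k v) = (if k = 0 then f 0 v else 0)"
        using Es_on_lev[of _ "d - k" d] k assms d_ge by auto
    qed
    finally show ?thesis by simp
  qed
  then show thesis using that f(1)[of 0] by simp
qed

end

lemma sum_nonneg_Reals:
  fixes g :: "'a \<Rightarrow> complex"
  assumes "finite I" "\<And>i. i \<in> I \<Longrightarrow> g i \<in> \<real>\<^sub>\<ge>\<^sub>0"
  shows "sum g I \<in> \<real>\<^sub>\<ge>\<^sub>0" and "sum g I = 0 \<Longrightarrow> i \<in> I \<Longrightarrow> g i = 0"
proof -
  have g: "Re (g i) \<ge> 0" "Im (g i) = 0" if "i \<in> I" for i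
    using assms(2)[OF that] by (auto simp: complex_nonneg_Reals_iff)
  show "sum g I \<in> \<real>\<^sub>\<ge>\<^sub>0"
    using g by (auto simp: complex_nonneg_Reals_iff intro: sum_nonneg sum.neutral)
  show "g i = 0" if "sum g I = 0" "i \<in> I"
  proof -
    have "(\<Sum>i\<in>I. Re (g i)) = 0" using arg_cong[OF that(1), of Re] by simp
    then have "Re (g i) = 0" using sum_nonneg_eq_0_iff[of I "\<lambda>i. Re (g i)"] assms(1) g that(2) by blast
    then show ?thesis using g(2)[OF that(2)] by (simp add: complex_eq_iff)
  qed
qed

context bipartite_qpoly_base
begin

section \<open>Distances and eccentricities in the last subconstituent\<close>

abbreviation K :: "'v set" where "K \<equiv> sphere_at UNIV R d x"

abbreviation R2 :: "'v rel" where "R2 \<equiv> dist2_edges R K"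

lemma in_K: "y \<in> K \<longleftrightarrow> dist x y = d"
  by (simp add: sphere_at_def)

lemma K_even: "y \<in> K \<Longrightarrow> z \<in> K \<Longrightarrow> even (dist y z)"
  using even_dist[of x y] even_dist[of x z] even_dist[of y z] by (auto simp: in_K)

lemma T_nth: "T $ y $ z = (if y \<in> K \<and> z \<in> K then
    of_nat (c 2) * dm 2 $ y $ z + of_nat (b 0) * dm 0 $ y $ z else 0)"
proof -
  have e: "(M *v axis z 1) $ y = M $ y $ z" for M :: "complex^'v^'v" and y
    by (simp add: matrix_vector_mult_def axis_def if_distrib[of "\<lambda>t. _ * t"] cong: if_cong)
  have "A ** A = mscale (of_nat (c 2)) (dm 2) + mscale (of_nat (b 0)) (dm 0)"
    using A_dm[of 1] by (simp add: numeral_2_eq_2)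
  then have AA: "(A *v (A *v axis z 1)) $ y = of_nat (c 2) * dm 2 $ y $ z + of_nat (b 0) * dm 0 $ y $ z"
    by (simp add: matrix_vector_mul_assoc e)
  have ax: "(axis z 1 :: complex^'v) \<in> lev (dist x z)" by (auto simp: lev_def axis_def)
  have "T $ y $ z = (T *v axis z 1) $ y" by (simp add: e)
  also have "\<dots> = (if y \<in> K then (A *v (A *v (Es d *v axis z 1))) $ y else 0)"
    by (simp add: T_vec in_K)
  finally show ?thesis using AA by (auto simp: Es_on_lev[OF ax] in_K)
qed

lemma T_sym: "T $ y $ z = T $ z $ y"
  by (auto simp: T_nth dm_nth dist_sym)

lemma T_nth_nonneg: "T $ y $ z \<in> \<real>\<^sub>\<ge>\<^sub>0"
  by (auto simp: T_nth dm_nth complex_nonneg_Reals_iff)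

lemma T_nth_nonzero: "T $ y $ z \<noteq> 0 \<Longrightarrow> y \<in> K \<and> z \<in> K \<and> (y = z \<or> (z, y) \<in> R2)"
  by (auto simp: T_nth dm_nth dist2_edges_def dist_sym split: if_splits)

lemma T_nth_edge: "(z, y) \<in> R2 \<Longrightarrow> T $ y $ z \<noteq> 0"
  using cc_nonzero by (auto simp: T_nth dm_nth dist2_edges_def dist_sym split: if_splits)

lemma pol_T_support:
  "pol T m f \<Longrightarrow> f (axis z 1) $ y \<noteq> 0 \<Longrightarrow> \<exists>n\<le>m. (z, y) \<in> R2 ^^ n"
proof (induction arbitrary: y rule: pol.induct)
  case (pol_id m)
  then have "y = z" by (simp add: axis_def split: if_splits)
  then show ?case by (intro exI[of _ 0]) simp
next
  case (pol_add m f g)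
  then show ?case by force
next
  case (pol_scale m f s)
  then show ?case by force
next
  case (pol_step m f)
  then have "(\<Sum>u\<in>UNIV. T $ y $ u * f (axis z 1) $ u) \<noteq> 0" by (simp add: matrix_vector_mult_def)
  then obtain u where u: "T $ y $ u \<noteq> 0" "f (axis z 1) $ u \<noteq> 0"
    by (metis (mono_tags, lifting) mult_eq_0_iff sum.neutral)
  then obtain n where n: "n \<le> m" "(z, u) \<in> R2 ^^ n" using pol_step.IH by blast
  show ?case
  proof (cases "y = u")
    case True then show ?thesis using n by (intro exI[of _ n]) simp
  next
    case False
    then have "(u, y) \<in> R2" using T_nth_nonzero[OF u(1)] by auto
    then show ?thesis using n by (intro exI[of _ "Suc n"]) auto
  qed
qed

lemma axis_lev_d: "z \<in> K \<Longrightarrow> (axis z 1 :: complex^'v) \<in> lev d"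
  by (auto simp: lev_def axis_def in_K)

text \<open>On \<open>K\<close> the matrix \<open>dm (2 * i)\<close> acts as a polynomial of degree
  at most \<open>i\<close> in \<open>T\<close>, and each factor \<open>T\<close> moves the support
  by at most one edge of \<open>R2\<close>. A nonzero entry thus gives a walk of at most
  \<open>i\<close> steps, and fewer than \<open>i\<close> steps cannot cover distance
  \<open>2 * i\<close>.\<close>

lemma R2_path:
  assumes "y \<in> K" "z \<in> K" "dist z y = 2 * i"
  shows "(z, y) \<in> R2 ^^ i"
proof -
  have "2 * i \<le> d" using dist_le[of z y] assms by simp
  then obtain f where f: "pol T i f" "\<And>v. v \<in> lev d \<Longrightarrow> Es d *v (dm (2 * i) *v v) = f v"
    by (rule dm_pol_T) blast
  have "(dm (2 * i) *v axis z 1) $ y = 1"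
    using assms by (simp add: matrix_vector_mult_def axis_def dm_nth dist_sym[of y] if_distrib[of "\<lambda>t. _ * t"] cong: if_cong)
  then have "f (axis z 1) $ y \<noteq> 0"
    using f(2)[OF axis_lev_d[OF assms(2)]] assms(1) by (metis Es_vec in_K one_neq_zero)
  then obtain n where n: "n \<le> i" "(z, y) \<in> R2 ^^ n" using pol_T_support[OF f(1)] by blast
  then have "i \<le> n" using relpow_dist2_le[OF n(2)] assms by simp
  then show ?thesis using n by simp
qed

lemma gdist_R2:
  assumes "y \<in> K" "z \<in> K"
  shows "2 * gdist R2 z y = dist z y"
proof -
  obtain i where i: "dist z y = 2 * i" using K_even[OF assms(2,1)] by blast
  have p: "(z, y) \<in> R2 ^^ i" by (rule R2_path[OF assms i])
  then have "gdist R2 z y \<le> i" by (rule gdist_le)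
  moreover have "i \<le> gdist R2 z y"
    using relpow_dist2_le[OF relpow_gdist[OF relpow_imp_rtrancl[OF p]]] i by simp
  ultimately show ?thesis using i by simp
qed

text \<open>Column sums of \<open>T\<close>: a vertex of \<open>K\<close> has \<open>b 0\<close>
  neighbours, all on level \<open>d - 1\<close>, and each of them has \<open>b (d - 1)\<close>
  neighbours in \<open>K\<close>.\<close>

lemma sum_T:
  assumes "v \<in> lev d"
  shows "(\<Sum>y\<in>UNIV. (T *v v) $ y) = of_nat (b (d - 1)) * of_nat (b 0) * (\<Sum>y\<in>UNIV. v $ y)"
proof -
  have A: "(\<Sum>y\<in>UNIV. (A *v w) $ y) = of_nat (b 0) * (\<Sum>y\<in>UNIV. w $ y)" for w :: "complex^'v"
  proof -
    have "(\<Sum>y\<in>UNIV. (A *v w) $ y) = (\<Sum>z\<in>UNIV. (\<Sum>y\<in>UNIV. A $ y $ z) * w $ z)"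
      unfolding matrix_vector_mult_def vec_lambda_beta sum_distrib_right by (rule sum.swap)
    moreover have "(\<Sum>y\<in>UNIV. A $ y $ z) = of_nat (b 0)" for z
    proof -
      have "{y. (z, y) \<in> R \<and> dist z y = dist z z + 1} = {y. dist y z = 1}" 
        by (intro Collect_cong) (metis add_0 dist_eq_1 dist_sym gdist_self)
      then have "card {y. dist y z = 1} = b 0" using card_b[of z z] by simp
      then show ?thesis by (simp add: dm_nth sum.If_cases)
    qed
    ultimately show ?thesis by (simp add: sum_distrib_left)
  qed
  define w where "w = A *v v"
  have w: "w \<in> lev (d - 1)" unfolding w_def by (subst A_lev_up_d[OF assms]) simp
  have "(\<Sum>y\<in>UNIV. (Es d *v (A *v w)) $ y) = (\<Sum>y\<in>UNIV. \<Sum>z\<in>UNIV. (if dist x y = d then A $ y $ z else 0) * w $ z)"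
    unfolding Es_vec by (intro sum.cong refl) (simp add: matrix_vector_mult_def)
  also have "\<dots> = (\<Sum>z\<in>UNIV. (\<Sum>y\<in>UNIV. if dist x y = d then A $ y $ z else 0) * w $ z)"
    unfolding sum_distrib_right by (rule sum.swap)
  also have "\<dots> = (\<Sum>z\<in>UNIV. of_nat (b (d - 1)) * w $ z)"
  proof (intro sum.cong refl)
    fix z
    show "(\<Sum>y\<in>UNIV. if dist x y = d then A $ y $ z else 0) * w $ z = of_nat (b (d - 1)) * w $ z"
    proof (cases "w $ z = 0")
      case False
      then have z: "dist x z = d - 1" using w by (auto simp: lev_def)
      have "(\<Sum>y\<in>UNIV. if dist x y = d then A $ y $ z else 0) = (\<Sum>y\<in>UNIV. if dist x y = d \<and> dist z y = 1 then 1 else 0)"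
        by (intro sum.cong refl) (simp add: dm_nth dist_sym)
      also have "\<dots> = of_nat (card {y. dist x y = d \<and> dist z y = 1})" by (simp add: sum.If_cases)
      also have "{y. dist x y = d \<and> dist z y = 1} = {y. (z, y) \<in> R \<and> dist x y = dist x z + 1}"
        using z d_ge dist_eq_1 by auto
      finally show ?thesis using card_b[of z x] z by simp
    qed simp
  qed
  finally show ?thesis using T_on_lev[OF assms] A[of v] by (simp add: w_def mult_ac flip: sum_distrib_left)
qed

lemma sum_pol_T: "pol T m f \<Longrightarrow> \<exists>s. \<forall>v\<in>lev d. (\<Sum>y\<in>UNIV. f v $ y) = s * (\<Sum>y\<in>UNIV. v $ y)"
proof (induction rule: pol.induct)
  case (pol_id m)
  then show ?case by (intro exI[of _ 1]) simp
next
  case (pol_add m f g)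
  then obtain s t where "\<forall>v\<in>lev d. (\<Sum>y\<in>UNIV. f v $ y) = s * (\<Sum>y\<in>UNIV. v $ y)"
    "\<forall>v\<in>lev d. (\<Sum>y\<in>UNIV. g v $ y) = t * (\<Sum>y\<in>UNIV. v $ y)" by blast
  then show ?case by (intro exI[of _ "s + t"]) (simp add: sum.distrib algebra_simps)
next
  case (pol_scale m f r)
  then obtain s where "\<forall>v\<in>lev d. (\<Sum>y\<in>UNIV. f v $ y) = s * (\<Sum>y\<in>UNIV. v $ y)" by blast
  then show ?case by (intro exI[of _ "r * s"]) (simp add: mult.assoc flip: sum_distrib_left)
next
  case (pol_step m f)
  then obtain s where "\<forall>v\<in>lev d. (\<Sum>y\<in>UNIV. f v $ y) = s * (\<Sum>y\<in>UNIV. v $ y)" by blast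
  then show ?case
    by (intro exI[of _ "of_nat (b (d - 1)) * of_nat (b 0) * s"]) (simp add: sum_T pol_T_lev[OF pol_step.hyps])
qed

text \<open>Polynomials in \<open>T\<close> inherit the constant column sums. Applied to
  \<open>dm (2 * i)\<close>, this says that the number of vertices of \<open>K\<close> at distance
  \<open>2 * i\<close> does not depend on the vertex of \<open>K\<close>.\<close>

lemma eccentricity_K:
  assumes "y \<in> K" "z \<in> K" "dist z y = 2 * i" "z' \<in> K"
  obtains y' where "y' \<in> K" "dist z' y' = 2 * i"
proof -
  have "2 * i \<le> d" using dist_le[of z y] assms by simp
  then obtain f where f: "pol T i f" "\<And>v. v \<in> lev d \<Longrightarrow> Es d *v (dm (2 * i) *v v) = f v"
    by (rule dm_pol_T) blast
  obtain s where s: "\<forall>v\<in>lev d. (\<Sum>y\<in>UNIV. f v $ y) = s * (\<Sum>y\<in>UNIV. v $ y)"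
    using sum_pol_T[OF f(1)] by blast
  have nth: "f (axis u 1) $ y = (if y \<in> K \<and> dist u y = 2 * i then 1 else 0)" if "u \<in> K" for u y
  proof -
    have "(dm (2 * i) *v axis u 1) $ y = dm (2 * i) $ y $ u"
      by (simp add: matrix_vector_mult_def axis_def if_distrib[of "\<lambda>t. _ * t"] cong: if_cong)
    then show ?thesis unfolding f(2)[OF axis_lev_d[OF that], symmetric]
      by (simp add: in_K dm_nth dist_sym)
  qed
  have cnt: "of_nat (card {y \<in> K. dist u y = 2 * i}) = s" if "u \<in> K" for u
  proof -
    have "(\<Sum>y\<in>UNIV. f (axis u 1) $ y) = s * (\<Sum>y\<in>UNIV. (axis u 1 :: complex^'v) $ y)"
      using s axis_lev_d[OF that] by blast
    moreover have "(\<Sum>y\<in>UNIV. (axis u 1 :: complex^'v) $ y) = 1" by (simp add: axis_def)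
    moreover have "(\<Sum>y\<in>UNIV. f (axis u 1) $ y) = of_nat (card {y \<in> K. dist u y = 2 * i})"
      unfolding nth[OF that] by (simp add: sum.If_cases)
    ultimately show ?thesis by simp
  qed
  have "(of_nat (card {y \<in> K. dist z' y = 2 * i}) :: complex) = of_nat (card {y \<in> K. dist z y = 2 * i})"
    using cnt assms by simp
  then have "card {y \<in> K. dist z' y = 2 * i} = card {y \<in> K. dist z y = 2 * i}" by (simp only: of_nat_eq_iff)
  moreover have "card {y \<in> K. dist z y = 2 * i} > 0" using assms by (auto simp: card_gt_0_iff)
  ultimately have "{y \<in> K. dist z' y = 2 * i} \<noteq> {}" by (metis card.empty less_irrefl)
  then show thesis using that by blast
qed

subsection \<open>Covering radius\<close>

primrec iter :: "(nat \<Rightarrow> complex) \<Rightarrow> complex^'v \<Rightarrow> nat \<Rightarrow> complex^'v" where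
  "iter \<mu> v 0 = v"
| "iter \<mu> v (Suc n) = T *v iter \<mu> v n - \<mu> n *s iter \<mu> v n"

lemma iter_eigen:
  assumes "\<And>j. j \<in> J \<Longrightarrow> T *v g j = l j *s g j"
  shows "iter \<mu> (\<Sum>j\<in>J. g j) n = (\<Sum>j\<in>J. (\<Prod>i<n. l j - \<mu> i) *s g j)"
proof (induction n)
  case (Suc n)
  have "T *v (\<Sum>j\<in>J. (\<Prod>i<n. l j - \<mu> i) *s g j) = (\<Sum>j\<in>J. T *v ((\<Prod>i<n. l j - \<mu> i) *s g j))"
    by (rule vec.linear_sum) (rule matrix_vector_mul_linear_gen)
  also have "\<dots> = (\<Sum>j\<in>J. l j *s ((\<Prod>i<n. l j - \<mu> i) *s g j))"
    using assms by (intro sum.cong refl) (simp add: vector_scalar_commute mult.commute)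
  finally show ?case
    by (simp add: Suc vec.scale_sum_right sum_subtractf[symmetric] algebra_simps vector_sub_rdistrib)
qed simp

lemma iter_vanish: "m \<le> n \<Longrightarrow> iter \<mu> v m = 0 \<Longrightarrow> iter \<mu> v n = 0"
  by (induction n rule: dec_induct) simp_all

text \<open>At a vertex whose distance to \<open>Y\<close> is at least \<open>2 * n\<close>, the
  shifts by \<mu> contribute nothing. What remains is a sum over walks of length \<open>n\<close>
  with nonnegative weights, so nothing can cancel.\<close>

lemma iter_char_vec:
  assumes Y: "Y \<subseteq> K"
  shows "y \<in> K \<Longrightarrow> \<forall>z\<in>Y. 2 * n \<le> dist z y \<Longrightarrow> iter \<mu> (char_vec Y) n $ y \<in> \<real>\<^sub>\<ge>\<^sub>0 \<and>
    ((\<exists>z\<in>Y. dist z y = 2 * n) \<longleftrightarrow> iter \<mu> (char_vec Y) n $ y \<noteq> 0)"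
proof (induction n arbitrary: y)
  case 0
  then show ?case by (auto simp: char_vec_def complex_nonneg_Reals_iff)
next
  case (Suc n)
  let ?f = "iter \<mu> (char_vec Y) n"
  have y0: "?f $ y = 0" using Suc.IH[OF Suc.prems(1)] Suc.prems(2) by force
  have near: "2 * n \<le> dist z u" "dist z y \<le> dist z u + 2" if "z \<in> Y" "T $ y $ u \<noteq> 0" for z u
  proof -
    have "dist u y \<le> 2" using T_nth_nonzero[OF that(2)] by (auto simp: dist2_edges_def)
    then show "dist z y \<le> dist z u + 2" using dist_triangle[of z y u] by simp
    then show "2 * n \<le> dist z u" using Suc.prems(2) that(1) by fastforce
  qed
  have IH: "?f $ u \<in> \<real>\<^sub>\<ge>\<^sub>0" "(\<exists>z\<in>Y. dist z u = 2 * n) \<longleftrightarrow> ?f $ u \<noteq> 0" if "T $ y $ u \<noteq> 0" for u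
    using Suc.IH[of u] T_nth_nonzero[OF that] near(1) that by blast+
  have eq: "iter \<mu> (char_vec Y) (Suc n) $ y = (\<Sum>u\<in>UNIV. T $ y $ u * ?f $ u)"
    using y0 by (simp add: matrix_vector_mult_def)
  have nn: "T $ y $ u * ?f $ u \<in> \<real>\<^sub>\<ge>\<^sub>0" for u
    using IH(1)[of u] T_nth_nonneg[of y u] by (cases "T $ y $ u = 0") (auto intro: nonneg_Reals_mult_I)
  have "(\<exists>z\<in>Y. dist z y = 2 * Suc n) \<longleftrightarrow> (\<Sum>u\<in>UNIV. T $ y $ u * ?f $ u) \<noteq> 0"
  proof
    assume "\<exists>z\<in>Y. dist z y = 2 * Suc n"
    then obtain z where z: "z \<in> Y" "dist z y = 2 * Suc n" by blast
    then have "(z, y) \<in> R2 ^^ Suc n" using R2_path Y Suc.prems(1) by blast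
    then obtain u where u: "(z, u) \<in> R2 ^^ n" "(u, y) \<in> R2" by auto
    have T: "T $ y $ u \<noteq> 0" using T_nth_edge u(2) by blast
    have "dist z u = 2 * n" using relpow_dist2_le[OF u(1)] near(1)[OF z(1) T] by simp
    then have "T $ y $ u * ?f $ u \<noteq> 0" using IH(2)[OF T] z(1) T by auto
    then show "(\<Sum>u\<in>UNIV. T $ y $ u * ?f $ u) \<noteq> 0"
      using sum_nonneg_Reals(2)[of UNIV "\<lambda>u. T $ y $ u * ?f $ u" u] nn by auto
  next
    assume "(\<Sum>u\<in>UNIV. T $ y $ u * ?f $ u) \<noteq> 0"
    then obtain u where u: "T $ y $ u \<noteq> 0" "?f $ u \<noteq> 0"
      by (metis (mono_tags, lifting) mult_eq_0_iff sum.neutral)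
    then obtain z where "z \<in> Y" "dist z u = 2 * n" using IH(2) by blast
    then show "\<exists>z\<in>Y. dist z y = 2 * Suc n" using near(2)[OF _ u(1), of z] Suc.prems(2) by (intro bexI[of _ z]) force+
  qed
  then show ?case unfolding eq using sum_nonneg_Reals(1)[of UNIV "\<lambda>u. T $ y $ u * ?f $ u"] nn by simp
qed

text \<open>If the characteristic vector of \<open>Y\<close> involves at most \<open>card \<Lambda>\<close> eigenvalues of \<open>T\<close>, some
  product of \<open>card \<Lambda>\<close> factors \<open>T - \<mu>\<close> kills it, whereas such a product is nonzero at the points
  at distance \<open>2 * card \<Lambda>\<close> from \<open>Y\<close>.\<close>

lemma covering_radius:
  assumes Y: "Y \<subseteq> K" "Y \<noteq> {}"
    and chi: "char_vec Y = (\<Sum>j\<in>J. g j)" "\<And>j. j \<in> J \<Longrightarrow> T *v g j = l j *s g j"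
    and L: "finite \<Lambda>" "l ` J \<subseteq> \<Lambda>" and "finite J" and y: "y \<in> K"
  shows "\<exists>z\<in>Y. dist z y < 2 * card \<Lambda>"
proof (rule ccontr)
  assume "\<not> ?thesis"
  then have far: "2 * card \<Lambda> \<le> dist z y" if "z \<in> Y" for z using that by force
  obtain \<mu> where \<mu>: "bij_betw \<mu> {0..<card \<Lambda>} \<Lambda>" using ex_bij_betw_nat_finite[OF L(1)] by blast
  have "iter \<mu> (char_vec Y) (card \<Lambda>) = (\<Sum>j\<in>J. (\<Prod>i<card \<Lambda>. l j - \<mu> i) *s g j)"
    unfolding chi(1) by (rule iter_eigen[OF chi(2)])
  also have "\<dots> = 0"
  proof (intro sum.neutral ballI)
    fix j assume "j \<in> J"
    then have "l j \<in> \<mu> ` {0..<card \<Lambda>}" using \<mu> L(2) by (auto simp: bij_betw_def)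
    then have "(\<Prod>i<card \<Lambda>. l j - \<mu> i) = 0" by (auto simp: prod_zero_iff)
    then show "(\<Prod>i<card \<Lambda>. l j - \<mu> i) *s g j = 0" by simp
  qed
  finally have zero: "iter \<mu> (char_vec Y) (card \<Lambda>) = 0" .
  \<comment> \<open>With a nearest member \<open>z\<close> and \<open>n\<close> half its distance,
    \<open>n\<close> factors leave a nonzero entry at \<open>y\<close>, although
    \<open>card \<Lambda>\<close> factors, no more than \<open>n\<close>, already annihilate the
    vector.\<close>
  obtain z where z: "z \<in> Y" "\<And>z'. z' \<in> Y \<Longrightarrow> dist z y \<le> dist z' y"
    using ex_has_least_nat[of "\<lambda>z. z \<in> Y" _ "\<lambda>z. dist z y"] Y(2) by blast
  obtain n where n: "dist z y = 2 * n" using K_even z(1) Y(1) y by (metis evenE subsetD)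
  have "iter \<mu> (char_vec Y) n $ y \<noteq> 0" using iter_char_vec[OF Y(1) y, of n \<mu>] z n by auto
  moreover have "iter \<mu> (char_vec Y) n = 0"
    by (rule iter_vanish[OF _ zero]) (use far[OF z(1)] n in simp)
  ultimately show False by simp
qed

end

section \<open>Irreducible modules\<close>

text \<open>The abstract form of a split decomposition, to be used once with \<open>A\<close> as the
  raising map and once with \<open>B\<close>. The indices run over all natural numbers, so that only
  the bottom piece needs a special case.\<close>

lemma split_invariant:
  fixes M N :: "complex^'v::finite^'v"
  assumes M: "\<And>i v. v \<in> F i \<Longrightarrow> M *v v - \<alpha> i *s v \<in> F (Suc i)"
    and N: "\<And>i v. v \<in> F i \<Longrightarrow> N *v v - \<beta> i *s v \<in> (case i of 0 \<Rightarrow> {0} | Suc j \<Rightarrow> F j)"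
    and v: "v \<in> vec.span (\<Union>i. F i)"
  shows "M *v v \<in> vec.span (\<Union>i. F i)" "N *v v \<in> vec.span (\<Union>i. F i)"
proof -
  let ?S = "vec.span (\<Union>i. F i)"
  have F: "w \<in> ?S" if "w \<in> F i" for w i using that by (auto intro: vec.span_base)
  have base: "M *v w \<in> ?S" "N *v w \<in> ?S" if w: "w \<in> F i" for w i
  proof -
    have "(M *v w - \<alpha> i *s w) + \<alpha> i *s w \<in> ?S"
      using F[OF M[OF w]] F[OF w] by (intro vec.span_add vec.span_scale)
    then show "M *v w \<in> ?S" by simp
    have "N *v w - \<beta> i *s w \<in> ?S"
      using N[OF w] F vec.span_zero by (cases i) auto
    then have "(N *v w - \<beta> i *s w) + \<beta> i *s w \<in> ?S"
      using F[OF w] by (intro vec.span_add vec.span_scale)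
    then show "N *v w \<in> ?S" by simp
  qed
  show "M *v v \<in> ?S"
    using v
  proof (induction rule: vec.span_induct_alt)
    case (step c w u)
    then obtain i where "w \<in> F i" by blast
    then have "c *s (M *v w) + M *v u \<in> ?S"
      using step base(1) by (intro vec.span_add vec.span_scale) blast+
    then show ?case by (simp add: matrix_vector_right_distrib vector_scalar_commute)
  qed (simp add: vec.span_zero)
  show "N *v v \<in> ?S"
    using v
  proof (induction rule: vec.span_induct_alt)
    case (step c w u)
    then obtain i where "w \<in> F i" by blast
    then have "c *s (N *v w) + N *v u \<in> ?S"
      using step base(2) by (intro vec.span_add vec.span_scale) blast+
    then show ?case by (simp add: matrix_vector_right_distrib vector_scalar_commute)
  qed (simp add: vec.span_zero)
qed

context bipartite_qpoly_base
begin

lemma E_vec_eigen: "k \<le> d \<Longrightarrow> E k *v (A *v v) = th k *s (E k *v v)"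
  by (simp add: matrix_vector_mul_assoc E_A[unfolded One_nat_def] mscale_vec)

lemma E_B_expand: "k \<le> d \<Longrightarrow> E k *v (B *v v) = (\<Sum>l\<le>d. E k *v (B *v (E l *v v)))"
proof -
  have "E k *v (B *v v) = (E k ** B) *v (\<Sum>l\<le>d. E l *v v)"
    by (simp add: sum_E_vec matrix_vector_mul_assoc)
  also have "\<dots> = (\<Sum>l\<le>d. (E k ** B) *v (E l *v v))"
    by (rule vec.linear_sum) (rule matrix_vector_mul_linear_gen)
  finally show ?thesis by (simp add: matrix_vector_mul_assoc matrix_mul_assoc)
qed

lemma E_B_vanish:
  assumes "k \<le> d" "\<And>l. l \<le> d \<Longrightarrow> l \<le> k + 1 \<Longrightarrow> k \<le> l + 1 \<Longrightarrow> E l *v v = 0"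
  shows "E k *v (B *v v) = 0"
proof (subst E_B_expand[OF assms(1)], intro sum.neutral ballI)
  fix l assume "l \<in> {..d}"
  then have l: "l \<le> d" by simp
  show "E k *v (B *v (E l *v v)) = 0"
  proof (cases "l \<le> k + 1 \<and> k \<le> l + 1")
    case True then show ?thesis using assms(2) l by simp
  next
    case False
    then have "E k ** B ** E l = 0" using assms(1) l by (intro E_dual_adj_E) auto
    then show ?thesis by (simp add: matrix_vector_mul_assoc matrix_mul_assoc)
  qed
qed

lemma E_all_zero: "(\<And>k. k \<le> d \<Longrightarrow> E k *v v = 0) \<Longrightarrow> v = 0"
  using sum_E_vec[of v] by simp

section \<open>Terwilliger modules and complete reducibility\<close>

lemma T_moduleD:
  assumes "T_module R x W"
  shows T_module_subspace: "vec.subspace W"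
    and T_module_BM: "M \<in> BM \<Longrightarrow> w \<in> W \<Longrightarrow> M *v w \<in> W"
    and T_module_Es: "i \<le> d \<Longrightarrow> w \<in> W \<Longrightarrow> Es i *v w \<in> W"
proof -
  have "Es i \<in> terwilliger R x" if "i \<le> d" by (rule terwilliger.dual) (simp add: that)
  then show "vec.subspace W" "M \<in> BM \<Longrightarrow> w \<in> W \<Longrightarrow> M *v w \<in> W" "i \<le> d \<Longrightarrow> w \<in> W \<Longrightarrow> Es i *v w \<in> W"
    using assms unfolding T_module_def by (auto intro: terwilliger.bm)
qed

lemma T_module_level_function:
  assumes W: "T_module R x W" "w \<in> W"
  shows "(\<chi> u. h (dist x u) * w $ u) \<in> W"
proof -
  have "(\<chi> u. h (dist x u) * w $ u) = (\<Sum>i\<le>d. h i *s (Es i *v w))"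
    using dist_le by (simp add: vec_eq_iff if_distrib[of "\<lambda>t. _ * t"] cong: if_cong)
  also have "\<dots> \<in> W"
    using T_moduleD[OF W(1)] W(2) by (intro vec.subspace_sum vec.subspace_scale) auto
  finally show ?thesis .
qed

lemma T_module_B: "T_module R x W \<Longrightarrow> w \<in> W \<Longrightarrow> B *v w \<in> W"
  using T_module_level_function[of W w ts] by (simp add: vec_eq_iff[symmetric] dual_adj_def matrix_vector_mult_def
      if_distrib[of "\<lambda>t. t * _"] cong: if_cong)

text \<open>\<open>A\<close> generates the Bose-Mesner algebra. As the dual eigenvalues are
  distinct, each \<open>Es i\<close> is a Lagrange interpolation polynomial in
  \<open>B\<close>.\<close>

lemma T_moduleI:
  assumes W: "vec.subspace W" and A: "\<And>w. w \<in> W \<Longrightarrow> A *v w \<in> W" and B: "\<And>w. w \<in> W \<Longrightarrow> B *v w \<in> W"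
  shows "T_module R x W"
proof -
  have prod: "finite J \<Longrightarrow> w \<in> W \<Longrightarrow> (\<chi> u. (\<Prod>j\<in>J. ts (dist x u) - ts j) * w $ u) \<in> W" for J w
  proof (induction J arbitrary: w rule: finite_induct)
    case (insert j J)
    have "B *v w - ts j *s w \<in> W" using B insert.prems W vec.subspace_diff vec.subspace_scale by blast
    from insert.IH[OF this] insert.hyps show ?case by (simp add: algebra_simps)
  qed simp
  have Es: "Es i *v w \<in> W" if "i \<le> d" "w \<in> W" for i w
  proof -
    let ?J = "{..d} - {i}"
    let ?c = "\<Prod>j\<in>?J. ts i - ts j"
    have c: "?c \<noteq> 0" using ts_inj that(1) by (auto simp: prod_zero_iff)
    have "(\<Prod>j\<in>?J. ts (dist x u) - ts j) = (if dist x u = i then ?c else 0)" for u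
      using dist_le[of x u] by (auto simp: prod_zero_iff)
    then have "Es i *v w = (1 / ?c) *s (\<chi> u. (\<Prod>j\<in>?J. ts (dist x u) - ts j) * w $ u)"
      using c by (simp add: vec_eq_iff)
    then show ?thesis using prod[of ?J w] that(2) W vec.subspace_scale by auto
  qed
  have BM: "\<forall>w\<in>W. M *v w \<in> W" if "M \<in> BM" for M
    using that
  proof (induction M rule: BM_induct)
    case (mult M)
    then show ?case using A by (simp flip: matrix_vector_mul_assoc)
  qed (simp_all add: matrix_vector_mult_add_rdistrib mscale_vec vec.subspace_add[OF W] vec.subspace_scale[OF W])
  have "\<forall>w\<in>W. M *v w \<in> W" if "M \<in> terwilliger R x" for M
    using that
  proof (induction M rule: terwilliger.induct)
    case (mult M N)
    then show ?case by (simp flip: matrix_vector_mul_assoc)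
  qed (simp_all add: BM Es matrix_vector_mult_add_rdistrib mscale_vec vec.subspace_add[OF W] vec.subspace_scale[OF W])
  then show ?thesis unfolding T_module_def using W by blast
qed

lemma T_module_ocomp:
  assumes W: "T_module R x W"
  shows "T_module R x (ocomp W)"
proof (rule T_moduleI[OF subspace_ocomp])
  fix v assume v: "v \<in> ocomp W"
  have "cip w (A *v v) = 0" if "w \<in> W" for w
    using v T_module_BM[OF W BM_adj[OF dm_in_BM] that] cip_adj[of "adj A" w v] by (auto simp: ocomp_def)
  then show "A *v v \<in> ocomp W" by (auto simp: ocomp_def)
  have "cip w (B *v v) = 0" if "w \<in> W" for w
    using v T_module_B[OF W that] cip_adj[of B w v] by (auto simp: ocomp_def adj_dual_adj)
  then show "B *v v \<in> ocomp W" by (auto simp: ocomp_def)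
qed

text \<open>The orthogonal complement of the sum of all irreducible modules is a module. If it were
  nonzero, a nonzero submodule of least dimension in it would be irreducible and hence orthogonal to
  itself.\<close>

lemma irreducible_span_UNIV: "vec.span (\<Union>{W. irreducible_T_module R x W}) = UNIV"
proof (rule ccontr)
  let ?S = "vec.span (\<Union>{W. irreducible_T_module R x W})"
  assume neq: "?S \<noteq> UNIV"
  have inv: "M *v v \<in> ?S" if M: "\<And>W w. T_module R x W \<Longrightarrow> w \<in> W \<Longrightarrow> M *v w \<in> W" and v: "v \<in> ?S" for M v
    using v
  proof (induction rule: vec.span_induct_alt)
    case (step c w u)
    then obtain W where W: "irreducible_T_module R x W" "w \<in> W" by blast
    then have "M *v w \<in> W" using M by (auto simp: irreducible_T_module_def)
    then have "M *v w \<in> ?S" using W by (intro vec.span_base) blast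
    then show ?case using step
      by (auto simp: matrix_vector_right_distrib vector_scalar_commute intro: vec.span_add vec.span_scale)
  qed (simp add: vec.span_zero)
  have "T_module R x ?S"
  proof (rule T_moduleI[OF vec.subspace_span])
    fix w assume w: "w \<in> ?S"
    show "A *v w \<in> ?S" by (rule inv[OF T_module_BM[OF _ dm_in_BM] w])
    show "B *v w \<in> ?S" by (rule inv[OF T_module_B w])
  qed
  then have comp: "T_module R x (ocomp ?S)" by (rule T_module_ocomp)
  have "ocomp ?S \<noteq> {0}"
  proof
    assume "ocomp ?S = {0}"
    then have "v \<in> ?S" for v
      using orthogonal_decomposition[OF vec.subspace_span, of "\<Union>{W. irreducible_T_module R x W}" v]
      by (metis add.right_neutral singletonD)
    then show False using neq by blast
  qed
  then have ocomp: "T_module R x (ocomp ?S) \<and> ocomp ?S \<noteq> {0} \<and> ocomp ?S \<subseteq> ocomp ?S" using comp by blast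
  obtain W where W: "T_module R x W" "W \<noteq> {0}" "W \<subseteq> ocomp ?S"
    and least: "\<And>W'. T_module R x W' \<and> W' \<noteq> {0} \<and> W' \<subseteq> ocomp ?S \<Longrightarrow> vec.dim W \<le> vec.dim W'"
    using ex_has_least_nat[of "\<lambda>W. T_module R x W \<and> W \<noteq> {0} \<and> W \<subseteq> ocomp ?S" _ vec.dim, OF ocomp] by blast
  have "irreducible_T_module R x W"
    unfolding irreducible_T_module_def
  proof (intro conjI allI impI)
    fix W' assume W': "T_module R x W' \<and> W' \<subseteq> W"
    show "W' = {0} \<or> W' = W"
    proof (cases "W' = {0}")
      case False
      then have "vec.dim W \<le> vec.dim W'" using least W' W by blast
      then show ?thesis
        using vec.subspace_dim_equal[of W' W] W' W T_module_subspace by blast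
    qed simp
  qed (use W in auto)
  then have "W \<subseteq> ?S" by (auto intro: vec.span_base)
  then have "W \<subseteq> {0}" using W(3) ocomp_inter by blast
  then show False using W(2) vec.subspace_0[OF T_module_subspace[OF W(1)]] by blast
qed

lemma image_zero_iff:
  assumes "vec.subspace W"
  shows "(*v) (M :: complex^'v^'v) ` W \<noteq> {0} \<longleftrightarrow> (\<exists>w\<in>W. M *v w \<noteq> 0)"
proof -
  have "0 \<in> (*v) M ` W" using vec.subspace_0[OF assms] by (intro image_eqI[of _ _ 0]) auto
  then show ?thesis by blast
qed

section \<open>Endpoints and split decompositions\<close>

lemma dual_endpointE:
  assumes W: "T_module R x W" "W \<noteq> {0}"
  obtains w where "w \<in> W" "E (dual_endpoint R E W) *v w \<noteq> 0" "dual_endpoint R E W \<le> d"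
    "\<And>k v. v \<in> W \<Longrightarrow> k \<le> d \<Longrightarrow> k < dual_endpoint R E W \<Longrightarrow> E k *v v = 0"
proof -
  have sub: "vec.subspace W" by (rule T_module_subspace[OF W(1)])
  define I where "I = {i. i \<le> d \<and> (\<exists>w\<in>W. E i *v w \<noteq> 0)}"
  have I: "dual_endpoint R E W = Min I"
    by (simp add: dual_endpoint_def I_def image_zero_iff[OF sub])
  have fin: "finite I" unfolding I_def by simp
  obtain w where "w \<in> W" "w \<noteq> 0" using W(2) vec.subspace_0[OF sub] by blast
  then have "I \<noteq> {}" using E_all_zero[of w] unfolding I_def by blast
  then have "Min I \<in> I" using fin by simp
  then obtain w where "w \<in> W" "E (dual_endpoint R E W) *v w \<noteq> 0" "dual_endpoint R E W \<le> d"
    unfolding I by (auto simp: I_def)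
  moreover have "E k *v v = 0" if "v \<in> W" "k \<le> d" "k < dual_endpoint R E W" for k v
  proof (rule ccontr)
    assume "E k *v v \<noteq> 0"
    then have "k \<in> I" using that unfolding I_def by blast
    then have "Min I \<le> k" using fin by simp
    then show False using that(3) unfolding I by simp
  qed
  ultimately show thesis using that by blast
qed

lemma endpointE:
  assumes W: "T_module R x W" "W \<noteq> {0}"
  obtains w u where "w \<in> W" "w $ u \<noteq> 0" "dist x u = endpoint R x W"
    "\<And>v u. v \<in> W \<Longrightarrow> v $ u \<noteq> 0 \<Longrightarrow> endpoint R x W \<le> dist x u"
proof -
  have sub: "vec.subspace W" by (rule T_module_subspace[OF W(1)])
  define I where "I = {i. i \<le> d \<and> (\<exists>w\<in>W. Es i *v w \<noteq> 0)}"
  have I: "endpoint R x W = Min I"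
    by (simp add: endpoint_def I_def image_zero_iff[OF sub])
  have fin: "finite I" unfolding I_def by simp
  have le: "Min I \<le> dist x u" if "v \<in> W" "v $ u \<noteq> 0" for v u
  proof -
    have "(Es (dist x u) *v v) $ u \<noteq> 0" using that by simp
    then have "Es (dist x u) *v v \<noteq> 0" by (metis zero_index)
    then have "dist x u \<in> I" using dist_le that unfolding I_def by blast
    then show ?thesis using fin by simp
  qed
  obtain w where "w \<in> W" "w \<noteq> 0" using W(2) vec.subspace_0[OF sub] by blast
  then obtain u where u: "w $ u \<noteq> 0" by (auto simp: vec_eq_iff)
  then have "(Es (dist x u) *v w) $ u \<noteq> 0" by simp
  then have "Es (dist x u) *v w \<noteq> 0" by (metis zero_index)
  then have "dist x u \<in> I" using dist_le \<open>w \<in> W\<close> unfolding I_def by blast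
  then have "Min I \<in> I" using fin by (intro Min_in) auto
  then obtain w where w: "w \<in> W" "Es (Min I) *v w \<noteq> 0" by (auto simp: I_def)
  then obtain u where "(Es (Min I) *v w) $ u \<noteq> 0" by (auto simp: vec_eq_iff simp del: Es_vec)
  then have "w $ u \<noteq> 0" "dist x u = Min I" by (auto split: if_splits)
  then show thesis using that[of w u] w(1) le I by simp
qed

lemma signed_vec:
  "signed M *v v = (\<chi> u. (-1) ^ dist x u * (M *v (\<chi> u. (-1) ^ dist x u * v $ u)) $ u)"
  unfolding vec_eq_iff matrix_vector_mult_def vec_lambda_beta signed_nth sum_distrib_left
  by (intro allI sum.cong refl) (subst dist_sign[of _ _ x], simp only: mult_ac)

text \<open>The diagonal matrix of signs is a combination of the \<open>Es i\<close>, so it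
  preserves \<open>W\<close>, and conjugation by it exchanges \<open>E k\<close> and
  \<open>E (d - k)\<close>. The set of \<open>k\<close> for which \<open>E k\<close> is nonzero on
  \<open>W\<close> is therefore symmetric.\<close>

lemma dual_endpoint_top:
  assumes W: "T_module R x W" "W \<noteq> {0}"
  shows "\<exists>w\<in>W. E (d - dual_endpoint R E W) *v w \<noteq> 0"
    and "v \<in> W \<Longrightarrow> k \<le> d \<Longrightarrow> d - dual_endpoint R E W < k \<Longrightarrow> E k *v v = 0"
    and "2 * dual_endpoint R E W \<le> d"
proof -
  let ?t = "dual_endpoint R E W" and ?s = "\<lambda>v :: complex^'v. \<chi> u. (-1) ^ dist x u * v $ u"
  obtain w where w: "w \<in> W" "E ?t *v w \<noteq> 0" "?t \<le> d"
    and low: "\<And>k v. v \<in> W \<Longrightarrow> k \<le> d \<Longrightarrow> k < ?t \<Longrightarrow> E k *v v = 0"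
    using dual_endpointE[OF W] by blast
  have sW: "?s v \<in> W" if "v \<in> W" for v
    using T_module_level_function[OF W(1) that, of "\<lambda>i. (-1) ^ i"] .
  have ss: "?s (?s v) = v" for v by (simp add: vec_eq_iff minus_one_power_iff)
  have E: "E (d - k) *v v = ?s (E k *v ?s v)" if "k \<le> d" for k v
    unfolding signed_E[OF that, symmetric] by (rule signed_vec)
  have "E (d - ?t) *v ?s w = ?s (E ?t *v w)" unfolding E[OF w(3)] ss ..
  moreover have "?s (E ?t *v w) \<noteq> 0" using w(2) ss[of "E ?t *v w"] by (metis vec_lambda_beta mult_zero_right vec_eq_iff zero_index)
  ultimately show top: "\<exists>w\<in>W. E (d - ?t) *v w \<noteq> 0" using sW[OF w(1)] by metis
  show "E k *v v = 0" if "v \<in> W" "k \<le> d" "d - ?t < k" for v k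
  proof -
    have "E (d - k) *v ?s v = 0" using low[OF sW[OF that(1)], of "d - k"] that by auto
    then show ?thesis using E[of "d - k" v] that(2) by (simp add: vec_eq_iff)
  qed
  show "2 * ?t \<le> d" using top low[of _ "d - ?t"] w(3) by fastforce
qed

lemma irreducibleD:
  assumes "irreducible_T_module R x W"
  shows "T_module R x W" "W \<noteq> {0}"
    "T_module R x W' \<Longrightarrow> W' \<subseteq> W \<Longrightarrow> v \<in> W' \<Longrightarrow> v \<noteq> 0 \<Longrightarrow> W' = W"
  using assms unfolding irreducible_T_module_def by auto

text \<open>The spanning sets form a split decomposition: up to scalars, \<open>A\<close> maps the \<open>i\<close>-th into the
  next one and \<open>A\<^sup>*\<close> into the previous one, so that their span is a module.\<close>

lemma irreducible_split_last:
  assumes W: "irreducible_T_module R x W"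
    and v: "v \<in> W" "v \<in> lev d" "v \<noteq> 0" and s: "\<And>k. k \<le> d \<Longrightarrow> k < s \<Longrightarrow> E k *v v = 0"
  shows "W \<subseteq> vec.span (\<Union>i. {v \<in> W. (\<forall>u. v $ u \<noteq> 0 \<longrightarrow> d \<le> dist x u + i) \<and> (\<forall>k\<le>d. k < i + s \<longrightarrow> E k *v v = 0)})"
proof -
  define F where "F i = {v \<in> W. (\<forall>u. v $ u \<noteq> 0 \<longrightarrow> d \<le> dist x u + i) \<and> (\<forall>k\<le>d. k < i + s \<longrightarrow> E k *v v = 0)}" for i
  note TW = irreducibleD(1)[OF W]
  note sub = T_module_subspace[OF TW]
  have A: "A *v w - th (i + s) *s w \<in> F (Suc i)" if w: "w \<in> F i" for i w
    unfolding F_def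
  proof (intro CollectI conjI allI impI)
    have wW: "w \<in> W" using w by (simp add: F_def)
    show "A *v w - th (i + s) *s w \<in> W"
      using wW T_module_BM[OF TW dm_in_BM] sub vec.subspace_diff vec.subspace_scale by blast
    fix u assume "(A *v w - th (i + s) *s w) $ u \<noteq> 0"
    then have "(A *v w) $ u \<noteq> 0 \<or> w $ u \<noteq> 0" by auto
    then show "d \<le> dist x u + Suc i"
    proof
      assume "(A *v w) $ u \<noteq> 0"
      then obtain z where "(u, z) \<in> R" "w $ z \<noteq> 0" by (rule A_nonzero)
      then show ?thesis using w dist_neighbour[of u z x] by (fastforce simp: F_def)
    qed (use w in \<open>fastforce simp: F_def\<close>)
  next
    fix k assume k: "k \<le> d" "k < Suc i + s"
    then show "E k *v (A *v w - th (i + s) *s w) = 0"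
      using w by (cases "k = i + s") (auto simp: F_def matrix_vector_mult_diff_distrib E_vec_eigen[unfolded One_nat_def] vector_scalar_commute)
  qed
  have B: "B *v w - ts (d - i) *s w \<in> (case i of 0 \<Rightarrow> {0} | Suc j \<Rightarrow> F j)" if w: "w \<in> F i" for i w
  proof -
    have supp: "d < dist x u + i" if u: "(B *v w - ts (d - i) *s w) $ u \<noteq> 0" for u
    proof -
      have "d \<le> dist x u + i" using u w by (auto simp: F_def)
      moreover have "dist x u \<noteq> d - i" using u by auto
      ultimately show ?thesis using dist_le[of x u] by linarith
    qed
    show ?thesis
    proof (cases i)
      case 0
      then have "(B *v w - ts (d - i) *s w) $ u = 0" for u using supp[of u] dist_le[of x u] by fastforce
      then show ?thesis using 0 by (simp add: vec_eq_iff)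
    next
      case (Suc j)
      have wW: "w \<in> W" using w by (simp add: F_def)
      have "B *v w - ts (d - i) *s w \<in> F j"
        unfolding F_def
      proof (intro CollectI conjI allI impI)
        show "B *v w - ts (d - i) *s w \<in> W"
          using wW T_module_B[OF TW] sub vec.subspace_diff vec.subspace_scale by blast
        show "d \<le> dist x u + j" if "(B *v w - ts (d - i) *s w) $ u \<noteq> 0" for u
          using supp[OF that] Suc by simp
        fix k assume k: "k \<le> d" "k < j + s"
        have "E k *v (B *v w) = 0" using w k Suc by (intro E_B_vanish) (auto simp: F_def)
        moreover have "E k *v w = 0" using w k Suc by (auto simp: F_def)
        ultimately show "E k *v (B *v w - ts (d - i) *s w) = 0"
          by (simp add: matrix_vector_mult_diff_distrib vector_scalar_commute)
      qed
      then show ?thesis using Suc by simp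
    qed
  qed
  let ?S = "vec.span (\<Union>i. F i)"
  have "T_module R x ?S"
    using split_invariant[of F A "\<lambda>i. th (i + s)" B "\<lambda>i. ts (d - i)", OF A B]
    by (intro T_moduleI vec.subspace_span) auto
  moreover have "?S \<subseteq> W" by (rule vec.span_minimal[OF _ sub]) (auto simp: F_def)
  moreover have "v \<in> ?S"
  proof (intro vec.span_base UN_I[of 0])
    have "dist x u = d" if "v $ u \<noteq> 0" for u using v(2) that unfolding lev_def by blast
    then show "v \<in> F 0" using v(1) s by (auto simp: F_def)
  qed simp
  ultimately have "?S = W" using irreducibleD(3)[OF W] v(3) by blast
  then show ?thesis unfolding F_def by simp
qed

lemma span_vanish:
  assumes "w \<in> vec.span S" "\<And>v. v \<in> S \<Longrightarrow> M *v v = 0"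
  shows "(M :: complex^'v^'v) *v w = 0"
  using assms(1) by (induction rule: vec.span_induct_alt)
    (simp_all add: matrix_vector_right_distrib vector_scalar_commute assms(2))

text \<open>A nonzero \<open>v\<close> killed at the dual endpoint \<open>t\<close> could start a
  split decomposition with \<open>s = t + 1\<close>. All of \<open>W\<close> would then be killed by
  \<open>E t\<close>.\<close>

lemma irreducible_last_injective:
  assumes W: "irreducible_T_module R x W" and v: "v \<in> W" "v \<in> lev d"
    and 0: "E (dual_endpoint R E W) *v v = 0"
  shows "v = 0"
proof (rule ccontr)
  assume nz: "v \<noteq> 0"
  let ?t = "dual_endpoint R E W"
  obtain w where w: "w \<in> W" "E ?t *v w \<noteq> 0" "?t \<le> d"
    and low: "\<And>k v. v \<in> W \<Longrightarrow> k \<le> d \<Longrightarrow> k < ?t \<Longrightarrow> E k *v v = 0"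
    using dual_endpointE[OF irreducibleD(1,2)[OF W]] by blast
  have "E k *v v = 0" if "k \<le> d" "k < Suc ?t" for k
    using low[OF v(1)] 0 that less_antisym by blast
  note sub = irreducible_split_last[OF W v nz this]
  have "E ?t *v w = 0"
    by (rule span_vanish[OF subsetD[OF sub w(1)]]) (use w(3) in auto)
  then show False using w(2) by simp
qed

lemma endpoint_eq:
  assumes W: "irreducible_T_module R x W" and v: "v \<in> W" "v \<in> lev d" "v \<noteq> 0"
  shows "endpoint R x W = 2 * dual_endpoint R E W"
proof -
  let ?t = "dual_endpoint R E W" and ?r = "endpoint R x W"
  note TW = irreducibleD(1)[OF W]
  note sub = T_module_subspace[OF TW]
  note top = dual_endpoint_top[OF irreducibleD(1,2)[OF W]]
  obtain w where w: "w \<in> W" "E ?t *v w \<noteq> 0" "?t \<le> d"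
    and low: "\<And>k v. v \<in> W \<Longrightarrow> k \<le> d \<Longrightarrow> k < ?t \<Longrightarrow> E k *v v = 0"
    using dual_endpointE[OF irreducibleD(1,2)[OF W]] by blast
  obtain y u where y: "y \<in> W" "y $ u \<noteq> 0" "dist x u = ?r"
    and lowr: "\<And>v u. v \<in> W \<Longrightarrow> v $ u \<noteq> 0 \<Longrightarrow> ?r \<le> dist x u"
    using endpointE[OF irreducibleD(1,2)[OF W]] by blast
  have "2 * ?t \<le> ?r"
  proof (rule ccontr)
    assume less: "\<not> ?thesis"
    \<comment> \<open>A piece of the decomposition that is nonzero on level \<open>r\<close> has
      index \<open>i \<ge> d - r\<close>. For \<open>r < 2 * t\<close> it is killed by
      \<open>E k\<close> for all \<open>k \<le> d - t\<close>, and \<open>W\<close> has no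
      components beyond \<open>d - t\<close>.\<close>
    have "Es ?r *v y = 0"
    proof (rule span_vanish[OF subsetD[OF irreducible_split_last[OF W v low[OF v(1)]] y(1)]])
      fix z assume "z \<in> (\<Union>i. {v \<in> W. (\<forall>u. v $ u \<noteq> 0 \<longrightarrow> d \<le> dist x u + i) \<and> (\<forall>k\<le>d. k < i + ?t \<longrightarrow> E k *v v = 0)})"
      then obtain i where z: "z \<in> W" "\<And>u. z $ u \<noteq> 0 \<Longrightarrow> d \<le> dist x u + i"
        "\<And>k. k \<le> d \<Longrightarrow> k < i + ?t \<Longrightarrow> E k *v z = 0" by auto
      have "z $ u = 0" if u: "dist x u = ?r" for u
      proof (rule ccontr)
        assume nz: "z $ u \<noteq> 0"
        then have "d \<le> ?r + i" using z(2) u by metis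
        then have "d - ?t < i + ?t" using less by linarith
        then have "E k *v z = 0" if "k \<le> d" for k
          using z(3)[OF that] top(2)[OF z(1) that] by linarith
        then have "z = 0" by (rule E_all_zero)
        then show False using nz by simp
      qed
      then show "Es ?r *v z = 0" by (simp add: vec_eq_iff)
    qed
    then have "(Es ?r *v y) $ u = 0" by simp
    then show False using y by simp
  qed
  moreover have "?r \<le> 2 * ?t"
  proof -
    \<comment> \<open>The opposite split decomposition, growing out of \<open>E t\<close>: now
      \<open>B\<close> raises the index and \<open>A\<close> lowers it.\<close>
    define F where "F i = {v \<in> W. (\<forall>k\<le>d. ?t + i < k \<longrightarrow> E k *v v = 0) \<and> (\<forall>u. v $ u \<noteq> 0 \<longrightarrow> dist x u + i \<le> d)}" for i
    have B: "B *v w - ts (d - i) *s w \<in> F (Suc i)" if w: "w \<in> F i" for i w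
      unfolding F_def
    proof (intro CollectI conjI allI impI)
      have wW: "w \<in> W" using w by (simp add: F_def)
      show "B *v w - ts (d - i) *s w \<in> W"
        using wW T_module_B[OF TW] sub vec.subspace_diff vec.subspace_scale by blast
      fix u assume u: "(B *v w - ts (d - i) *s w) $ u \<noteq> 0"
      then have "dist x u + i \<le> d" using w by (auto simp: F_def)
      moreover have "dist x u \<noteq> d - i" using u by auto
      ultimately show "dist x u + Suc i \<le> d" by linarith
    next
      fix k assume k: "k \<le> d" "?t + Suc i < k"
      have "E k *v (B *v w) = 0" using w k by (intro E_B_vanish) (auto simp: F_def)
      moreover have "E k *v w = 0" using w k by (auto simp: F_def)
      ultimately show "E k *v (B *v w - ts (d - i) *s w) = 0"
        by (simp add: matrix_vector_mult_diff_distrib vector_scalar_commute)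
    qed
    have A: "A *v w - th (?t + i) *s w \<in> (case i of 0 \<Rightarrow> {0} | Suc j \<Rightarrow> F j)" if w: "w \<in> F i" for i w
    proof -
      have wW: "w \<in> W" using w by (simp add: F_def)
      have E: "E k *v (A *v w - th (?t + i) *s w) = 0" if k: "k \<le> d" "?t + i \<le> k" for k
        using w k by (cases "k = ?t + i")
          (auto simp: F_def matrix_vector_mult_diff_distrib E_vec_eigen[unfolded One_nat_def] vector_scalar_commute)
      have inW: "A *v w - th (?t + i) *s w \<in> W"
        using wW T_module_BM[OF TW dm_in_BM] sub vec.subspace_diff vec.subspace_scale by blast
      show ?thesis
      proof (cases i)
        case 0
        have "A *v w - th (?t + i) *s w = 0"
        proof (rule E_all_zero)
          fix k assume k: "k \<le> d"
          show "E k *v (A *v w - th (?t + i) *s w) = 0"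
            using E[OF k] low[OF inW k] 0 by (cases "k < ?t") simp_all
        qed
        then show ?thesis using 0 by simp
      next
        case (Suc j)
        have "A *v w - th (?t + i) *s w \<in> F j"
          unfolding F_def
        proof (intro CollectI conjI allI impI)
          show "E k *v (A *v w - th (?t + i) *s w) = 0" if "k \<le> d" "?t + j < k" for k
            using E that Suc by simp
          fix u assume "(A *v w - th (?t + i) *s w) $ u \<noteq> 0"
          then have "(A *v w) $ u \<noteq> 0 \<or> w $ u \<noteq> 0" by auto
          then show "dist x u + j \<le> d"
          proof
            assume "(A *v w) $ u \<noteq> 0"
            then obtain z where "(u, z) \<in> R" "w $ z \<noteq> 0" by (rule A_nonzero)
            then show ?thesis using w Suc dist_neighbour[of u z x] by (fastforce simp: F_def)
          qed (use w Suc in \<open>fastforce simp: F_def\<close>)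
        qed (rule inW)
        then show ?thesis using Suc by simp
      qed
    qed
    let ?S = "vec.span (\<Union>i. F i)"
    have "T_module R x ?S"
      using split_invariant[of F B "\<lambda>i. ts (d - i)" A "\<lambda>i. th (?t + i)", OF B A]
      by (intro T_moduleI vec.subspace_span) auto
    moreover have "?S \<subseteq> W" by (rule vec.span_minimal[OF _ sub]) (auto simp: F_def)
    moreover have "E ?t *v w \<in> ?S"
    proof (intro vec.span_base UN_I[of 0])
      have "E k *v (E ?t *v w) = 0" if "k \<le> d" "?t < k" for k
        using E_orth[of k ?t] that w(3) by (simp add: matrix_vector_mul_assoc)
      then show "E ?t *v w \<in> F 0"
        using T_module_BM[OF TW E_in_BM[OF w(3)] w(1)] dist_le by (simp add: F_def)
    qed simp
    ultimately have S: "?S = W" using irreducibleD(3)[OF W] w(2) by blast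
    obtain y where y: "y \<in> W" "E (d - ?t) *v y \<noteq> 0" using top(1) by blast
    show ?thesis
    proof (rule ccontr)
      assume less: "\<not> ?r \<le> 2 * ?t"
      \<comment> \<open>A nonzero piece has \<open>r + i \<le> d\<close>, so for
        \<open>r > 2 * t\<close> its last component \<open>t + i\<close> stays below
        \<open>d - t\<close>.\<close>
      have "E (d - ?t) *v y = 0"
      proof (rule span_vanish[OF y(1)[folded S]])
        fix z assume "z \<in> (\<Union>i. F i)"
        then obtain i where z: "z \<in> F i" by blast
        show "E (d - ?t) *v z = 0"
        proof (cases "z = 0")
          case False
          then obtain u where "z $ u \<noteq> 0" by (auto simp: vec_eq_iff)
          then have "?r + i \<le> d" using z lowr[of z u] by (fastforce simp: F_def)
          then have "?t + i < d - ?t" using less by linarith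
          then show ?thesis using z by (simp add: F_def)
        qed simp
      qed
      then show False using y(2) by simp
    qed
  qed
  ultimately show ?thesis by simp
qed

text \<open>The value for which \<open>v \<in> E\<^sub>d\<^sup>*W\<close> satisfies \<open>E\<^sub>t (T - lam t) v = 0\<close>; it is read off from
  \<open>(A\<^sup>* - \<theta>\<^sup>*\<^bsub>d-2\<^esub>) (A - \<theta>\<^bsub>t+1\<^esub>) (A - \<theta>\<^sub>t) v\<close>.\<close>

definition lam :: "nat \<Rightarrow> complex" where
  "lam t = th t * (th t + th (t + 1)) * (ts (d - 1) - ts (d - 2)) / (ts d - ts (d - 2)) - th t * th (t + 1)"

lemma T_eigenvalue:
  assumes W: "irreducible_T_module R x W" and v: "v \<in> W" "v \<in> lev d"
  shows "T *v v = lam (dual_endpoint R E W) *s v"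
proof -
  let ?t = "dual_endpoint R E W"
  note TW = irreducibleD(1)[OF W]
  note sub = T_module_subspace[OF TW]
  obtain w where w: "?t \<le> d" and low: "\<And>k v. v \<in> W \<Longrightarrow> k \<le> d \<Longrightarrow> k < ?t \<Longrightarrow> E k *v v = 0"
    using dual_endpointE[OF irreducibleD(1,2)[OF W]] by blast
  define p q where "p = th ?t" and "q = th (?t + 1)"
  define e where "e = ts d - ts (d - 2)"
  define f where "f = (p + q) * (ts (d - 1) - ts (d - 2))"
  have e: "e \<noteq> 0" unfolding e_def using ts_neq[of d "d - 2"] d_ge by simp
  \<comment> \<open>\<open>x1\<close> is \<open>v\<close> after the factor \<open>A - p\<close> and
    \<open>x2\<close> is \<open>v\<close> after both \<open>A - p\<close> and \<open>A - q\<close>.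
    They are killed by \<open>E k\<close> for \<open>k\<close> up to \<open>t\<close> and up to
    \<open>t + 1\<close> respectively.\<close>
  define x1 where "x1 = A *v v - p *s v"
  define x2 where "x2 = A *v (A *v v) - (p + q) *s (A *v v) + (p * q) *s v"
  have AW: "A *v z \<in> W" if "z \<in> W" for z using T_module_BM[OF TW dm_in_BM that] .
  have x1W: "x1 \<in> W" and x2W: "x2 \<in> W"
    unfolding x1_def x2_def using v AW by (auto intro!: vec.subspace_diff[OF sub] vec.subspace_add[OF sub] vec.subspace_scale[OF sub])
  have Ex1: "E k *v x1 = (th k - p) *s (E k *v v)" if "k \<le> d" for k
    by (simp add: x1_def matrix_vector_mult_diff_distrib E_vec_eigen[OF that, unfolded One_nat_def]
        vector_scalar_commute vector_sub_rdistrib)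
  have Ex2: "E k *v x2 = ((th k - p) * (th k - q)) *s (E k *v v)" if "k \<le> d" for k
    by (simp add: x2_def matrix_vector_mult_diff_distrib matrix_vector_right_distrib E_vec_eigen[OF that, unfolded One_nat_def]
        vector_scalar_commute vec_eq_iff algebra_simps)
  have Ex2_0: "E k *v x2 = 0" if k: "k \<le> d" "k \<le> ?t + 1" for k
  proof -
    consider "k < ?t" | "k = ?t" | "k = ?t + 1" using k(2) by linarith
    then show ?thesis
    proof cases
      case 1
      then show ?thesis using Ex2[OF k(1)] low[OF v(1) k(1)] by simp
    next
      case 2
      then have "th k = p" by (simp add: p_def)
      then show ?thesis by (simp add: Ex2[OF k(1)])
    next
      case 3
      then have "th k = q" by (simp add: q_def)
      then show ?thesis by (simp add: Ex2[OF k(1)])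
    qed
  qed
  \<comment> \<open>Subtracting \<open>ts (d - 2)\<close> removes the part of \<open>x2\<close> on
    level \<open>d - 2\<close>, and \<open>f\<close> is chosen so that \<open>f *s x1\<close>
    cancels the part on level \<open>d - 1\<close>. Thus \<open>z\<close> lies on level
    \<open>d\<close>, where being killed by \<open>E t\<close> forces it to vanish.\<close>
  define z where "z = (B *v x2 - ts (d - 2) *s x2) + f *s x1"
  have "E ?t *v z = 0"
  proof -
    have "E ?t *v (B *v x2) = 0" using Ex2_0 w by (intro E_B_vanish) auto
    then show ?thesis unfolding z_def using Ex1[OF w] Ex2_0[OF w]
      by (simp add: matrix_vector_mult_diff_distrib matrix_vector_right_distrib vector_scalar_commute p_def)
  qed
  moreover have z: "z = e *s (T *v v - lam ?t *s v)"
  proof -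
    have A1: "A *v v \<in> lev (d - 1)" by (subst A_lev_up_d[OF v(2)]) simp
    define l where "l = Es (d - 2) *v (A *v (A *v v))"
    have AA: "A *v (A *v v) = l + T *v v"
      using A_lev_split[OF A1] d_ge T_on_lev[OF v(2)] by (simp add: l_def numeral_2_eq_2)
    have Bl: "B *v l = ts (d - 2) *s l" by (rule B_on_lev) (simp add: l_def)
    have BT: "B *v (T *v v) = ts d *s (T *v v)" by (rule B_on_lev) simp
    have lam: "e * lam ?t = f * p - e * (p * q)"
      using e by (simp add: lam_def p_def q_def f_def flip: e_def) (simp add: field_simps)
    have "z = e *s (T *v v) - (e * lam ?t) *s v"
      unfolding z_def lam x1_def x2_def AA
      by (simp add: matrix_vector_mult_diff_distrib matrix_vector_right_distrib vector_scalar_commute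
          Bl BT B_on_lev[OF A1, unfolded One_nat_def] B_on_lev[OF v(2)] vec_eq_iff del: B_vec)
         (simp add: e_def f_def algebra_simps)
    then show ?thesis by (simp add: vec_eq_iff algebra_simps)
  qed
  moreover have "z \<in> W"
    unfolding z_def using x1W x2W T_module_B[OF TW]
    by (auto intro!: vec.subspace_diff[OF sub] vec.subspace_add[OF sub] vec.subspace_scale[OF sub])
  moreover have "z \<in> lev d" unfolding z using T_lev[of v] v(2) by (simp add: lev_def)
  ultimately have "z = 0" using irreducible_last_injective[OF W, of z] by blast
  then have "e *s (T *v v - lam ?t *s v) = 0" using z by metis
  then show ?thesis using e unfolding vec.scale_eq_0_iff by simp
qed

end

section \<open>Widths and descendents\<close>

lemma qform_dist_matrix:
  assumes "Y \<subseteq> V"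
  shows "qform (dist_matrix V S i) Y = of_nat (card {(u, v). u \<in> Y \<and> v \<in> Y \<and> gdist S u v = i})"
proof -
  have "qform (dist_matrix V S i) Y = (\<Sum>u\<in>UNIV. \<Sum>v\<in>UNIV. if u \<in> Y \<and> v \<in> Y \<and> gdist S u v = i then 1 else 0)"
    unfolding qform_def matrix_vector_mult_def vec_lambda_beta sum_distrib_left
    using assms by (intro sum.cong refl) (auto simp: char_vec_def dist_matrix_def)
  also have "\<dots> = (\<Sum>p\<in>UNIV. if fst p \<in> Y \<and> snd p \<in> Y \<and> gdist S (fst p) (snd p) = i then 1 else 0)"
    by (simp add: sum.cartesian_product case_prod_unfold)
  also have "\<dots> = of_nat (card {(u, v). u \<in> Y \<and> v \<in> Y \<and> gdist S u v = i})"
    by (simp add: sum.If_cases case_prod_unfold)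
  finally show ?thesis .
qed

lemma qform_dist_matrix_nonzero:
  assumes "Y \<subseteq> V"
  shows "qform (dist_matrix V S i) Y \<noteq> 0 \<longleftrightarrow> (\<exists>u\<in>Y. \<exists>v\<in>Y. gdist S u v = i)"
  unfolding qform_dist_matrix[OF assms] of_nat_eq_0_iff by (auto simp: card_eq_0_iff)

lemma gdist_le_width:
  assumes "Y \<subseteq> V" "y \<in> Y" "z \<in> Y"
  shows "gdist S y z \<le> width V S Y"
  unfolding width_def qform_dist_matrix_nonzero[OF assms(1)]
  using assms diameter_of_bounds(1)[of V y z S] by (intro Max_ge) auto

lemma width_le:
  assumes "Y \<subseteq> V" "Y \<noteq> {}" "\<And>y z. y \<in> Y \<Longrightarrow> z \<in> Y \<Longrightarrow> gdist S y z \<le> n"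
  shows "width V S Y \<le> n"
proof -
  obtain y where "y \<in> Y" using assms(2) by blast
  then have "0 \<in> {i. i \<le> diameter_of V S \<and> (\<exists>u\<in>Y. \<exists>v\<in>Y. gdist S u v = i)}"
    by (auto intro!: bexI[of _ y])
  then show ?thesis
    unfolding width_def qform_dist_matrix_nonzero[OF assms(1)]
    using assms(3) by (subst Max_le_iff) auto
qed

lemma qform_restrict_mat:
  assumes "Y \<subseteq> H"
  shows "qform (restrict_mat H M) Y = qform M Y"
  unfolding qform_def matrix_vector_mult_def vec_lambda_beta sum_distrib_left
  using assms by (intro sum.cong refl) (auto simp: char_vec_def restrict_mat_def)

lemma qform_add: "qform (M + N) Y = qform M Y + qform N Y"
  by (simp add: qform_eq_cip matrix_vector_mult_add_rdistrib cip_add_right)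

lemma cip_self_nonneg: "cip v v \<in> \<real>\<^sub>\<ge>\<^sub>0"
  unfolding cip_self nonneg_Reals_of_real_iff by (simp add: sum_nonneg)

lemma cip_self_add_eq_0:
  assumes "cip u u + cip v v = 0"
  shows "u = 0" "v = 0"
proof -
  have "Re (cip u u) \<ge> 0" "Im (cip u u) = 0" "Re (cip v v) \<ge> 0" "Im (cip v v) = 0"
    using cip_self_nonneg[of u] cip_self_nonneg[of v] by (auto simp: complex_nonneg_Reals_iff)
  moreover have "Re (cip u u) + Re (cip v v) = 0" using arg_cong[OF assms, of Re] by simp
  ultimately have "cip u u = 0" "cip v v = 0" by (auto simp: complex_eq_iff)
  then show "u = 0" "v = 0" by (simp_all add: cip_self_eq_0)
qed

context bipartite_qpoly_base
begin

section \<open>The eigenspaces of the last subconstituent\<close>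

abbreviation U :: "nat \<Rightarrow> (complex^'v) set" where "U j \<equiv> U_space R E x (2 * j) j"

definition G :: "nat \<Rightarrow> (complex^'v) set" where
  "G j = (*v) (Es d) ` U j"

lemma last_idempotent_eq: "last_idempotent R E x j = orth_proj (G j)"
  by (simp add: last_idempotent_def G_def)

lemma subspace_U: "vec.subspace (U j)"
  by (simp add: U_space_def vec.subspace_span)

lemma subspace_G: "vec.subspace (G j)"
proof -
  note sub = subspace_U[of j]
  show ?thesis
    unfolding vec.subspace_def G_def
  proof (intro conjI ballI allI)
    show "0 \<in> (*v) (Es d) ` U j" using vec.subspace_0[OF sub] by (intro image_eqI[of _ _ 0]) auto
    fix u v assume "u \<in> (*v) (Es d) ` U j" "v \<in> (*v) (Es d) ` U j"
    then obtain u' v' where "u = Es d *v u'" "u' \<in> U j" "v = Es d *v v'" "v' \<in> U j" by blast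
    then show "u + v \<in> (*v) (Es d) ` U j"
      using vec.subspace_add[OF sub] by (intro image_eqI[of _ _ "u' + v'"]) (auto simp: matrix_vector_right_distrib)
  next
    fix c u assume "u \<in> (*v) (Es d) ` U j"
    then obtain u' where "u = Es d *v u'" "u' \<in> U j" by blast
    then show "c *s u \<in> (*v) (Es d) ` U j"
      using vec.subspace_scale[OF sub] by (intro image_eqI[of _ _ "c *s u'"]) (auto simp: vector_scalar_commute)
  qed
qed

lemma U_induct [consumes 1, case_names zero step]:
  assumes u: "u \<in> U j" and zero: "Q 0"
    and step: "\<And>s W w u. irreducible_T_module R x W \<Longrightarrow> dual_endpoint R E W = j \<Longrightarrow> w \<in> W \<Longrightarrow> Q u \<Longrightarrow> Q (s *s w + u)"
  shows "Q u"
  using u unfolding U_space_def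
proof (induction rule: vec.span_induct_alt)
  case (step s w u)
  then show ?case using assms(3) by blast
qed (rule zero)

lemma T_on_G:
  assumes "v \<in> G j"
  shows "T *v v = lam j *s v"
proof -
  obtain u where u: "u \<in> U j" "v = Es d *v u" using assms by (auto simp: G_def)
  from u(1) have "T *v (Es d *v u) = lam j *s (Es d *v u)"
  proof (induction rule: U_induct)
    case (step s W w u)
    have "T *v (Es d *v w) = lam j *s (Es d *v w)"
      using T_eigenvalue[OF step(1) T_module_Es[OF irreducibleD(1)[OF step(1)] order_refl step(3)]] step(2) by simp
    then show ?case using step(4)
      by (simp add: matrix_vector_right_distrib vector_scalar_commute vec.scale_right_distrib)
  qed simp
  then show ?thesis using u by simp
qed

text \<open>Only irreducible modules that meet level \<open>d\<close> contribute. Such a module with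
  dual endpoint \<open>t\<close> has endpoint \<open>2 * t\<close>, so it lies in
  \<open>U t\<close>, and the symmetry of its dual support gives
  \<open>t \<le> d div 2\<close>.\<close>

lemma lev_d_decomposition:
  assumes "v \<in> lev d"
  obtains g where "v = (\<Sum>j\<le>d div 2. g j)" "\<And>j. g j \<in> G j"
proof -
  have "\<exists>g. Es d *v u = (\<Sum>j\<le>d div 2. g j) \<and> (\<forall>j. g j \<in> G j)"
    if "u \<in> vec.span (\<Union>{W. irreducible_T_module R x W})" for u
    using that
  proof (induction rule: vec.span_induct_alt)
    case base
    show ?case by (intro exI[of _ "\<lambda>_. 0"]) (simp add: vec.subspace_0[OF subspace_G])
  next
    case (step s w u)
    then obtain g where g: "Es d *v u = (\<Sum>j\<le>d div 2. g j)" "\<And>j. g j \<in> G j" by blast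
    obtain W where W: "irreducible_T_module R x W" "w \<in> W" using step by blast
    show ?case
    proof (cases "Es d *v w = 0")
      case True
      then show ?thesis using g by (intro exI[of _ g]) (simp add: matrix_vector_right_distrib vector_scalar_commute)
    next
      case False
      let ?t = "dual_endpoint R E W"
      have "Es d *v w \<in> W" using T_module_Es[OF irreducibleD(1)[OF W(1)] order_refl W(2)] .
      then have "endpoint R x W = 2 * ?t" using endpoint_eq[OF W(1)] False by simp
      then have "w \<in> U ?t" using W unfolding U_space_def by (intro vec.span_base) blast
      then have "Es d *v w \<in> G ?t" by (auto simp: G_def)
      then have G: "s *s (Es d *v w) + g ?t \<in> G ?t"
        using g(2) subspace_G vec.subspace_add vec.subspace_scale by blast
      have t: "?t \<le> d div 2" using dual_endpoint_top(3)[OF irreducibleD(1,2)[OF W(1)]] by linarith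
      define h where "h = g(?t := s *s (Es d *v w) + g ?t)"
      have "(\<Sum>j\<le>d div 2. h j) = h ?t + (\<Sum>j\<in>{..d div 2} - {?t}. h j)"
        using t by (intro sum.remove) auto
      also have "(\<Sum>j\<in>{..d div 2} - {?t}. h j) = (\<Sum>j\<in>{..d div 2} - {?t}. g j)"
        by (intro sum.cong) (auto simp: h_def)
      also have "h ?t + \<dots> = s *s (Es d *v w) + (g ?t + (\<Sum>j\<in>{..d div 2} - {?t}. g j))"
        by (simp add: h_def add.assoc)
      also have "g ?t + (\<Sum>j\<in>{..d div 2} - {?t}. g j) = (\<Sum>j\<le>d div 2. g j)"
        using t by (intro sum.remove[symmetric]) auto
      finally have "Es d *v (s *s w + u) = (\<Sum>j\<le>d div 2. h j)"
        using g(1) by (simp add: matrix_vector_right_distrib vector_scalar_commute)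
      moreover have "h j \<in> G j" for j using G g(2) by (simp add: h_def)
      ultimately show ?thesis by blast
    qed
  qed
  then have "\<exists>g. Es d *v v = (\<Sum>j\<le>d div 2. g j) \<and> (\<forall>j. g j \<in> G j)"
    using irreducible_span_UNIV by blast
  then show thesis using that Es_on_lev[OF assms, of d] by auto
qed

lemma adj_T: "adj T = T"
proof -
  have "cnj (T $ v $ u) = T $ u $ v" for u v
    using T_sym[of u v] T_nth_nonneg[of v u] by (auto simp: complex_nonneg_Reals_iff complex_eq_iff)
  then show ?thesis by (simp add: adj_def vec_eq_iff)
qed

lemma char_vec_lev_d: "Y \<subseteq> K \<Longrightarrow> char_vec Y \<in> lev d"
  by (auto simp: lev_def char_vec_def in_K)

context
  assumes conn_K: "has_diameter K R2 (d div 2)"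
begin

lemma diametral_pair: "\<exists>y\<in>K. \<exists>z\<in>K. dist z y = 2 * (d div 2)"
proof -
  have "K \<noteq> {}" "diameter_of K R2 = d div 2"
    using conn_K by (auto simp: has_diameter_def connected_graph_def)
  then obtain z y where "z \<in> K" "y \<in> K" "gdist R2 z y = d div 2"
    using diameter_of_bounds(2)[of K R2] by auto
  then show ?thesis using gdist_R2 by metis
qed

text \<open>For one vertex of a diametral pair, the covering radius bound requires more than
  \<open>d div 2\<close> different eigenvalues, and only the \<open>d div 2 + 1\<close> values of
  \<open>lam\<close> are available.\<close>

lemma lam_inj: "inj_on lam {..d div 2}"
proof -
  obtain y z where yz: "y \<in> K" "z \<in> K" "dist z y = 2 * (d div 2)" using diametral_pair by blast
  obtain g where g: "char_vec {z} = (\<Sum>j\<le>d div 2. g j)" "\<And>j. g j \<in> G j"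
    using lev_d_decomposition[OF char_vec_lev_d[of "{z}"]] yz by blast
  have "\<exists>z'\<in>{z}. dist z' y < 2 * card (lam ` {..d div 2})"
    by (rule covering_radius[OF _ _ g(1) T_on_G[OF g(2)]]) (use yz in auto)
  then have "card (lam ` {..d div 2}) \<ge> card {..d div 2}" using yz by simp
  then have "card (lam ` {..d div 2}) = card {..d div 2}" using card_image_le[of "{..d div 2}" lam] by simp
  then show ?thesis by (rule eq_card_imp_inj_on[rotated]) simp
qed

lemma G_orthogonal:
  assumes "i \<le> d div 2" "j \<le> d div 2" "i \<noteq> j" "g \<in> G i" "h \<in> G j"
  shows "cip g h = 0"
proof (cases "g = 0")
  case False
  have "cnj (lam i) * cip g v = cip (T *v g) v" for v
    by (simp add: T_on_G[OF assms(4)] cip_scale_left)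
  then have *: "cnj (lam i) * cip g v = cip g (T *v v)" for v
    by (simp add: cip_adj adj_T)
  have "cnj (lam i) * cip g g = lam i * cip g g"
    using *[of g] by (simp add: T_on_G[OF assms(4)] cip_scale_right)
  then have "cnj (lam i) = lam i" using False cip_self_eq_0[of g] by simp
  then have "lam i * cip g h = lam j * cip g h"
    using *[of h] by (simp add: T_on_G[OF assms(5)] cip_scale_right)
  moreover have "lam i \<noteq> lam j" using lam_inj assms by (auto dest: inj_onD)
  ultimately show ?thesis by simp
qed simp

text \<open>By orthogonality \<open>g j\<close> is the projection of the characteristic vector to
  \<open>G j\<close>. Hence the dual width is the largest \<open>j\<close> with \<open>g j\<close>
  nonzero.\<close>

lemma qform_last_idempotent:
  assumes chi: "char_vec Y = (\<Sum>j\<le>d div 2. g j)" and g: "\<And>j. g j \<in> G j" and j: "j \<le> d div 2"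
  shows "qform (last_idempotent R E x j) Y = cip (g j) (g j)" "cip (g j) (char_vec Y) = cip (g j) (g j)"
proof -
  have orth: "cip h (g i) = (if i = j then cip h (g j) else 0)" if "h \<in> G j" "i \<le> d div 2" for h i
  proof (cases "i = j")
    case False
    have "cip h (g i) = 0"
      by (rule G_orthogonal[OF j that(2) _ that(1) g]) (use False in simp)
    then show ?thesis unfolding if_not_P[OF False] .
  qed simp
  have cip: "cip h (char_vec Y) = cip h (g j)" if "h \<in> G j" for h
  proof -
    have "cip h (char_vec Y) = (\<Sum>i\<le>d div 2. if i = j then cip h (g j) else 0)"
      unfolding chi cip_sum_right by (intro sum.cong refl orth[OF that]) simp
    then show ?thesis using j by simp
  qed
  show "cip (g j) (char_vec Y) = cip (g j) (g j)" by (rule cip[OF g])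
  have "cip h (char_vec Y - g j) = 0" if "h \<in> G j" for h
    using cip[OF that] cip_add_right[of h "char_vec Y - g j" "g j"] by simp
  then have "orth_proj (G j) *v (char_vec Y - g j) = 0"
    by (intro orth_proj_kills[OF subspace_G]) (simp add: ocomp_def)
  then have "orth_proj (G j) *v char_vec Y = g j"
    using orth_proj_fixes[OF subspace_G g, of j] by (simp add: matrix_vector_mult_diff_distrib)
  then show "qform (last_idempotent R E x j) Y = cip (g j) (g j)"
    unfolding last_idempotent_eq using qform_hermitian_idempotent[OF orth_proj(1,2)[OF subspace_G]] by metis
qed

lemma descendent_last_subconstituent:
  assumes H: "H = P \<or> H = - P"
    and Y: "descendent H (dist2_edges R H) (halved_idempotent H d E) Y"
    and ne: "Y \<inter> K \<noteq> {}"
  shows "descendent K R2 (last_idempotent R E x) (Y \<inter> K)"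
    and "width K R2 (Y \<inter> K) = width H (dist2_edges R H) Y"
proof -
  let ?D = "d div 2" and ?RH = "dist2_edges R H" and ?F = "halved_idempotent H d E"
  let ?F' = "last_idempotent R E x"
  define w where "w = width H ?RH Y"
  have Hp: "v \<in> H \<longleftrightarrow> even (dist u v)" if "u \<in> H" for u v
    using H that even_dist[of u v] by auto
  have Y': "Y \<noteq> {}" "Y \<subseteq> H" using Y by (auto simp: descendent_def)
  then obtain y where "y \<in> H" by blast
  then have diam: "diameter_of H ?RH = ?D" using diameter_colour_class[of H y] Hp by blast
  have diamK: "diameter_of K R2 = ?D" using conn_K by (simp add: has_diameter_def)
  have dw: "w + dual_width H ?RH ?F Y = ?D" using Y diam by (simp add: descendent_def w_def)
  have Yw: "dist y z \<le> 2 * w" if "y \<in> Y" "z \<in> Y" for y z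
    using gdist_le_width[OF Y'(2) that, of ?RH] gdist_colour_class[OF Hp, of y z] that Y'(2) w_def by force
  have E_sq: "qform (E k) Y = cip (E k *v char_vec Y) (E k *v char_vec Y)" if "k \<le> d" for k
    using that by (intro qform_hermitian_idempotent) (simp_all add: hermitian_mat_iff_adj E_adj E_idem)
  \<comment> \<open>\<open>?D - w\<close> is the dual width of \<open>Y\<close>. The quadratic form
    of \<open>E j + E (d - j)\<close> is a sum of two squared norms, so both vectors vanish.\<close>
  have halved: "E j *v char_vec Y = 0 \<and> E (d - j) *v char_vec Y = 0" if j: "?D - w < j" "j \<le> ?D" for j
  proof -
    have "qform (?F j) Y = 0"
    proof (rule ccontr)
      assume "qform (?F j) Y \<noteq> 0"
      then have "j \<le> dual_width H ?RH ?F Y"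
        unfolding dual_width_def diam using j by (intro Max_ge) auto
      then show False using dw j by linarith
    qed
    then have *: "qform (if 2 * j = d then E j else E j + E (d - j)) Y = 0"
      unfolding halved_idempotent_def qform_restrict_mat[OF Y'(2)] .
    show ?thesis
    proof (cases "2 * j = d")
      case True
      then have "d - j = j" by simp
      then show ?thesis using * True E_sq[of j] by (simp add: cip_self_eq_0)
    next
      case False
      then show ?thesis using * E_sq[of j] E_sq[of "d - j"] j cip_self_add_eq_0 by (auto simp: qform_add)
    qed
  qed
  have perp: "cip v (char_vec Y) = 0"
    if W: "irreducible_T_module R x W" "?D - w < dual_endpoint R E W" "v \<in> W" for W v
  proof -
    let ?t = "dual_endpoint R E W"
    note TW = irreducibleD(1,2)[OF W(1)]
    have "cip v (char_vec Y) = cip v (\<Sum>k\<le>d. E k *v char_vec Y)" by (simp add: sum_E_vec)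
    also have "\<dots> = (\<Sum>k\<le>d. cip v (E k *v char_vec Y))" by (rule cip_sum_right)
    also have "\<dots> = 0"
    proof (intro sum.neutral ballI)
      fix k assume "k \<in> {..d}"
      then have k: "k \<le> d" by simp
      have sq: "cip v (E k *v char_vec Y) = cip (E k *v v) (char_vec Y)"
        using cip_adj[of "E k" v "char_vec Y"] E_adj[OF k] by simp
      \<comment> \<open>Between \<open>t\<close> and \<open>d - t\<close>, one of \<open>k\<close>
        and \<open>d - k\<close> lies between \<open>t\<close> and \<open>?D\<close>, that is, above
        the dual width of \<open>Y\<close>. Then \<open>halved\<close> applies.\<close>
      consider "k < ?t" | "d - ?t < k" | "?t \<le> k" "k \<le> ?D" | "?t \<le> d - k" "d - k \<le> ?D" by linarith
      then show "cip v (E k *v char_vec Y) = 0"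
      proof cases
        case 1
        then have "E k *v v = 0" using dual_endpointE[OF TW] W(3) k by metis
        then show ?thesis using sq by simp
      next
        case 2
        then show ?thesis using sq dual_endpoint_top(2)[OF TW W(3) k] by simp
      next
        case 3
        then show ?thesis using halved[of k] W(2) by simp
      next
        case 4
        then show ?thesis using halved[of "d - k"] W(2) k by simp
      qed
    qed
    finally show ?thesis .
  qed
  define Q where "Q = Y \<inter> K"
  have Q: "Q \<subseteq> K" "Q \<noteq> {}" "Q \<subseteq> Y" using ne by (auto simp: Q_def)
  have EsY: "Es d *v char_vec Y = char_vec Q" by (auto simp: vec_eq_iff char_vec_def Q_def in_K)
  obtain g where g: "char_vec Q = (\<Sum>j\<le>?D. g j)" "\<And>j. g j \<in> G j"
    using lev_d_decomposition[OF char_vec_lev_d[OF Q(1)]] by blast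
  note qf = qform_last_idempotent[OF g]
  have g0: "g j = 0" if j: "?D - w < j" "j \<le> ?D" for j
  proof -
    obtain u where u: "u \<in> U j" "g j = Es d *v u" using g(2)[of j] by (auto simp: G_def)
    \<comment> \<open>\<open>Es d\<close> keeps each summand of \<open>u\<close> in its own module
      of dual endpoint \<open>j\<close>, so \<open>perp\<close> applies. As the result is supported
      on \<open>K\<close>, \<open>Y\<close> may afterwards be replaced by \<open>Q\<close>.\<close>
    from u(1) have "cip (Es d *v u) (char_vec Y) = 0"
    proof (induction rule: U_induct)
      case (step s W v u)
      have "cip (Es d *v v) (char_vec Y) = 0"
        using perp[OF step(1) _ T_module_Es[OF irreducibleD(1)[OF step(1)] order_refl step(3)]] step(2) j by simp
      then show ?case using step(4)
        by (simp add: matrix_vector_right_distrib vector_scalar_commute cip_add_left cip_scale_left)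
    qed simp
    moreover have "cip (Es d *v u) (char_vec Y) = cip (Es d *v u) (char_vec Q)"
      unfolding cip_def by (intro sum.cong refl) (auto simp: char_vec_def Q_def in_K)
    ultimately show ?thesis using qf(2)[OF j(2)] u(2) cip_self_eq_0 by metis
  qed
  define m where "m = dual_width K R2 ?F' Q"
  define I where "I = {i. i \<le> ?D \<and> g i \<noteq> 0}"
  have mI: "m = Max I"
    unfolding m_def dual_width_def I_def diamK 
    by (intro arg_cong[of _ _ Max] Collect_cong) (auto simp: qf(1) cip_self_eq_0)
  have fin: "finite I" by (simp add: I_def)
  have "I \<noteq> {}"
  proof
    assume "I = {}"
    then have "char_vec Q = 0" unfolding g(1) I_def by (intro sum.neutral) auto
    moreover obtain q where "q \<in> Q" using Q(2) by blast
    then have "char_vec Q $ q = 1" by (simp add: char_vec_def)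
    ultimately show False by simp
  qed
  then have m: "m \<in> I" unfolding mI using fin by (rule Max_in[rotated])
  then have mw: "m \<le> ?D - w" using g0[of m] by (force simp: I_def)
  have chi: "char_vec Q = (\<Sum>j\<le>m. g j)"
    unfolding g(1)
  proof (rule sum.mono_neutral_right)
    show "{..m} \<subseteq> {..?D}" using m by (auto simp: I_def)
    show "\<forall>i\<in>{..?D} - {..m}. g i = 0" using Max_ge[OF fin] unfolding mI by (force simp: I_def)
  qed simp
  define w' where "w' = width K R2 Q"
  have "w' \<le> w"
    unfolding w'_def
  proof (rule width_le[OF Q(1,2)])
    fix y z assume "y \<in> Q" "z \<in> Q"
    then have "y \<in> K" "z \<in> K" "y \<in> Y" "z \<in> Y" using Q(1,3) by auto
    then show "gdist R2 y z \<le> w" using gdist_R2[of z y] Yw[of y z] by simp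
  qed
  moreover have "?D \<le> w' + m"
  proof -
    \<comment> \<open>Some \<open>z\<close> lies at full distance from \<open>y\<close>. As
      \<open>m + 1\<close> eigenvalues suffice for \<open>Q\<close> and distances in
      \<open>K\<close> are even, some \<open>q\<close> in \<open>Q\<close> is within
      \<open>2 * m\<close> of \<open>z\<close>, so \<open>y\<close> and \<open>q\<close> are far
      apart.\<close>
    obtain y where y: "y \<in> Q" using Q(2) by blast
    obtain y1 z1 where "y1 \<in> K" "z1 \<in> K" "dist z1 y1 = 2 * ?D" using diametral_pair by blast
    moreover have "y \<in> K" using y Q(1) by blast
    ultimately obtain z where z: "z \<in> K" "dist y z = 2 * ?D" by (rule eccentricity_K)
    have "\<exists>q\<in>Q. dist q z < 2 * card (lam ` {..m})"
      by (rule covering_radius[OF Q(1,2) chi T_on_G[OF g(2)]]) (use z in auto)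
    then obtain q where q: "q \<in> Q" "dist q z < 2 * card (lam ` {..m})" by blast
    moreover have "card (lam ` {..m}) \<le> m + 1" using card_image_le[of "{..m}" lam] by simp
    moreover have "even (dist q z)" using K_even q(1) Q(1) z(1) by blast
    ultimately have "dist q z \<le> 2 * m" by presburger
    moreover have "dist y q \<le> 2 * w'"
      using gdist_le_width[OF Q(1) y q(1), of R2] gdist_R2[OF subsetD[OF Q(1) q(1)] subsetD[OF Q(1) y]] unfolding w'_def by linarith
    ultimately show ?thesis using dist_triangle[of y z q] z(2) by linarith
  qed
  ultimately have "w' = w" "w' + m = ?D" using mw dw by linarith+
  then show "descendent K R2 ?F' (Y \<inter> K)" "width K R2 (Y \<inter> K) = width H ?RH Y"
    using Q diamK unfolding descendent_def Q_def[symmetric] w'_def[symmetric] m_def[symmetric] w_def[symmetric]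
    by simp_all
qed

end

end

theorem mainTheorem6:
  fixes R :: "'v::finite rel"
    and E :: "nat \<Rightarrow> complex^'v^'v"
    and d w :: nat
    and x :: 'v
    and P N H Y :: "'v set"
  assumes "distance_regular UNIV R"
    and "bipartition UNIV R P N"
    and "has_diameter UNIV R d"
    and "d \<ge> 6"
    and "Q_polynomial UNIV R E"
    and "has_diameter (sphere_at UNIV R d x) (dist2_edges R (sphere_at UNIV R d x)) (d div 2)"
    and "H = P \<or> H = N"
    and "descendent H (dist2_edges R H) (halved_idempotent H d E) Y"
    and "width H (dist2_edges R H) Y = w"
    and "Y \<inter> sphere_at UNIV R d x \<noteq> {}"
  shows "descendent (sphere_at UNIV R d x) (dist2_edges R (sphere_at UNIV R d x))
           (last_idempotent R E x) (Y \<inter> sphere_at UNIV R d x) \<and>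
         width (sphere_at UNIV R d x) (dist2_edges R (sphere_at UNIV R d x))
           (Y \<inter> sphere_at UNIV R d x) = w"
proof -
  obtain b c where bc: "\<And>x y. card {z. (y, z) \<in> R \<and> gdist R x z = gdist R x y + 1} = b (gdist R x y)"
    "\<And>x y. card {z. (y, z) \<in> R \<and> gdist R x z + 1 = gdist R x y} = c (gdist R x y)"
    using assms(1) unfolding distance_regular_def by auto
  have graph: "sym R" "irrefl R" "\<And>u v. (u, v) \<in> R\<^sup>*"
    using assms(1) unfolding distance_regular_def simple_graph_def connected_graph_def by auto
  have diam: "diameter_of UNIV R = d" using assms(3) by (simp add: has_diameter_def)
  obtain as bs cs :: "nat \<Rightarrow> complex" where Q:
    "bij_betw E {..d} {e. primitive_idempotent (bose_mesner UNIV R) e}"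
    "E 0 = mscale (1 / of_nat CARD('v)) (all_ones UNIV)"
    "\<And>i. i \<in> {1..d} \<Longrightarrow> bs (i - 1) * cs i \<noteq> 0"
    "\<And>i. i \<le> d \<Longrightarrow> hadamard (E 1) (E i) = mscale (1 / of_nat CARD('v))
           ((if i = 0 then 0 else mscale (bs (i - 1)) (E (i - 1)))
              + mscale (as i) (E i)
              + (if i = d then 0 else mscale (cs (i + 1)) (E (i + 1))))"
    using assms(5) unfolding Q_polynomial_def Let_def diam by blast
  have part: "P \<union> N = UNIV" "P \<inter> N = {}" "\<And>u v. (u, v) \<in> R \<Longrightarrow> (u \<in> P \<and> v \<in> N) \<or> (u \<in> N \<and> v \<in> P)"
    using assms(2) unfolding bipartition_def by auto
  have "N = - P" using part(1,2) by blast
  then have H: "H = P \<or> H = - P" using assms(7) by simp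
  interpret bipartite_qpoly_base R P b c d E as bs cs x
  proof unfold_locales
    show "(u \<in> P) = (v \<notin> P)" if "(u, v) \<in> R" for u v using part(2,3) that by blast
    show "gdist R u v \<le> d" for u v using diameter_of_bounds(1)[of UNIV u v R] diam by simp
    show "\<exists>u v. gdist R u v = d" using diameter_of_bounds(2)[of UNIV R] diam by auto
  qed (use graph bc assms(4) Q in auto)
  show ?thesis
    using descendent_last_subconstituent[OF assms(6) H assms(8,10)] assms(9) by simp
qed

end
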